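(* Let $X$ be the inverse limit of a tent map $T_s$, $s\in(\sqrt2,2]$, and let $L^1=\ldots l^1_2l^1_1$ and $L^2=\ldots l^2_2l^2_1$ be admissible left-infinite sequences such that there exists $n\in\mathbb N$ with $l^1_k=l^2_k$ for every $k>n$. Then the embeddings $\varphi_{L^1}$ and $\varphi_{L^2}$ of $X$ are equivalent.
   Context: Tent inverse limits. For $s\in(\sqrt2,2]$ let $T=T_s\colon[0,1]\to[0,1]$, $T_s(t)=\min\{st,s(1-t)\}$, $c=\frac12$, and $X=\{x=(\pi_i(x))_{i\le0}\in[0,1]^{-\mathbb N_0}: T(\pi_i(x))=\pi_{i+1}(x)\ \forall i<0\}$ with the product topology. Symbolics. $\#_1(w)$ is the number of ones of a word $w$. The kneading sequence is $\nu=c_1c_2\ldots$, $c_i=0$ if $T^i(c)\in[0,c]$, $c_i=1$ if $T^i(c)\in[c,1]$; if $T^n(c)=c$, $\nu$ is the smaller of $(c_1\ldots c_{n-1}0)^\infty,(c_1\ldots c_{n-1}1)^\infty$ in the parity-lexicographical order: for sequences (or words of equal length) first differing at index $k$, $s\prec t$ iff $s_k<t_k$ and $\#_1(s_1\ldots s_{k-1})$ is even, or $s_k>t_k$ and it is odd. A word $a_1\ldots a_n$ is admissible if $c_2\ldots c_{2+n-i}\preceq a_i\ldots a_n\preceq c_1\ldots c_{1+n-i}$ for all $i$. An infinite sequence is admissible if all its finite subwords are; additionally, sequences $0^\infty s_ks_{k+1}\ldots$ with $s_k=1$ and the part from $s_k$ on admissible (and the constant zero sequence) are called admissible. $X$ is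 identified with $\Sigma_{adm}/\!\sim$, where $\Sigma_{adm}$ is the set of admissible two-sided sequences $\ldots s_{-1}.s_0s_1\ldots$ and $s\sim t$ iff $s=t$ or they differ at exactly one index $k$ and $s_{k+1}s_{k+2}\ldots=t_{k+1}t_{k+2}\ldots=\nu$; the point $x$ corresponds to the class of $(x_i)$ with $x_i=0$ (resp. $1$) if $\pi_i(x)$ (for $i\le0$) or $T^i(\pi_0(x))$ (for $i>0$) lies in $[0,c]$ (resp. $[c,1]$). Left-infinite sequences are written $\overleftarrow s=\ldots s_2s_1$ ($s_j$ being the entry at index $-j$), and the basic arc $A(\overleftarrow s)$ is the set of points of $X$ having a representative with left part $\overleftarrow s$; it is an arc or a point. Embeddings. For an admissible left-infinite $L=\ldots l_2l_1$ put $\psi_L(\overleftarrow s)=\sum_{i\ge1}(-1)^{\#_1(l_i\ldots l_1)-\#_1(s_i\ldots s_1)}3^{-i}+\frac12$. The embedding $\varphi_L\colon X\to\mathbb R^2$ draws each basic arc $A(\overleftarrow s)$ as the horizontal segment $\pi_0(A(\overleftarrow s))\times\{\psi_L(\overleftarrow s)\}$; whenever two $\sim$-identified two-sided sequences differ only at an index $k<0$, the corresponding endpoints of the two basic arcs are joined by a semicircle, on the left if $\#_1$ of the word at indices $k+1,\ldots,-1$ is odd and on the right if it is even. Two embeddings $\varphi,\psi\colon K\to\mathbb R^2$ of a continuum $K$ are equivalent if $\psi\circ\varphi^{-1}\colon\varphi(K)\to\psi(K)$ can be extended to a homeomorphism of the plane. *)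

theory Defs
  imports "HOL-Analysis.Analysis"
begin

definition tent :: "real \<Rightarrow> real \<Rightarrow> real" where
  "tent s t = min (s * t) (s * (1 - t))"

(* The negative indices are reflected: the coordinate x i of a thread is pi_{-i}(x).
   The topology is the product topology, i.e. the one of the function type. *)
definition tent_limit :: "real \<Rightarrow> (nat \<Rightarrow> real) set" where
  "tent_limit s = {x. (\<forall>i. x i \<in> {0..1}) \<and> (\<forall>i. tent s (x (Suc i)) = x i)}"

(* pi_i(x) for i <= 0 and T^i(pi_0(x)) for i > 0 *)
definition coord :: "real \<Rightarrow> (nat \<Rightarrow> real) \<Rightarrow> int \<Rightarrow> real" where
  "coord s x i = (if i \<le> 0 then x (nat (- i)) else (tent s ^^ nat i) (x 0))"


section \<open>Symbolics\<close>

text \<open>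
  The symbols 0 and 1 are \<open>False\<close> and \<open>True\<close>; finite words are lists. One-sided sequences, both
  \<open>c\<^sub>1c\<^sub>2\<dots>\<close> and left-infinite \<open>\<dots>l\<^sub>2l\<^sub>1\<close>, are functions on \<^typ>\<open>nat\<close> of which only the values at
  positive arguments are meaningful. Two-sided sequences are functions on \<^typ>\<open>int\<close>.
\<close>

definition ones :: "bool list \<Rightarrow> nat" where
  "ones w = count_list w True"

definition plex_less :: "bool list \<Rightarrow> bool list \<Rightarrow> bool" where
  "plex_less u v \<longleftrightarrow> length u = length v \<and>
     (\<exists>k<length u. take k u = take k v \<and>
        (u ! k < v ! k \<and> even (ones (take k u)) \<or> u ! k > v ! k \<and> odd (ones (take k u))))"

definition plex_le :: "bool list \<Rightarrow> bool list \<Rightarrow> bool" where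
  "plex_le u v \<longleftrightarrow> u = v \<or> plex_less u v"

definition plex_less_seq :: "(nat \<Rightarrow> bool) \<Rightarrow> (nat \<Rightarrow> bool) \<Rightarrow> bool" where
  "plex_less_seq a b \<longleftrightarrow> (\<exists>n. plex_less (map a [1..<Suc n]) (map b [1..<Suc n]))"

(* the periodic sequence www..., with first entry at index 1 *)
definition periodic_seq :: "bool list \<Rightarrow> nat \<Rightarrow> bool" where
  "periodic_seq w i = w ! ((i - 1) mod length w)"

definition kneading :: "real \<Rightarrow> nat \<Rightarrow> bool" where
  "kneading s =
    (if \<exists>n\<ge>1. (tent s ^^ n) (1/2) = 1/2
     then let n = (LEAST n. n \<ge> 1 \<and> (tent s ^^ n) (1/2) = 1/2);
              w = map (\<lambda>i. (tent s ^^ i) (1/2) > 1/2) [1..<n];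
              u = periodic_seq (w @ [False]);
              v = periodic_seq (w @ [True])
          in if plex_less_seq u v then u else v
     else (\<lambda>i. (tent s ^^ i) (1/2) > 1/2))"

definition adm_word :: "real \<Rightarrow> bool list \<Rightarrow> bool" where
  "adm_word s w \<longleftrightarrow> (\<forall>i<length w.
     plex_le (map (kneading s) [2..<2 + (length w - i)]) (drop i w) \<and>
     plex_le (drop i w) (map (kneading s) [1..<1 + (length w - i)]))"

definition adm_two_sided :: "real \<Rightarrow> (int \<Rightarrow> bool) \<Rightarrow> bool" where
  "adm_two_sided s a \<longleftrightarrow>
     (\<forall>i j. adm_word s (map a [i..j])) \<or>
     (\<exists>k. a k \<and> (\<forall>i<k. \<not> a i) \<and> (\<forall>i j. k \<le> i \<longrightarrow> adm_word s (map a [i..j]))) \<or>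
     (\<forall>i. \<not> a i)"

(* the word l_j ... l_i *)
definition lword :: "(nat \<Rightarrow> bool) \<Rightarrow> nat \<Rightarrow> nat \<Rightarrow> bool list" where
  "lword l j i = rev (map l [i..<Suc j])"

definition adm_left :: "real \<Rightarrow> (nat \<Rightarrow> bool) \<Rightarrow> bool" where
  "adm_left s l \<longleftrightarrow>
     (\<forall>i\<ge>1. \<forall>j. adm_word s (lword l j i)) \<or>
     (\<exists>k\<ge>1. l k \<and> (\<forall>j>k. \<not> l j) \<and> adm_word s (lword l k 1)) \<or>
     (\<forall>j\<ge>1. \<not> l j)"

(* s ~ t with s and t distinct, differing at the index k only *)
definition identified_at :: "real \<Rightarrow> int \<Rightarrow> (int \<Rightarrow> bool) \<Rightarrow> (int \<Rightarrow> bool) \<Rightarrow> bool" where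
  "identified_at s k a b \<longleftrightarrow> a k \<noteq> b k \<and> (\<forall>i. i \<noteq> k \<longrightarrow> a i = b i) \<and>
     (\<forall>j\<ge>1. a (k + int j) = kneading s j)"

(* The admissible itineraries of x; they form the equivalence class that corresponds to x. *)
definition represents :: "real \<Rightarrow> (int \<Rightarrow> bool) \<Rightarrow> (nat \<Rightarrow> real) \<Rightarrow> bool" where
  "represents s a x \<longleftrightarrow> adm_two_sided s a \<and>
     (\<forall>i. coord s x i \<in> (if a i then {1/2..1} else {0..1/2}))"

definition left_part :: "(int \<Rightarrow> bool) \<Rightarrow> nat \<Rightarrow> bool" where
  "left_part a j = a (- int j)"

definition basic_arc :: "real \<Rightarrow> (nat \<Rightarrow> bool) \<Rightarrow> (nat \<Rightarrow> real) set" where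
  "basic_arc s l =
     {x \<in> tent_limit s. \<exists>a. represents s a x \<and> (\<forall>j\<ge>1. left_part a j = l j)}"


section \<open>Embeddings\<close>

definition height :: "(nat \<Rightarrow> bool) \<Rightarrow> (nat \<Rightarrow> bool) \<Rightarrow> real" where
  "height L l =
     (\<Sum>i. (-1) powi (int (ones (lword L (Suc i) 1)) - int (ones (lword l (Suc i) 1)))
            * (1 / 3 ^ Suc i)) + 1/2"

(* semicircle joining (t, y) and (t, z), to the left of the line through them if lf holds,
   to the right otherwise *)
definition semicircle :: "bool \<Rightarrow> real \<Rightarrow> real \<Rightarrow> real \<Rightarrow> (real \<times> real) set" where
  "semicircle lf t y z =
     {(u, v). (u - t)\<^sup>2 + (v - (y + z) / 2)\<^sup>2 = ((y - z) / 2)\<^sup>2 \<and> (if lf then u \<le> t else u \<ge> t)}"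

text \<open>
  \<open>drawn s L x\<close> is what stands for the point \<open>x\<close> in the picture that consists of the segments
  \<open>\<pi>\<^sub>0(A(l)) \<times> {\<psi>\<^sub>L(l)}\<close> and of the semicircles: a single point of a segment if \<open>x\<close> lies in only
  one basic arc, and the whole semicircle (with its two endpoints) if \<open>x\<close> is a common endpoint of
  two basic arcs.
\<close>

definition drawn :: "real \<Rightarrow> (nat \<Rightarrow> bool) \<Rightarrow> (nat \<Rightarrow> real) \<Rightarrow> (real \<times> real) set" where
  "drawn s L x =
     {(x 0, height L l) | l. x \<in> basic_arc s l} \<union>
     \<Union> {semicircle (odd (ones (map a [k + 1..-1]))) (x 0)
           (height L (left_part a)) (height L (left_part b)) | a b k.
           k < 0 \<and> represents s a x \<and> represents s b x \<and> identified_at s k a b}"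

text \<open>
  The picture determines a map on \<open>X\<close> only after a semicircle, whose two endpoints are the same
  point of \<open>X\<close>, is regarded as one point. So \<open>\<phi>\<close> is an embedding \<open>\<phi>\<^sub>L\<close> if it is read off the
  picture through a quotient map \<open>q\<close> of the plane onto the plane that collapses each semicircle and
  is otherwise injective. (Moore's decomposition theorem provides such quotient maps.) Two such
  \<open>q\<close> for the same \<open>L\<close> differ by a homeomorphism of the plane, hence \<open>\<phi>\<^sub>L\<close> is determined exactly up
  to equivalence of embeddings.
\<close>

definition is_phi :: "real \<Rightarrow> (nat \<Rightarrow> bool) \<Rightarrow> ((nat \<Rightarrow> real) \<Rightarrow> real \<times> real) \<Rightarrow> bool" where
  "is_phi s L \<phi> \<longleftrightarrow>
     embedding_map (top_of_set (tent_limit s)) euclidean \<phi> \<and>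
     (\<exists>q :: real \<times> real \<Rightarrow> real \<times> real. quotient_map euclidean euclidean q \<and>
        (\<forall>x\<in>tent_limit s. \<forall>p\<in>drawn s L x. q p = \<phi> x) \<and>
        (\<forall>p p'. q p = q p' \<longleftrightarrow>
           p = p' \<or> (\<exists>x\<in>tent_limit s. p \<in> drawn s L x \<and> p' \<in> drawn s L x)))"

definition equivalent_embeddings ::
    "'a::topological_space set \<Rightarrow> ('a \<Rightarrow> real \<times> real) \<Rightarrow> ('a \<Rightarrow> real \<times> real) \<Rightarrow> bool" where
  "equivalent_embeddings K f g \<longleftrightarrow>
     embedding_map (top_of_set K) euclidean f \<and>
     embedding_map (top_of_set K) euclidean g \<and>
     (\<exists>h :: real \<times> real \<Rightarrow> real \<times> real. homeomorphic_map euclidean euclidean h \<and>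
        (\<forall>p \<in> f ` K. h p = (g \<circ> inv_into K f) p))"

end

(*
  Write L' = ... l_3 l_2 for L = ... l_2 l_1, and let a thread y be prolonged to x = (..., y_{-1}, y_0, T(y_0)).
  By the recursion for the heights, the L-picture arises from the L'-picture by folding the plane along the
  vertical line through the turning point: one half is mapped to the band [2/3, 1], the other one to the
  band [0, 1/3], and the points on the line are blown up to the caps at the index -1. Undoing this fold is a
  quotient map of the plane onto itself whose only nontrivial fibres are caps of the L-picture. Hence phi_L,
  composed with the prolongation, is an embedding phi_L'. If the two given sequences agree beyond n, then
  after n steps both embeddings are read off the same picture through quotient maps with the same fibres,
  which differ by a homeomorphism of the plane.

  The fold stretches horizontally by s and shrinks vertically by 3, so that semicircles become half
  ellipses, whose aspect ratio changes from step to step. Caps may bulge over the turning line, where the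
  plane has to be cut; admissibility of the itineraries keeps such caps away from the arcs on the other side
  (cap_separated), and this leaves room for a cut by Lipschitz functions (cut_between).
*)
theory Submission
  imports Defs
begin

text \<open>The unfolding may collapse nothing but caps of the picture. It is glued exactly where
  the two cutting functions \<open>zm\<close> and \<open>zp\<close> agree, so they have to agree at
  the heights of the turning points in the picture and at no other height. The difficulty is thus
  quantitative. A height that deviates from both ends of a cap in an early symbol is separated from
  them by at least the distance of these ends, so a cap bulging over the turning line stays clear of
  the arcs of the other side in proportion to its size. This gives a cone condition of slope \<beta>
  = \<alpha>/(3s) between the two sides. Cutting functions of slope 6/5 \<beta> then meet only at
  common limit points of both sides, and the same estimates force these onto the turning line. The
  reserve is limited: pushing back a bulge costs another factor 7/6, and 7/6 * 6/5 = 7/5 has to stay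
  below sqrt 2, a bound for how fast the half ellipses around the fold move away from the line. That
  limit points on the line belong to the sides is borrowed from the picture after the fold.\<close>

text \<open>
  Half ellipses with horizontal semiaxis \<open>\<alpha>\<close> times the vertical one; the equation is the one of the
  ellipse with both of its terms in \<open>v\<close> factored.
\<close>

definition half_ellipse :: "real \<Rightarrow> bool \<Rightarrow> real \<Rightarrow> real \<Rightarrow> real \<Rightarrow> (real \<times> real) set" where
  "half_ellipse \<alpha> lf t y z =
     {(u, v). (u - t)\<^sup>2 = \<alpha>\<^sup>2 * ((v - y) * (z - v)) \<and> (if lf then u \<le> t else u \<ge> t)}"

subsection \<open>Maps that preserve horizontal lines\<close>

text \<open>Surjectivity is the intermediate value theorem on each line. Closedness: the bounds
  \<open>a\<close>, \<open>b\<close> chosen at the limit height also work at nearby heights, so the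
  preimages of a convergent sequence stay in a compact strip. Monotonicity is weak on purpose, as
  segments of a line may be collapsed.\<close>

lemma slice_map_quotient:
  fixes f :: "real \<times> real \<Rightarrow> real"
  assumes cont: "continuous_on UNIV f"
    and mono: "\<And>u u' v. u \<le> u' \<Longrightarrow> f (u, v) \<le> f (u', v)"
    and up: "\<And>v M. \<exists>u. M < f (u, v)" and down: "\<And>v M. \<exists>u. f (u, v) < M"
  shows "quotient_map euclidean euclidean (\<lambda>p. (f p, snd p))"
proof (rule continuous_closed_imp_quotient_map)
  let ?F = "\<lambda>p. (f p, snd p)"
  have contF: "continuous_on UNIV ?F"
    by (intro continuous_intros cont)
  then show "continuous_map euclidean euclidean ?F"
    by (simp add: continuous_map_iff_continuous2)
  show "?F ` topspace euclidean = topspace euclidean"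
  proof -
    have "\<exists>u. f (u, v) = t" for v t
    proof -
      obtain a b where ab: "f (a, v) < t" "t < f (b, v)"
        using up down by blast
      have "a \<le> b"
        using mono[of b a v] ab by linarith
      moreover have "continuous_on {a..b} (\<lambda>u. f (u, v))"
        by (rule continuous_on_compose2[OF cont]) (auto intro!: continuous_intros)
      ultimately show ?thesis
        using IVT'[of "\<lambda>u. f (u, v)" a t b] ab by auto
    qed
    then have "\<exists>p. q = ?F p" for q
      by (metis fst_conv snd_conv prod.collapse)
    then show ?thesis
      by (simp only: topspace_euclidean surj_def) blast
  qed
  show "closed_map euclidean euclidean ?F"
    unfolding closed_map_def
  proof (intro allI impI)
    fix S :: "(real \<times> real) set"
    assume "closedin euclidean S"
    then have S: "closed S" by simp
    have "closed (?F ` S)"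
      unfolding closed_sequential_limits
    proof (intro allI impI, elim conjE)
      fix y l
      assume y: "\<forall>n. y n \<in> ?F ` S" and lim: "y \<longlonglongrightarrow> l"
      obtain p where p: "\<And>n. p n \<in> S" "\<And>n. y n = ?F (p n)"
        using y by (auto simp: image_iff) metis
      have limf: "(\<lambda>n. f (p n)) \<longlonglongrightarrow> fst l" and lims: "(\<lambda>n. snd (p n)) \<longlonglongrightarrow> snd l"
        using tendsto_fst[OF lim] tendsto_snd[OF lim] p(2) by auto
      obtain a b where ab: "f (a, snd l) < fst l - 1" "fst l + 1 < f (b, snd l)"
        using up down by blast
      have fl: "(\<lambda>n. f (x, snd (p n))) \<longlonglongrightarrow> f (x, snd l)" for x
        using continuous_on_tendsto_compose[OF cont tendsto_Pair[OF tendsto_const lims]] by simp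
      have "eventually (\<lambda>n. f (p n) > fst l - 1) sequentially"
          "eventually (\<lambda>n. f (p n) < fst l + 1) sequentially"
        using order_tendstoD[OF limf] by auto
      moreover have "eventually (\<lambda>n. f (a, snd (p n)) < fst l - 1) sequentially"
          "eventually (\<lambda>n. f (b, snd (p n)) > fst l + 1) sequentially"
        using order_tendstoD[OF fl[of a]] order_tendstoD[OF fl[of b]] ab by auto
      ultimately have "eventually (\<lambda>n. a \<le> fst (p n) \<and> fst (p n) \<le> b) sequentially"
      proof eventually_elim
        case (elim n)
        have "\<not> fst (p n) \<le> a" "\<not> b \<le> fst (p n)"
          using elim mono[of "fst (p n)" a "snd (p n)"] mono[of b "fst (p n)" "snd (p n)"] by auto
        then show ?case by simp
      qed
      then obtain N where N: "\<And>n. n \<ge> N \<Longrightarrow> fst (p n) \<in> {a..b}"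
        by (auto simp: eventually_sequentially)
      then obtain l' r where r: "strict_mono r" "((\<lambda>n. fst (p (n + N))) \<circ> r) \<longlonglongrightarrow> l'"
        using compact_Icc[of a b, unfolded compact_def, rule_format, of "\<lambda>n. fst (p (n + N))"]
            by auto
      have rN: "filterlim (\<lambda>n. r n + N) at_top sequentially"
        using filterlim_subseq[OF r(1)] by (rule filterlim_at_top_mono) auto
      have "(\<lambda>n. snd (p (r n + N))) \<longlonglongrightarrow> snd l"
        using filterlim_compose[OF lims rN] .
      then have "(\<lambda>n. (fst (p (r n + N)), snd (p (r n + N)))) \<longlonglongrightarrow> (l', snd l)"
        using r(2) by (intro tendsto_Pair) (auto simp: o_def)
      then have pl: "(\<lambda>n. p (r n + N)) \<longlonglongrightarrow> (l', snd l)"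
        by simp
      then have "(l', snd l) \<in> S"
        using closed_sequentially[OF S, of "\<lambda>n. p (r n + N)"] p(1) by blast
      moreover have "(\<lambda>n. f (p (r n + N))) \<longlonglongrightarrow> f (l', snd l)"
        using cont pl by (intro continuous_on_tendsto_compose[of UNIV f]) auto
      then have "f (l', snd l) = fst l"
        using filterlim_compose[OF limf rN] LIMSEQ_unique by blast
      ultimately show "l \<in> ?F ` S"
        by (metis (no_types, lifting) image_eqI prod.collapse snd_conv)
    qed
    then show "closedin euclidean (?F ` S)" by simp
  qed
qed

text \<open>For \<open>H\<close> \<ge> 0 this translates by - \<open>H\<close> up to the abscissa
  \<open>H\<close> and is the identity beyond 7/6 * \<open>H\<close>; the piece of slope 7 in
  between joins the two.\<close>

definition push :: "(real \<Rightarrow> real) \<Rightarrow> real \<times> real \<Rightarrow> real" where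
  "push H p = max (fst p - H (snd p)) (min (fst p) (7 * (fst p - H (snd p))))"

lemma push_strict: "u < u' \<Longrightarrow> push H (u, z) < push H (u', z)"
  by (auto simp: push_def max_def min_def)

lemma push_quotient:
  assumes "continuous_on UNIV H" "\<And>z. 0 \<le> H z"
  shows "quotient_map euclidean euclidean (\<lambda>p. (push H p, snd p))"
proof (rule slice_map_quotient)
  show "continuous_on UNIV (push H)"
    unfolding push_def by (intro continuous_intros continuous_on_compose2[OF assms(1)]) auto
  show "push H (u, v) \<le> push H (u', v)" if "u \<le> u'" for u u' v
    using that push_strict[of u u' H v] by (cases "u = u'") auto
  show "\<exists>u. M < push H (u, v)" for v M
    by (rule exI[of _ "M + H v + 1"]) (auto simp: push_def max_def)
  show "\<exists>u. push H (u, v) < M" for v M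
    using assms(2)[of v] by (intro exI[of _ "M - 1"]) (auto simp: push_def max_def min_def)
qed

text \<open>Abscissa of the innermost half ellipse, with vertical semiaxis 1/6, which belongs to
  height 0 before the fold; it is 0 at the heights of the arms.\<close>

definition cap_start :: "real \<Rightarrow> real \<Rightarrow> real" where
  "cap_start \<alpha> z = \<alpha> * sqrt (max (z\<^sup>2) (1/36) - z\<^sup>2)"

text \<open>To the right of \<open>cap_start\<close> the value depends only on the half ellipse
  through the point: semiaxis R goes to 3 R - 1/2, the height that is folded to it. To the left the
  slope is 1, so that distances along the arms survive.\<close>

definition flatten :: "real \<Rightarrow> real \<times> real \<Rightarrow> real" where
  "flatten \<alpha> p = 3 * sqrt ((max (fst p) (cap_start \<alpha> (snd p)) / \<alpha>)\<^sup>2 + (snd p)\<^sup>2) - 1/2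
      + min (fst p - cap_start \<alpha> (snd p)) 0"

lemma cap_start_nonneg: "0 < \<alpha> \<Longrightarrow> 0 \<le> cap_start \<alpha> z"
  by (simp add: cap_start_def)

lemma flatten_strict:
  assumes "0 < \<alpha>" "u < u'"
  shows "flatten \<alpha> (u, z) < flatten \<alpha> (u', z)"
proof (cases "u' \<le> cap_start \<alpha> z")
  case True
  then show ?thesis using assms by (simp add: flatten_def max_def min_def)
next
  case False
  have "0 \<le> max u (cap_start \<alpha> z)" "max u (cap_start \<alpha> z) < max u' (cap_start \<alpha> z)"
    using cap_start_nonneg[OF assms(1), of z] False assms by auto
  then have "(max u (cap_start \<alpha> z) / \<alpha>)\<^sup>2 < (max u' (cap_start \<alpha> z) / \<alpha>)\<^sup>2"
    using assms(1) by (intro power_strict_mono divide_strict_right_mono divide_nonneg_pos) auto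
  then have
      "sqrt ((max u (cap_start \<alpha> z) / \<alpha>)\<^sup>2 + z\<^sup>2) < sqrt ((max u' (cap_start \<alpha> z) / \<alpha>)\<^sup>2 + z\<^sup>2)"
    by simp
  moreover have "min (u - cap_start \<alpha> z) 0 \<le> min (u' - cap_start \<alpha> z) 0"
    using assms(2) by auto
  ultimately show ?thesis unfolding flatten_def fst_conv snd_conv
      by (intro add_less_le_mono diff_strict_right_mono mult_strict_left_mono) (assumption | simp)+
qed

lemma flatten_quotient:
  assumes "0 < \<alpha>"
  shows "quotient_map euclidean euclidean (\<lambda>p. (flatten \<alpha> p, snd p))"
proof (rule slice_map_quotient)
  show "continuous_on UNIV (flatten \<alpha>)"
    unfolding flatten_def cap_start_def using assms by (intro continuous_intros) auto
  show "flatten \<alpha> (u, v) \<le> flatten \<alpha> (u', v)" if "u \<le> u'" for u u' v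
    using that flatten_strict[OF assms, of u u' v] by (cases "u = u'") auto
  show "\<exists>u. M < flatten \<alpha> (u, v)" for v M
  proof (intro exI)
    let ?u = "max (cap_start \<alpha> v) (\<alpha> * (\<bar>M\<bar> + 1))"
    have a: "\<bar>M\<bar> + 1 \<le> ?u / \<alpha>" using assms by (simp add: field_simps)
    then have "0 \<le> ?u / \<alpha>" by linarith
    then have "?u / \<alpha> \<le> sqrt ((?u / \<alpha>)\<^sup>2 + v\<^sup>2)"
      by (metis real_sqrt_sum_squares_ge1)
    moreover have "flatten \<alpha> (?u, v) = 3 * sqrt ((?u / \<alpha>)\<^sup>2 + v\<^sup>2) - 1/2"
      unfolding flatten_def fst_conv snd_conv by (auto simp: max_absorb1)
    ultimately show "M < flatten \<alpha> (?u, v)"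
      using a by linarith
  qed
  show "\<exists>u. flatten \<alpha> (u, v) < M" for v M
  proof (intro exI)
    let ?c = "cap_start \<alpha> v"
    let ?u = "?c - \<bar>M\<bar> - 3 * sqrt ((?c / \<alpha>)\<^sup>2 + v\<^sup>2)"
    have "0 \<le> sqrt ((?c / \<alpha>)\<^sup>2 + v\<^sup>2)" by simp
    then have "max ?u ?c = ?c" "min (?u - ?c) 0 = ?u - ?c"
        by (linarith | simp only: max_def min_def)+
    then have "flatten \<alpha> (?u, v) = - \<bar>M\<bar> - 1/2"
      unfolding flatten_def fst_conv snd_conv by simp
    then show "flatten \<alpha> (?u, v) < M" by linarith
  qed
qed

lemma flatten_cap:
  assumes "0 < \<alpha>" "1/6 \<le> R" "\<bar>z\<bar> \<le> R"
  shows "flatten \<alpha> (\<alpha> * sqrt (R\<^sup>2 - z\<^sup>2), z) = 3 * R - 1/2"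
proof -
  have "z\<^sup>2 \<le> R\<^sup>2" using assms by (metis abs_ge_zero power2_abs power_mono)
  moreover have "1/36 \<le> R\<^sup>2" using power_mono[of "1/6" R 2] assms(2) by (simp add: power2_eq_square)
  ultimately have "cap_start \<alpha> z \<le> \<alpha> * sqrt (R\<^sup>2 - z\<^sup>2)"
    unfolding cap_start_def using assms(1) by (intro mult_left_mono real_sqrt_le_mono) auto
  then show ?thesis
    using assms \<open>z\<^sup>2 \<le> R\<^sup>2\<close> by (simp add: flatten_def max_absorb1)
qed

lemma flatten_arm:
  assumes "0 < \<alpha>" "1/6 \<le> \<bar>z\<bar>" "u \<le> 0"
  shows "flatten \<alpha> (u, z) = 3 * \<bar>z\<bar> - 1/2 + u"
proof -
  have "1/36 \<le> z\<^sup>2" using power_mono[of "1/6" "\<bar>z\<bar>" 2] assms(2) by (simp add: power2_eq_square)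
  then have "cap_start \<alpha> z = 0" by (simp add: cap_start_def)
  then show ?thesis using assms by (simp add: flatten_def max_absorb2 min_absorb1)
qed

text \<open>
  Only \<open>radius y = y / 3 + 1/6\<close> for \<open>y \<ge> 0\<close> matters, the half width of the fold at height \<open>y\<close>; the
  exponential lets the chords of half width \<open>radius y\<close>, \<open>y\<close> real, fill the plane.
\<close>

definition radius :: "real \<Rightarrow> real" where
  "radius y = exp (min y 0) / 6 + max y 0 / 3"

definition level :: "real \<Rightarrow> real" where
  "level z = ln (6 * min z (1/6)) + 3 * (max z (1/6) - 1/6)"

lemma radius_pos: "0 < radius y"
  by (simp add: radius_def add_pos_nonneg)

lemma radius_ge0: "0 \<le> y \<Longrightarrow> radius y = y / 3 + 1/6"
  by (simp add: radius_def min_absorb2 max_absorb1)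

lemma level_ge: "1/6 \<le> z \<Longrightarrow> level z = 3 * z - 1/2"
  by (simp add: level_def min_absorb2 max_absorb1)

lemma level_radius: "level (radius y) = y"
proof (cases "0 \<le> y")
  case True
  then show ?thesis by (simp add: radius_ge0 level_ge)
next
  case False
  then have r: "radius y = exp y / 6" by (simp add: radius_def min_absorb1 max_absorb2)
  then have "radius y \<le> 1/6" using False by simp
  moreover have "ln (6 * radius y) = y" by (simp add: r)
  ultimately show ?thesis by (simp add: level_def min_absorb1 max_absorb2)
qed

lemma level_strict: "0 < z \<Longrightarrow> z < z' \<Longrightarrow> level z < level z'"
proof -
  assume a: "0 < z" "z < z'"
  consider "z' \<le> 1/6" | "z \<le> 1/6" "1/6 < z'" | "1/6 < z" by linarith
  then show ?thesis
  proof cases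
    case 1 then show ?thesis using a by (simp add: level_def min_absorb1 max_absorb2)
  next
    case 2
    then have "ln (6 * z) \<le> 0" using a by simp
    then show ?thesis using 2
        by (simp add: level_def min_absorb1 min_absorb2 max_absorb1 max_absorb2)
  next
    case 3 then show ?thesis using a by (simp add: level_ge)
  qed
qed

lemma level_mono: "0 < z \<Longrightarrow> z \<le> z' \<Longrightarrow> level z \<le> level z'"
  using level_strict[of z z'] by (cases "z = z'") auto

text \<open>The arguments are the height z and the value u of \<open>flatten\<close>. On a chord the
  result runs from -1/2 to 1/2; beyond its ends \<open>level\<close> |z| - u is added or subtracted,
  which on an arm is the distance back to abscissa 0.\<close>

definition unroll :: "real \<times> real \<Rightarrow> real" where
  "unroll p = max (-1) (min 1 (fst p / radius (snd p))) / 2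
     + level (max (fst p) (radius (snd p))) - level (max (- fst p) (radius (snd p)))"

lemma unroll_top: "radius u \<le> z \<Longrightarrow> unroll (z, u) = 1/2 + level z - u"
  using radius_pos[of u] by (simp add: unroll_def level_radius min_absorb1 max_absorb1 max_absorb2)

lemma unroll_bottom: "radius u \<le> -z \<Longrightarrow> unroll (z, u) = -1/2 - level (-z) + u"
proof -
  assume a: "radius u \<le> -z"
  then have "z / radius u \<le> -1" using radius_pos[of u] by (simp add: field_simps)
  moreover have "max z (radius u) = radius u" using radius_pos[of u] a by simp
  ultimately show ?thesis using a by (simp add: unroll_def level_radius max_absorb1 min_absorb2)
qed

lemma unroll_mid:
  assumes "\<bar>z\<bar> \<le> radius u"
  shows "unroll (z, u) = z / radius u / 2"
proof -
  have "z / radius u \<le> 1" "- 1 \<le> z / radius u"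
    using radius_pos[of u] assms by (simp_all add: field_simps)
  moreover have "max z (radius u) = radius u" "max (-z) (radius u) = radius u"
    using assms by auto
  ultimately show ?thesis by (simp add: unroll_def level_radius)
qed

lemma unroll_strict:
  assumes "z < z'"
  shows "unroll (z, u) < unroll (z', u)"
proof -
  let ?r = "radius u"
  have r: "0 < ?r" by (rule radius_pos)
  have m: "level (max z ?r) \<le> level (max z' ?r)" "level (max (- z') ?r) \<le> level (max (- z) ?r)"
      "max (-1) (min 1 (z / ?r)) \<le> max (-1) (min 1 (z' / ?r))"
    using assms r by (intro level_mono max.mono min.mono divide_right_mono; simp)+
  have less: "A \<le> A' \<Longrightarrow> B < B' \<Longrightarrow> C' \<le> C \<Longrightarrow> A / 2 + B - C < A' / 2 + B' - C'"
      "A \<le> A' \<Longrightarrow> B \<le> B' \<Longrightarrow> C' < C \<Longrightarrow> A / 2 + B - C < A' / 2 + B' - C'"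
    for A A' B B' C C' :: real
    by linarith+
  consider "?r < z'" | "z < - ?r" | "z' \<le> ?r" "- ?r \<le> z" by linarith
  then show ?thesis
  proof cases
    case 1
    then have "level (max z ?r) < level (max z' ?r)" using assms r by (intro level_strict) auto
    then show ?thesis using m unfolding unroll_def fst_conv snd_conv by (intro less(1)) auto
  next
    case 2
    then have "level (max (- z') ?r) < level (max (- z) ?r)" using assms r
        by (intro level_strict) auto
    then show ?thesis using m unfolding unroll_def fst_conv snd_conv by (intro less(2)) auto
  next
    case 3
    then have "\<bar>z\<bar> \<le> ?r" "\<bar>z'\<bar> \<le> ?r" using assms by linarith+
    then have "unroll (z, u) = z / ?r / 2" "unroll (z', u) = z' / ?r / 2"
      by (simp_all only: unroll_mid)
    then show ?thesis using r assms by (simp add: divide_strict_right_mono)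
  qed
qed

lemma unroll_quotient: "quotient_map euclidean euclidean (\<lambda>p. (unroll p, snd p))"
proof (rule slice_map_quotient)
  have "continuous_on UNIV radius"
    unfolding radius_def by (intro continuous_intros) auto
  then have r: "continuous_on UNIV (\<lambda>p::real\<times>real. radius (snd p))"
    by (rule continuous_on_compose2) (auto intro!: continuous_intros)
  have "continuous_on {0<..} level"
    unfolding level_def by (intro continuous_intros) (auto simp: min_def)
  then have l: "continuous_on UNIV (\<lambda>p::real\<times>real. level (g p))"
    if "continuous_on UNIV g" "\<And>p. 0 < g p" for g
    using that by (auto intro: continuous_on_compose2)
  show "continuous_on UNIV unroll"
    unfolding unroll_def using radius_pos
    by (intro continuous_intros r l)
        (auto simp: less_max_iff_disj less_imp_neq[OF radius_pos, symmetric])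
  show "unroll (u, v) \<le> unroll (u', v)" if "u \<le> u'" for u u' v
    using that unroll_strict[of u u' v] by (cases "u = u'") auto
  show "\<exists>u. M < unroll (u, v)" for v M
  proof -
    define w where "w = max (radius v) (max (1/6) (\<bar>M\<bar> + \<bar>v\<bar> + 1))"
    have w: "radius v \<le> w" "1/6 \<le> w" "\<bar>M\<bar> + \<bar>v\<bar> + 1 \<le> w"
      unfolding w_def by (rule max.cobounded1 order_trans[OF max.cobounded1 max.cobounded2]
        order_trans[OF max.cobounded2 max.cobounded2])+
    have "level w = 3 * w - 1/2" by (rule level_ge[OF w(2)])
    moreover have "unroll (w, v) = 1/2 + level w - v" by (rule unroll_top[OF w(1)])
    ultimately have "M < unroll (w, v)" using w(3) by linarith
    then show ?thesis by blast
  qed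
  show "\<exists>u. unroll (u, v) < M" for v M
  proof -
    define w where "w = max (radius v) (max (1/6) (\<bar>M\<bar> + \<bar>v\<bar> + 1))"
    have w: "radius v \<le> w" "1/6 \<le> w" "\<bar>M\<bar> + \<bar>v\<bar> + 1 \<le> w"
      unfolding w_def by (rule max.cobounded1 order_trans[OF max.cobounded1 max.cobounded2]
        order_trans[OF max.cobounded2 max.cobounded2])+
    have "level w = 3 * w - 1/2" by (rule level_ge[OF w(2)])
    moreover have "unroll (- w, v) = -1/2 - level (- (- w)) + v" using w(1)
        by (intro unroll_bottom) simp
    ultimately have "unroll (- w, v) < M" using w(3) unfolding minus_minus by linarith
    then show ?thesis by blast
  qed
qed

text \<open>Away from the chord \<open>flatten\<close> decreases along an arm at the rate at which
  \<open>unroll\<close> grows in absolute value. Adding the excess over 1/2 makes the result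
  constant along each curve arm-chord-arm.\<close>

definition straighten :: "real \<times> real \<Rightarrow> real" where
  "straighten p = fst p + max (snd p - 1/2) 0 + max (- snd p - 1/2) 0"

lemma straighten_quotient: "quotient_map euclidean euclidean (\<lambda>p. (straighten p, snd p))"
proof (rule slice_map_quotient)
  show "continuous_on UNIV straighten"
    unfolding straighten_def by (intro continuous_intros)
  show "\<exists>u. M < straighten (u, v)" for v M
    by (rule exI[of _ "M + 1"]) (auto simp: straighten_def)
  show "\<exists>u. straighten (u, v) < M" for v M
    by (rule exI[of _ "M - 1 - max (v - 1/2) 0 - max (- v - 1/2) 0"]) (auto simp: straighten_def)
qed (auto simp: straighten_def)

lemma homeo_quotient:
  fixes f :: "real \<times> real \<Rightarrow> real \<times> real"
  assumes "continuous_on UNIV f" "continuous_on UNIV g" "\<And>p. g (f p) = p" "\<And>p. f (g p) = p"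
  shows "quotient_map euclidean euclidean f"
proof -
  have "homeomorphic_maps euclidean euclidean f g"
    using assms by (simp add: homeomorphic_maps_def)
  then show ?thesis
    using homeomorphic_maps_imp_map homeomorphic_map_def by blast
qed

text \<open>The upper arm reaches \<open>zm\<close> at position - \<open>Mt\<close> of the curve,
  the lower one reaches \<open>zp\<close> at \<open>Mb\<close>. Only positive parts enter, since an
  arm that is cut beyond 1/2 has already been moved back to the chord by \<open>push\<close>. The
  slope 1/s outside undoes the horizontal stretching.\<close>

definition fit :: "real \<Rightarrow> (real \<Rightarrow> real) \<Rightarrow> (real \<Rightarrow> real) \<Rightarrow> real \<times> real \<Rightarrow> real" where
  "fit s zm zp p = (let n = fst p; y = snd p;
       Mt = 1/2 + max 0 (s * (1/2 - zm y)); Mb = 1/2 + max 0 (s * (zp y - 1/2))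
     in zm y + (zp y - zm y) * ((max (- Mt) (min Mb n) + Mt) / (Mt + Mb))
        - max (- Mt - n) 0 / s + max (n - Mb) 0 / s)"

lemma fit_left:
  assumes "n \<le> - 1/2 - max 0 (s * (1/2 - zm y))"
  shows "fit s zm zp (n, y) = zm y + (n + 1/2 + max 0 (s * (1/2 - zm y))) / s"
proof -
  define M where "M = max 0 (s * (1/2 - zm y))"
  define N where "N = max 0 (s * (zp y - 1/2))"
  have "0 \<le> M" "0 \<le> N" "n \<le> -1/2 - M" using assms by (auto simp: M_def N_def)
  then show ?thesis
    unfolding fit_def Let_def fst_conv snd_conv M_def[symmetric] N_def[symmetric]
    by (simp add: max_absorb1 min_absorb2 max_absorb2 diff_divide_distrib add_divide_distrib)
qed

lemma fit_right:
  assumes "1/2 + max 0 (s * (zp y - 1/2)) \<le> n"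
  shows "fit s zm zp (n, y) = zp y + (n - 1/2 - max 0 (s * (zp y - 1/2))) / s"
proof -
  define M where "M = max 0 (s * (1/2 - zm y))"
  define N where "N = max 0 (s * (zp y - 1/2))"
  have "0 \<le> M" "0 \<le> N" "1/2 + N \<le> n" using assms by (auto simp: M_def N_def)
  then show ?thesis
    unfolding fit_def Let_def fst_conv snd_conv M_def[symmetric] N_def[symmetric]
    by (simp add: max_absorb1 min_absorb1 max_absorb2 add.commute)
qed

text \<open>Strictness is lost only on the middle interval, and there only if \<open>zm\<close> and
  \<open>zp\<close> coincide. No other map of the unfolding collapses anything.\<close>

lemma fit_less:
  assumes "0 < s" "zm y \<le> zp y" "n < n'"
    and "zm y < zp y \<or> n < -1/2 - max 0 (s * (1/2 - zm y)) \<or> 1/2 + max 0 (s * (zp y - 1/2)) < n'"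
  shows "fit s zm zp (n, y) < fit s zm zp (n', y)"
proof -
  define M where "M = 1/2 + max 0 (s * (1/2 - zm y))"
  define N where "N = 1/2 + max 0 (s * (zp y - 1/2))"
  define d where "d = (zp y - zm y) / (M + N)"
  have M: "0 < M" "0 < N" unfolding M_def N_def by (simp_all add: add_pos_nonneg)
  have d: "0 \<le> d" and dpos: "zm y < zp y \<Longrightarrow> 0 < d" using assms M by (auto simp: d_def)
  have eq: "fit s zm zp (x, y) = zm y + d * (max (- M) (min N x) + M)
        - max (- M - x) 0 / s + max (x - N) 0 / s" for x
    unfolding fit_def Let_def fst_conv snd_conv M_def[symmetric] N_def[symmetric] d_def by simp
  have h: "zm y < zp y \<or> n < - M \<or> N < n'"
    using assms(4) by (auto simp: M_def N_def)
  have l1: "d * (max (- M) (min N n) + M) \<le> d * (max (- M) (min N n') + M)"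
    using assms(3) d by (intro mult_left_mono) auto
  have l2: "max (- M - n') 0 / s \<le> max (- M - n) 0 / s" "max (n - N) 0 / s \<le> max (n' - N) 0 / s"
    using assms(1,3) by (intro divide_right_mono; simp)+
  have less: "A \<le> A' \<Longrightarrow> B' < B \<Longrightarrow> C \<le> C' \<Longrightarrow> z + A - B + C < z + A' - B' + C'"
      "A \<le> A' \<Longrightarrow> B' \<le> B \<Longrightarrow> C < C' \<Longrightarrow> z + A - B + C < z + A' - B' + C'"
      "A < A' \<Longrightarrow> B' \<le> B \<Longrightarrow> C \<le> C' \<Longrightarrow> z + A - B + C < z + A' - B' + C'"
      for z A A' B B' C C' :: real
    by linarith+
  consider "n < - M" | "N < n'" | "zm y < zp y" "- M \<le> n" "n' \<le> N"
    using h by linarith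
  then show ?thesis
  proof cases
    case 1
    then have "max (- M - n') 0 / s < max (- M - n) 0 / s"
      using assms(1,3) by (intro divide_strict_right_mono) auto
    with l1 l2(2) show ?thesis unfolding eq by (intro less(1))
  next
    case 2
    then have "max (n - N) 0 / s < max (n' - N) 0 / s"
      using assms(1,3) by (intro divide_strict_right_mono) auto
    with l1 l2(1) show ?thesis unfolding eq by (intro less(2))
  next
    case 3
    then have "d * (max (- M) (min N n) + M) < d * (max (- M) (min N n') + M)"
      using dpos assms(3) by (intro mult_strict_left_mono) auto
    with l2 show ?thesis unfolding eq by (intro less(3))
  qed
qed

lemma fit_mono:
  assumes "0 < s" "zm y \<le> zp y" "n \<le> n'"
  shows "fit s zm zp (n, y) \<le> fit s zm zp (n', y)"
proof (cases "n = n'")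
  case False
  define M where "M = 1/2 + max 0 (s * (1/2 - zm y))"
  define N where "N = 1/2 + max 0 (s * (zp y - 1/2))"
  define c where "c = zp y - zm y"
  have M: "0 < M + N" "0 \<le> c" using assms unfolding M_def N_def c_def
      by (simp_all add: add_pos_nonneg)
  have 1: "c * ((max (- M) (min N n) + M) / (M + N)) \<le> c * ((max (- M) (min N n') + M) / (M + N))"
    using assms(3) M by (intro mult_left_mono divide_right_mono) auto
  have 2: "max (- M - n') 0 / s \<le> max (- M - n) 0 / s" "max (n - N) 0 / s \<le> max (n' - N) 0 / s"
    using assms(1,3) by (intro divide_right_mono; simp)+
  show ?thesis
    unfolding fit_def Let_def fst_conv snd_conv M_def[symmetric] N_def[symmetric] c_def[symmetric]
    using 1 2 by (intro add_mono diff_mono order_refl)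
qed simp

lemma fit_const:
  assumes "zm y = 1/2" "zp y = 1/2" "\<bar>n\<bar> \<le> 1/2"
  shows "fit s zm zp (n, y) = 1/2"
  using assms by (simp add: fit_def max_absorb1 max_absorb2 min_absorb2 abs_le_iff)

lemma fit_quotient:
  assumes "0 < s" "continuous_on UNIV zm" "continuous_on UNIV zp" "\<And>y. zm y \<le> zp y"
  shows "quotient_map euclidean euclidean (\<lambda>p. (fit s zm zp p, snd p))"
proof (rule slice_map_quotient)
  have z: "continuous_on UNIV (\<lambda>p::real\<times>real. zm (snd p))"
      "continuous_on UNIV (\<lambda>p::real\<times>real. zp (snd p))"
    using assms by (auto intro!: continuous_on_compose2[of UNIV _ UNIV snd] continuous_intros)
  have "1/2 + max 0 a + (1/2 + max 0 b) \<noteq> (0::real)" for a b by linarith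
  then show "continuous_on UNIV (fit s zm zp)"
    unfolding fit_def Let_def using assms(1) by (intro continuous_intros z) auto
  show "fit s zm zp (u, v) \<le> fit s zm zp (u', v)" if "u \<le> u'" for u u' v
  proof -
    show ?thesis using fit_mono assms(1,4) that by blast
  qed
  show "\<exists>u. M < fit s zm zp (u, v)" for v M
  proof (intro exI)
    let ?N = "max 0 (s * (zp v - 1/2))"
    let ?u = "1/2 + ?N + s * (\<bar>M\<bar> + \<bar>zp v\<bar> + 1)"
    have "fit s zm zp (?u, v) = zp v + (?u - 1/2 - ?N) / s"
      using assms(1) by (intro fit_right) simp
    also have "\<dots> = zp v + (\<bar>M\<bar> + \<bar>zp v\<bar> + 1)" using assms(1) by simp
    finally show "M < fit s zm zp (?u, v)" by linarith
  qed
  show "\<exists>u. fit s zm zp (u, v) < M" for v M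
  proof (intro exI)
    let ?N = "max 0 (s * (1/2 - zm v))"
    let ?u = "- 1/2 - ?N - s * (\<bar>M\<bar> + \<bar>zm v\<bar> + 1)"
    have "fit s zm zp (?u, v) = zm v + (?u + 1/2 + ?N) / s"
      using assms(1) by (intro fit_left) simp
    also have "\<dots> = zm v - (\<bar>M\<bar> + \<bar>zm v\<bar> + 1)" using assms(1) by simp
    finally show "fit s zm zp (?u, v) < M" by linarith
  qed
qed

subsection \<open>Unbending the plane\<close>

text \<open>
  With the origin moved to \<open>(s/2, 1/2)\<close>, the folded plane is an upper arm \<open>u \<le> 0\<close>, \<open>z \<ge> 1/6\<close>, a lower
  arm \<open>u \<le> 0\<close>, \<open>z \<le> -1/6\<close> and concentric half ellipses that join them. Five maps undo the fold:
  \<open>push\<close> moves back into the arms what protrudes from them, \<open>flatten\<close> changes the half ellipses into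
  vertical chords, \<open>unroll\<close> and \<open>straighten\<close> introduce a coordinate along the curves arm-chord-arm and
  a coordinate that numbers these curves, and \<open>fit\<close> stretches the three parts of each curve so that
  the arms end at \<open>zm\<close> and \<open>zp\<close>. The chord is collapsed exactly if \<open>zm\<close> and \<open>zp\<close> agree.
\<close>

definition bulge :: "real \<Rightarrow> (real \<Rightarrow> real) \<Rightarrow> (real \<Rightarrow> real) \<Rightarrow> real \<Rightarrow> real" where
  "bulge s zm zp z = (let y = max (3 * \<bar>z\<bar> - 1/2) 0; r = max 0 (min 1 (3 * z + 1/2))
     in r * max 0 (s * (zm y - 1/2)) + (1 - r) * max 0 (s * (1/2 - zp y)))"

lemma bulge_nonneg: "0 \<le> bulge s zm zp z"
  unfolding bulge_def Let_def by (intro add_nonneg_nonneg mult_nonneg_nonneg) auto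

lemma bulge_top: "1/6 \<le> z \<Longrightarrow> bulge s zm zp z = max 0 (s * (zm (3 * z - 1/2) - 1/2))"
  by (simp add: bulge_def Let_def max_absorb1 max_absorb2 min_absorb1)

lemma bulge_bottom: "z \<le> -1/6 \<Longrightarrow> bulge s zm zp z = max 0 (s * (1/2 - zp (- 3 * z - 1/2)))"
  by (simp add: bulge_def Let_def max_absorb1 max_absorb2 min_absorb1 min_absorb2)

lemma continuous_bulge:
  assumes "continuous_on UNIV zm" "continuous_on UNIV zp"
  shows "continuous_on UNIV (bulge s zm zp)"
proof -
  have "continuous_on UNIV (\<lambda>z::real. zm (max (3 * \<bar>z\<bar> - 1/2) 0))"
      "continuous_on UNIV (\<lambda>z::real. zp (max (3 * \<bar>z\<bar> - 1/2) 0))"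
    by (rule continuous_on_compose2[OF assms(1)] continuous_on_compose2[OF assms(2)];
        auto intro!: continuous_intros)+
  then show ?thesis
    unfolding bulge_def Let_def by (intro continuous_intros)
qed

lemma push_arm: "0 \<le> H z \<Longrightarrow> u \<le> H z \<Longrightarrow> push H (u, z) = u - H z"
  by (auto simp: push_def max_def min_def)

lemma push_far: "0 \<le> H z \<Longrightarrow> 7/6 * H z \<le> u \<Longrightarrow> push H (u, z) = u"
  by (auto simp: push_def max_def min_def)

definition unbend ::
    "real \<Rightarrow> real \<Rightarrow> (real \<Rightarrow> real) \<Rightarrow> (real \<Rightarrow> real) \<Rightarrow> real \<times> real \<Rightarrow> real \<times> real" where
  "unbend s \<alpha> zm zp p =
     (let z = snd p - 1/2;
          u = flatten \<alpha> (push (bulge s zm zp) (fst p - s/2, z), z);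
          m = unroll (z, u); y = straighten (u, m)
      in (fit s zm zp (- m, y), y))"

lemma unbend_quotient:
  assumes "0 < s" "0 < \<alpha>" "continuous_on UNIV zm" "continuous_on UNIV zp" "\<And>y. zm y \<le> zp y"
  shows "quotient_map euclidean euclidean (unbend s \<alpha> zm zp)"
proof -
  let ?sw = "prod.swap :: real \<times> real \<Rightarrow> _"
  have sw: "quotient_map euclidean euclidean ?sw"
    by (rule homeo_quotient[of _ prod.swap]) (auto simp: continuous_on_swap)
  have sh: "quotient_map euclidean euclidean (\<lambda>p::real\<times>real. (fst p - s/2, snd p - 1/2))"
    by (rule homeo_quotient[of _ "\<lambda>p. (fst p + s/2, snd p + 1/2)"]) (auto intro!: continuous_intros)
  have neg: "quotient_map euclidean euclidean (\<lambda>p::real\<times>real. (- fst p, snd p))"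
    by (rule homeo_quotient[of _ "\<lambda>p. (- fst p, snd p)"]) (auto intro!: continuous_intros)
  have "unbend s \<alpha> zm zp = (\<lambda>p. (fit s zm zp p, snd p)) \<circ> (\<lambda>p. (- fst p, snd p)) \<circ> ?sw
      \<circ> (\<lambda>p. (straighten p, snd p)) \<circ> ?sw \<circ> (\<lambda>p. (unroll p, snd p)) \<circ> ?sw
      \<circ> (\<lambda>p. (flatten \<alpha> p, snd p)) \<circ> (\<lambda>p. (push (bulge s zm zp) p, snd p))
      \<circ> (\<lambda>p. (fst p - s/2, snd p - 1/2))"
    by (auto simp: unbend_def Let_def)
  then show ?thesis
    by (simp only:) (intro quotient_map_compose[where X' = euclidean] sw sh neg straighten_quotient
        unroll_quotient flatten_quotient assms fit_quotient push_quotient continuous_bulge bulge_nonneg)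
qed

text \<open>On the arm every map is affine along the line. The shift \<open>max 0 b\<close> of
  \<open>push\<close> cancels against the positive part in \<open>fit\<close>, because the positive
  parts of b and -b differ by b. The bound on \<open>u\<close> keeps the point in the arm after
  \<open>push\<close>.\<close>

lemma unbend_top:
  assumes s: "0 < s" "0 < \<alpha>" and w: "0 \<le> w" and u: "u \<le> zm w"
  shows "unbend s \<alpha> zm zp (s * u, (w + 2) / 3) = (u, w)"
proof -
  define b where "b = s * (zm w - 1/2)"
  define z where "z = w / 3 + 1/6"
  define U where "U = s * u - s/2"
  have U: "U \<le> b" using mult_left_mono[OF u, of s] s by (simp add: U_def b_def algebra_simps)
  have z: "1/6 \<le> z" "3 * z - 1/2 = w" "(w + 2) / 3 - 1/2 = z" using w
      by (auto simp: z_def field_simps)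
  have B: "bulge s zm zp z = max 0 b" using bulge_top[OF z(1), of s zm zp] z(2) by (simp add: b_def)
  define U1 where "U1 = U - max 0 b"
  have U1: "U1 \<le> 0" "U1 \<le> - max 0 (- b)" using U by (auto simp: U1_def)
  have p: "push (bulge s zm zp) (U, z) = U1"
    using push_arm[of "bulge s zm zp" z U] B U by (simp add: U1_def)
  have f: "flatten \<alpha> (U1, z) = w + U1"
    using flatten_arm[OF s(2) _ U1(1), of z] z by simp
  have "radius (w + U1) \<le> z"
  proof (rule ccontr)
    assume "\<not> ?thesis"
    then have "level z < level (radius (w + U1))" using z by (intro level_strict) auto
    then show False using U1 z by (simp add: level_radius level_ge)
  qed
  then have m: "unroll (z, w + U1) = 1/2 - U1"
    using unroll_top[of "w + U1" z] z by (simp add: level_ge)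
  have y: "straighten (w + U1, 1/2 - U1) = w"
    using U1 by (simp add: straighten_def)
  have "fit s zm zp (U1 - 1/2, w) = zm w + (U1 - 1/2 + 1/2 + max 0 (s * (1/2 - zm w))) / s"
    using U1 by (intro fit_left) (simp add: b_def algebra_simps)
  also have "max 0 (s * (1/2 - zm w)) = max 0 b - b"
    by (auto simp: b_def algebra_simps max_def)
  also have "zm w + (U1 - 1/2 + 1/2 + (max 0 b - b)) / s = zm w + (s * u - s/2 - b) / s"
    by (simp add: U1_def U_def)
  also have "\<dots> = u" using s by (simp add: b_def field_simps)
  finally show ?thesis
    unfolding unbend_def Let_def fst_conv snd_conv z(3) U_def[symmetric] p f m y by simp
qed

lemma unbend_bottom:
  assumes s: "0 < s" "0 < \<alpha>" and w: "0 \<le> w" and u: "zp w \<le> u"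
  shows "unbend s \<alpha> zm zp (s * (1 - u), (1 - w) / 3) = (u, w)"
proof -
  define b where "b = s * (1/2 - zp w)"
  define z where "z = - w / 3 - 1/6"
  define U where "U = s * (1 - u) - s/2"
  have U: "U \<le> b" using mult_left_mono[OF u, of s] s by (simp add: U_def b_def algebra_simps)
  have z: "z \<le> -1/6" "- 3 * z - 1/2 = w" "(1 - w) / 3 - 1/2 = z" "\<bar>z\<bar> = - z" using w
      by (auto simp: z_def field_simps)
  have B: "bulge s zm zp z = max 0 b" using bulge_bottom[OF z(1), of s zm zp] z(2)
      by (simp add: b_def)
  define U1 where "U1 = U - max 0 b"
  have U1: "U1 \<le> 0" "U1 \<le> - max 0 (- b)" using U by (auto simp: U1_def)
  have p: "push (bulge s zm zp) (U, z) = U1"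
    using push_arm[of "bulge s zm zp" z U] B U by (simp add: U1_def)
  have f: "flatten \<alpha> (U1, z) = w + U1"
    using flatten_arm[OF s(2) _ U1(1), of z] z by simp
  have "radius (w + U1) \<le> - z"
  proof (rule ccontr)
    assume "\<not> ?thesis"
    then have "level (- z) < level (radius (w + U1))" using z by (intro level_strict) auto
    then show False using U1 z by (simp add: level_radius level_ge)
  qed
  then have m: "unroll (z, w + U1) = U1 - 1/2"
    using unroll_bottom[of "w + U1" z] z by (simp add: level_ge)
  have y: "straighten (w + U1, U1 - 1/2) = w"
    using U1 by (simp add: straighten_def)
  have "fit s zm zp (1/2 - U1, w) = zp w + (1/2 - U1 - 1/2 - max 0 (s * (zp w - 1/2))) / s"
    using U1 by (intro fit_right) (simp add: b_def algebra_simps)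
  also have "max 0 (s * (zp w - 1/2)) = max 0 b - b"
    by (auto simp: b_def algebra_simps max_def)
  also have "zp w + (1/2 - U1 - 1/2 - (max 0 b - b)) / s = zp w + (b - (s * (1 - u) - s/2)) / s"
    by (simp add: U1_def U_def)
  also have "\<dots> = u" using s by (simp add: b_def field_simps)
  finally show ?thesis
    unfolding unbend_def Let_def fst_conv snd_conv z(3) U_def[symmetric] p f m y by simp
qed

text \<open>The ends (w + 2)/3 and (1 - w)/3 are symmetric about height 1/2, so these half ellipses
  are concentric for all w, with vertical semiaxis w/3 + 1/6.\<close>

lemma half_ellipse_fold:
  assumes "0 < \<alpha>" "0 \<le> w"
  shows "p \<in> half_ellipse \<alpha> False (s/2) ((w + 2) / 3) ((1 - w) / 3) \<longleftrightarrow>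
    \<bar>snd p - 1/2\<bar> \<le> w / 3 + 1/6 \<and> fst p - s/2 = \<alpha> * sqrt ((w / 3 + 1/6)\<^sup>2 - (snd p - 1/2)\<^sup>2)"
proof -
  define R where "R = w / 3 + 1/6"
  define z where "z = snd p - 1/2"
  define U where "U = fst p - s/2"
  have R: "0 < R" using assms by (simp add: R_def)
  have "(snd p - (w + 2) / 3) * ((1 - w) / 3 - snd p) = R\<^sup>2 - z\<^sup>2"
    by (simp add: R_def z_def power2_eq_square field_simps)
  then have "p \<in> half_ellipse \<alpha> False (s/2) ((w + 2) / 3) ((1 - w) / 3) \<longleftrightarrow>
      U\<^sup>2 = \<alpha>\<^sup>2 * (R\<^sup>2 - z\<^sup>2) \<and> 0 \<le> U"
    by (auto simp: half_ellipse_def U_def split: prod.splits)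
  also have "\<dots> \<longleftrightarrow> \<bar>z\<bar> \<le> R \<and> U = \<alpha> * sqrt (R\<^sup>2 - z\<^sup>2)"
  proof safe
    assume a: "U\<^sup>2 = \<alpha>\<^sup>2 * (R\<^sup>2 - z\<^sup>2)" "0 \<le> U"
    then have "0 \<le> R\<^sup>2 - z\<^sup>2" using assms(1)
      by (metis zero_le_mult_iff zero_le_power2 zero_less_power not_less)
    then show "\<bar>z\<bar> \<le> R" using R abs_le_square_iff[of z R] by simp
    have "U = sqrt (U\<^sup>2)" using a(2) by simp
    also have "\<dots> = \<alpha> * sqrt (R\<^sup>2 - z\<^sup>2)" unfolding a(1) using assms(1) by (simp add: real_sqrt_mult)
    finally show "U = \<alpha> * sqrt (R\<^sup>2 - z\<^sup>2)" .
  next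
    assume a: "\<bar>z\<bar> \<le> R" "U = \<alpha> * sqrt (R\<^sup>2 - z\<^sup>2)"
    then have nn: "0 \<le> R\<^sup>2 - z\<^sup>2" using abs_le_square_iff[of z R] R by simp
    show "(\<alpha> * sqrt (R\<^sup>2 - z\<^sup>2))\<^sup>2 = \<alpha>\<^sup>2 * (R\<^sup>2 - z\<^sup>2)" using nn by (simp add: power_mult_distrib)
    show "0 \<le> \<alpha> * sqrt (R\<^sup>2 - z\<^sup>2)" using assms(1) nn by simp
  qed
  finally show ?thesis by (simp add: R_def z_def U_def)
qed

text \<open>The conditions \<open>near\<close> compare the bulge with the distance to a height y0 at
  which the cut is closed. The slope 2/5 \<alpha> is s times 6/5 of \<alpha>/(3s), the aspect ratio
  of the caps before the fold.\<close>

locale fold_cut =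
  fixes s \<alpha> :: real and zm zp :: "real \<Rightarrow> real"
  assumes s: "0 < s" and \<alpha>: "0 < \<alpha>"
    and le: "zm y \<le> zp y"
    and eq: "zm y = zp y \<Longrightarrow> zm y = 1/2 \<and> 0 \<le> y \<and> y \<le> 1"
    and near: "zm y0 = zp y0 \<Longrightarrow> s * (zm y - 1/2) \<le> 2 * \<alpha> / 5 * \<bar>y - y0\<bar>"
      "zm y0 = zp y0 \<Longrightarrow> s * (1/2 - zp y) \<le> 2 * \<alpha> / 5 * \<bar>y - y0\<bar>"
begin

lemma push_cap:
  assumes w: "zm w = zp w" and z: "\<bar>z\<bar> \<le> w / 3 + 1/6"
  shows "push (bulge s zm zp)
      (\<alpha> * sqrt ((w / 3 + 1/6)\<^sup>2 - z\<^sup>2), z) = \<alpha> * sqrt ((w / 3 + 1/6)\<^sup>2 - z\<^sup>2)"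
proof (rule push_far, rule bulge_nonneg)
  \<comment> \<open>At height \<open>z\<close> the half ellipse of radius \<open>R\<close> has bulged by at least \<open>7/5 * \<alpha> * (R - \<bar>z\<bar>)\<close>, as
    \<open>7/5 < sqrt 2\<close>, whereas \<open>bulge\<close> is at most \<open>6/5 * \<alpha> * (R - \<bar>z\<bar>)\<close>.\<close>
  define R where "R = w / 3 + 1/6"
  define M where "M = max \<bar>z\<bar> (1/6)"
  define y where "y = max (3 * \<bar>z\<bar> - 1/2) 0"
  have w01: "0 \<le> w" "w \<le> 1" using eq[OF w] by auto
  have M: "1/6 \<le> M" "M \<le> R" "R \<le> 1/2" "\<bar>z\<bar> \<le> M" using z w01 by (auto simp: M_def R_def)
  have d: "2 * \<alpha> / 5 * \<bar>y - w\<bar> = 6/5 * \<alpha> * (R - M)"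
    using z w01 by (auto simp: y_def M_def R_def max_def algebra_simps)
  have nn: "0 \<le> 6/5 * \<alpha> * (R - M)" using M \<alpha> by (intro mult_nonneg_nonneg) auto
  define r where "r = max 0 (min 1 (3 * z + 1/2))"
  have r: "0 \<le> r" "0 \<le> 1 - r" by (auto simp: r_def)
  have "bulge s zm zp z = r * max 0 (s * (zm y - 1/2)) + (1 - r) * max 0 (s * (1/2 - zp y))"
    by (simp add: bulge_def Let_def y_def r_def)
  also have "\<dots> \<le> r * (6/5 * \<alpha> * (R - M)) + (1 - r) * (6/5 * \<alpha> * (R - M))"
    using r near[OF w, of y] nn unfolding d by (intro add_mono mult_left_mono) auto
  also have "\<dots> = 6/5 * \<alpha> * (R - M)" unfolding distrib_right[symmetric] by simp
  finally have b: "7/6 * bulge s zm zp z \<le> \<alpha> * (7/5 * (R - M))" by (simp add: algebra_simps)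
  have "(7/5 * (R - M))\<^sup>2 \<le> (R - M) * (R + M)"
  proof -
    \<comment> \<open>From \<open>R\<close> \<le> 1/2 and \<open>M\<close> \<ge> 1/6 follows
      \<open>R\<close> + \<open>M\<close> \<ge> 2 * (\<open>R\<close> - \<open>M\<close>), and 49/25
      < 2.\<close>
    have "(R - M) * (49/25 * (R - M)) \<le> (R - M) * (R + M)"
      using M by (intro mult_left_mono) auto
    then show ?thesis by (simp add: power2_eq_square algebra_simps)
  qed
  also have "\<dots> = R\<^sup>2 - M\<^sup>2" by (simp add: power2_eq_square algebra_simps)
  also have "\<dots> \<le> R\<^sup>2 - z\<^sup>2" using M abs_le_square_iff[of z M] by simp
  finally have "7/5 * (R - M) \<le> sqrt (R\<^sup>2 - z\<^sup>2)" by (rule real_le_rsqrt)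
  then show "7/6 * bulge s zm zp z \<le> \<alpha> * sqrt ((w / 3 + 1/6)\<^sup>2 - z\<^sup>2)"
    using order_trans[OF b mult_left_mono] \<alpha> unfolding R_def by auto
qed

lemma unbend_cap:
  assumes w: "zm w = zp w" and p: "p \<in> half_ellipse \<alpha> False (s/2) ((w + 2) / 3) ((1 - w) / 3)"
  shows "unbend s \<alpha> zm zp p = (1/2, w)"
proof -
  define R where "R = w / 3 + 1/6"
  define z where "z = snd p - 1/2"
  have w01: "0 \<le> w" "w \<le> 1" "zm w = 1/2" "zp w = 1/2" using eq[OF w] w by auto
  have z: "\<bar>z\<bar> \<le> R" and U: "fst p - s/2 = \<alpha> * sqrt (R\<^sup>2 - z\<^sup>2)"
    using p unfolding half_ellipse_fold[OF \<alpha> w01(1)] z_def R_def by auto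
  have pu: "push (bulge s zm zp) (fst p - s/2, z) = \<alpha> * sqrt (R\<^sup>2 - z\<^sup>2)"
    using push_cap[OF w, of z] z unfolding U R_def by simp
  have f: "flatten \<alpha> (\<alpha> * sqrt (R\<^sup>2 - z\<^sup>2), z) = w"
    using flatten_cap[OF \<alpha> _ z] w01 by (simp add: R_def)
  have rad: "radius w = R" using radius_ge0[OF w01(1)] by (simp add: R_def)
  have m: "unroll (z, w) = z / R / 2" using unroll_mid[of z w] z rad by simp
  have "0 < R" using w01 by (simp add: R_def)
  then have m1: "\<bar>z / R / 2\<bar> \<le> 1/2" using z by (simp add: abs_le_iff field_simps)
  then have y: "straighten (w, z / R / 2) = w"
      unfolding straighten_def fst_conv snd_conv abs_le_iff by linarith
  have "fit s zm zp (- (z / R / 2), w) = 1/2"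
    using w01 m1 by (intro fit_const) auto
  then show ?thesis
    unfolding unbend_def Let_def fst_conv snd_conv z_def[symmetric] pu f m y by simp
qed

text \<open>All maps before \<open>fit\<close> are injective, so distinct points with equal images
  have distinct positions \<open>m\<close> on the same curve. Then \<open>fit\<close> is constant
  between these, which forces \<open>zm\<close> = \<open>zp\<close> and puts both positions on the
  chord; going back through the maps leads to the half ellipse.\<close>

lemma unbend_fibres:
  assumes "unbend s \<alpha> zm zp p = unbend s \<alpha> zm zp p'"
  shows "p = p' \<or> (\<exists>w. zm w = zp w \<and> p \<in> half_ellipse \<alpha> False (s/2) ((w + 2) / 3) ((1 - w) / 3)
      \<and> p' \<in> half_ellipse \<alpha> False (s/2) ((w + 2) / 3) ((1 - w) / 3))"
proof -
  define z where "z p = snd p - 1/2" for p :: "real \<times> real"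
  define U where "U p = push (bulge s zm zp) (fst p - s/2, z p)" for p :: "real \<times> real"
  define u where "u p = flatten \<alpha> (U p, z p)" for p :: "real \<times> real"
  define m where "m p = unroll (z p, u p)" for p
  define y where "y p = straighten (u p, m p)" for p
  have ub: "unbend s \<alpha> zm zp p = (fit s zm zp (- m p, y p), y p)" for p
    by (simp add: unbend_def Let_def z_def U_def u_def m_def y_def)
  have yy: "y p = y p'" and fit: "fit s zm zp (- m p, y p) = fit s zm zp (- m p', y p)"
    using assms unfolding ub by auto
  have inj: "p = p'" if "m p = m p'"
  proof -
    have "u p = u p'" using yy that by (simp add: y_def straighten_def)
    moreover from this have "z p = z p'"
      using that unroll_strict[of "z p" "z p'" "u p"] unroll_strict[of "z p'" "z p" "u p"]
      unfolding m_def by (metis less_irrefl linorder_neqE_linordered_idom)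
    ultimately have "U p = U p'"
      using flatten_strict[OF \<alpha>, of "U p" "U p'" "z p"] flatten_strict[OF \<alpha>, of "U p'" "U p" "z p"]
      unfolding u_def by (metis less_irrefl linorder_neqE_linordered_idom)
    then have "fst p - s/2 = fst p' - s/2"
      using push_strict[of "fst p - s/2" "fst p' - s/2" "bulge s zm zp" "z p"]
        push_strict[of "fst p' - s/2" "fst p - s/2" "bulge s zm zp" "z p"] \<open>z p = z p'\<close>
      unfolding U_def by (metis less_irrefl linorder_neqE_linordered_idom)
    then show ?thesis using \<open>z p = z p'\<close> by (simp add: z_def prod_eq_iff)
  qed
  have cap: "q \<in> half_ellipse \<alpha> False (s/2) ((w + 2) / 3) ((1 - w) / 3)"
    if q: "y q = w" "zm w = zp w" "\<bar>m q\<bar> \<le> 1/2" for q w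
  proof -
    have w01: "0 \<le> w" "w \<le> 1" using eq[OF q(2)] by auto
    define R where "R = w / 3 + 1/6"
    have uw: "u q = w" using q by (simp add: y_def straighten_def abs_le_iff)
    have R: "radius w = R" "0 < R" using radius_ge0[OF w01(1)] w01 by (auto simp: R_def)
    have zR: "\<bar>z q\<bar> \<le> R"
    proof (rule ccontr)
      assume "\<not> ?thesis"
      then consider "R < z q" | "z q < - R" by linarith
      then show False
      proof cases
        case 1
        then have "m q > unroll (R, w)" unfolding m_def uw by (rule unroll_strict)
        then show False using q(3) R unroll_mid[of R w] by simp
      next
        case 2
        then have "m q < unroll (- R, w)" unfolding m_def uw by (rule unroll_strict)
        then show False using q(3) R unroll_mid[of "- R" w] by simp
      qed
    qed
    have f: "flatten \<alpha> (\<alpha> * sqrt (R\<^sup>2 - (z q)\<^sup>2), z q) = w"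
      using flatten_cap[OF \<alpha> _ zR] w01 by (simp add: R_def)
    have Uq: "U q = \<alpha> * sqrt (R\<^sup>2 - (z q)\<^sup>2)"
      using f uw flatten_strict[OF \<alpha>, of "U q" _ "z q"] flatten_strict[OF \<alpha>, of _ "U q" "z q"]
      unfolding u_def by (metis less_irrefl linorder_neqE_linordered_idom)
    have "push (bulge s zm zp) (\<alpha> * sqrt (R\<^sup>2 - (z q)\<^sup>2), z q) = \<alpha> * sqrt (R\<^sup>2 - (z q)\<^sup>2)"
      using push_cap[OF q(2), of "z q"] zR by (simp add: R_def)
    then have "fst q - s/2 = \<alpha> * sqrt (R\<^sup>2 - (z q)\<^sup>2)"
      using Uq push_strict[of "fst q - s/2" _ "bulge s zm zp" "z q"] push_strict[of _
          "fst q - s/2" "bulge s zm zp" "z q"]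
      unfolding U_def by (metis less_irrefl linorder_neqE_linordered_idom)
    then show ?thesis
      using zR unfolding half_ellipse_fold[OF \<alpha> w01(1)] R_def z_def by simp
  qed
  show ?thesis
  proof (cases "m p = m p'")
    case True
    then show ?thesis using inj by blast
  next
    case False
    let ?w = "y p"
    have less: False if "- m q < - m q'" "{q, q'} = {p, p'}" "zm ?w < zp ?w \<or> 
        - m q < -1/2 - max 0 (s * (1/2 - zm ?w)) \<or> 1/2 + max 0 (s * (zp ?w - 1/2)) < - m q'"
            for q q'
      using fit_less[where zm = zm and zp = zp and y = ?w, OF s le that(1,3)] fit that(2)
          by (auto simp: doubleton_eq_iff)
    have "zm ?w = zp ?w"
      using less[of p p'] less[of p' p] False le[of ?w] by fastforce
    moreover from eq[OF this] this have half: "zm ?w = 1/2" "zp ?w = 1/2" by auto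
    have "\<bar>m p\<bar> \<le> 1/2 \<and> \<bar>m p'\<bar> \<le> 1/2"
    proof (cases "m p < m p'")
      case True
      then have "\<not> (1/2 < m p' \<or> m p < -1/2)"
        using less[of p' p] unfolding half by (auto simp: insert_commute)
      then show ?thesis using True by linarith
    next
      case False
      then have "m p' < m p" using \<open>m p \<noteq> m p'\<close> by simp
      moreover from this have "\<not> (1/2 < m p \<or> m p' < -1/2)"
        using less[of p p'] unfolding half by auto
      ultimately show ?thesis by linarith
    qed
    ultimately show ?thesis using cap[of p ?w] cap[of p' ?w] yy by auto
  qed
qed

end

subsection \<open>Cutting between the two sides\<close>

text \<open>\<open>z\<close> is the least \<delta>-Lipschitz function above \<open>S\<close> and
  above the constant \<open>m\<close>, a supremum of cones. The constant keeps the supremum over a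
  nonempty set when \<open>S\<close> is empty. The last clause, approximate attainment, serves to
  locate points of contact.\<close>

lemma lipschitz_envelope:
  fixes S :: "(real \<times> real) set"
  assumes \<delta>: "0 < \<delta>" and M: "\<And>u w. (u, w) \<in> S \<Longrightarrow> u \<le> M"
  obtains z :: "real \<Rightarrow> real" where
    "\<And>v w. z v \<le> z w + \<delta> * \<bar>v - w\<bar>"
    "\<And>u w. (u, w) \<in> S \<Longrightarrow> u \<le> z w"
    "\<And>v e. 0 < e \<Longrightarrow> \<exists>u w. (u, w) \<in> S \<union> {m} \<times> UNIV \<and> z v - e < u - \<delta> * \<bar>v - w\<bar>"
proof
  let ?S = "S \<union> {m} \<times> UNIV"
  let ?g = "\<lambda>v p. fst p - \<delta> * \<bar>v - snd p\<bar>"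
  let ?z = "\<lambda>v. SUP p\<in>?S. ?g v p"
  have ne: "?S \<noteq> {}" by auto
  have bdd: "bdd_above (?g v ` ?S)" for v
  proof (rule bdd_aboveI2)
    fix p assume "p \<in> ?S"
    then have "fst p \<le> max M m" using M[of "fst p" "snd p"] by auto
    moreover have "0 \<le> \<delta> * \<bar>v - snd p\<bar>" using \<delta> by simp
    ultimately show "?g v p \<le> max M m" by linarith
  qed
  show "?z v \<le> ?z w + \<delta> * \<bar>v - w\<bar>" for v w
  proof (rule cSUP_least[OF ne])
    fix p assume p: "p \<in> ?S"
    have "\<delta> * \<bar>w - snd p\<bar> \<le> \<delta> * (\<bar>v - snd p\<bar> + \<bar>v - w\<bar>)"
      using \<delta> by (intro mult_left_mono) auto
    then have "?g v p \<le> ?g w p + \<delta> * \<bar>v - w\<bar>" by (simp add: algebra_simps)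
    also have "?g w p \<le> ?z w" by (rule cSUP_upper[OF p bdd])
    finally show "?g v p \<le> ?z w + \<delta> * \<bar>v - w\<bar>" by simp
  qed
  show "u \<le> ?z w" if "(u, w) \<in> S" for u w
    using cSUP_upper[OF _ bdd, of "(u, w)" w] that by simp
  show "\<exists>u w. (u, w) \<in> ?S \<and> ?z v - e < u - \<delta> * \<bar>v - w\<bar>" if "0 < e" for v e
  proof -
    have "?z v - e < ?z v" using that by simp
    then obtain p where "p \<in> ?S" "?z v - e < ?g v p"
      unfolding less_cSUP_iff[OF ne bdd] by blast
    then show ?thesis by (intro exI[of _ "fst p"] exI[of _ "snd p"]) simp
  qed
qed

text \<open>Envelopes of slope \<beta> would already be ordered by \<open>TB\<close>; the slope 6/5
  \<beta> keeps a reserve of \<beta>/5 per unit of height. Where the envelopes meet, nearly optimal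
  points of both sets cannot afford this reserve and must therefore be close to the meeting
  point.\<close>

lemma cut_between:
  fixes T B :: "(real \<times> real) set"
  assumes \<beta>: "0 < \<beta>"
    and TB: "\<And>u w u' w'. (u, w) \<in> T \<Longrightarrow> (u', w') \<in> B \<Longrightarrow> u - u' \<le> \<beta> * \<bar>w - w'\<bar>"
    and T: "\<And>u w. (u, w) \<in> T \<Longrightarrow> u \<le> 1" and B: "\<And>u w. (u, w) \<in> B \<Longrightarrow> 0 \<le> u"
  obtains zm zp :: "real \<Rightarrow> real" where
    "\<And>v w. zm v \<le> zm w + 6/5 * \<beta> * \<bar>v - w\<bar>" "\<And>v w. zp v \<le> zp w + 6/5 * \<beta> * \<bar>v - w\<bar>"
    "\<And>v. zm v \<le> zp v"
    "\<And>u w. (u, w) \<in> T \<Longrightarrow> u \<le> zm w" "\<And>u w. (u, w) \<in> B \<Longrightarrow> zp w \<le> u"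
    "\<And>v. zm v = zp v \<Longrightarrow> (zm v, v) \<in> closure T \<inter> closure B"
proof -
  define \<delta> where "\<delta> = 6/5 * \<beta>"
  have \<delta>: "0 < \<delta>" using \<beta> by (simp add: \<delta>_def)
  define B' where "B' = (\<lambda>p. (- fst p, snd p)) ` B"
  have B': "(u, w) \<in> B' \<longleftrightarrow> (- u, w) \<in> B" for u w
    by (force simp: B'_def image_iff)
  \<comment> \<open>The default is -1 for \<open>T\<close> and 2 for \<open>B\<close> (-2 after the
    reflection). Each is at least 1 away, in the right order, from the values of the other set and
    from the other default, so defaults never cause contact.\<close>
  obtain zm where zm: "\<And>v w. zm v \<le> zm w + \<delta> * \<bar>v - w\<bar>" "\<And>u w. (u, w) \<in> T \<Longrightarrow> u \<le> zm w"
      "\<And>v e. 0 < e \<Longrightarrow> \<exists>u w. (u, w) \<in> T \<union> {-1} \<times> UNIV \<and> zm v - e < u - \<delta> * \<bar>v - w\<bar>"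
    by (rule lipschitz_envelope[OF \<delta>, of T 1 "-1"]) (use T in blast)+
  obtain zn where zn: "\<And>v w. zn v \<le> zn w + \<delta> * \<bar>v - w\<bar>" "\<And>u w. (u, w) \<in> B' \<Longrightarrow> u \<le> zn w"
      "\<And>v e. 0 < e \<Longrightarrow> \<exists>u w. (u, w) \<in> B' \<union> {-2} \<times> UNIV \<and> zn v - e < u - \<delta> * \<bar>v - w\<bar>"
    by (rule lipschitz_envelope[OF \<delta>, of B' 0 "-2"]) (use B B' in force, blast)
  have near: "\<exists>u w u' w'. zm v - e < u - \<delta> * \<bar>v - w\<bar> \<and> u' + \<delta> * \<bar>v - w'\<bar> < - zn v + e \<and>
      ((u, w) \<in> T \<and> (u', w') \<in> B \<or> u - u' \<le> -1)" if e: "0 < e" for v e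
  proof -
    obtain u w where u: "(u, w) \<in> T \<union> {-1} \<times> UNIV" "zm v - e < u - \<delta> * \<bar>v - w\<bar>"
      using zm(3)[OF e] by blast
    obtain u' w' where u': "(u', w') \<in> B' \<union> {-2} \<times> UNIV" "zn v - e < u' - \<delta> * \<bar>v - w'\<bar>"
      using zn(3)[OF e] by blast
    have "(u, w) \<in> T \<and> (- u', w') \<in> B \<or> u - (- u') \<le> -1"
      using u(1) u'(1) T[of u w] B[of "- u'" w'] unfolding B'[symmetric] by auto
    then show ?thesis using u(2) u'(2) by (intro exI[of _ u] exI[of _ w] exI[of _ "- u'"]
        exI[of _ w']) auto
  qed
  have arith: "\<beta> * \<bar>w - w'\<bar> \<le> \<beta> * \<bar>v - w\<bar> + \<beta> * \<bar>v - w'\<bar>" for v w w'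
    unfolding distrib_left[symmetric] using \<beta> by (intro mult_left_mono) auto
  have split: "\<delta> * x = \<beta> * x + \<beta> * x / 5" for x by (simp add: \<delta>_def)
  have le: "zm v \<le> - zn v" for v
  proof (rule ccontr)
    assume "\<not> ?thesis"
    then have "0 < (zm v + zn v) / 2" by simp
    from near[OF this, of v] obtain u w u' w' where
      *: "zm v - (zm v + zn v) / 2 < u - \<delta> * \<bar>v - w\<bar>"
          "u' + \<delta> * \<bar>v - w'\<bar> < - zn v + (zm v + zn v) / 2"
        "(u, w) \<in> T \<and> (u', w') \<in> B \<or> u - u' \<le> -1" by blast
    have nn: "0 \<le> \<beta> * \<bar>v - w\<bar>" "0 \<le> \<beta> * \<bar>v - w'\<bar>" using \<beta> by auto
    have "u - u' \<le> \<beta> * \<bar>w - w'\<bar> \<or> u - u' \<le> -1" using *(3) TB by blast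
    then show False using *(1,2) nn arith[of w w' v] split[of "\<bar>v - w\<bar>"] split[of "\<bar>v - w'\<bar>"]
        by argo
  qed
  have clos: "(zm v, v) \<in> closure T \<inter> closure B" if eq: "zm v = - zn v" for v
  proof -
    have "\<exists>p\<in>T. \<exists>q\<in>B. dist p (zm v, v) < \<epsilon> \<and> dist q (zm v, v) < \<epsilon>" if \<epsilon>: "0 < \<epsilon>" for \<epsilon>
    proof -
      \<comment> \<open>Optimality up to e confines the points to |w - v| < 10 e/\<beta> and |u -
        \<open>zm v\<close>| < 11 e, where 10 is 2 divided by the reserve 1/5; the factor 30
        dominates both, and e \<le> 1/3 rules out the defaults.\<close>
      define e where "e = min (1/3) (\<epsilon> / (30 * (1 + 1 / \<beta>)))"
      have k: "0 < 30 * (1 + 1 / \<beta>)" using \<beta> by (simp add: add_pos_pos)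
      then have e: "0 < e" "e \<le> 1/3" "e * (30 * (1 + 1 / \<beta>)) \<le> \<epsilon>"
        using \<epsilon> by (auto simp: e_def min_def pos_le_divide_eq divide_simps)
      from near[OF e(1), of v] obtain u w u' w' where
        *: "zm v - e < u - \<delta> * \<bar>v - w\<bar>" "u' + \<delta> * \<bar>v - w'\<bar> < zm v + e"
          "(u, w) \<in> T \<and> (u', w') \<in> B \<or> u - u' \<le> -1" unfolding eq by auto
      have nn: "0 \<le> \<beta> * \<bar>v - w\<bar>" "0 \<le> \<beta> * \<bar>v - w'\<bar>" using \<beta> by auto
      have mem: "(u, w) \<in> T" "(u', w') \<in> B"
        using * nn e split[of "\<bar>v - w\<bar>"] split[of "\<bar>v - w'\<bar>"] by argo+
      have "u - u' \<le> \<beta> * \<bar>v - w\<bar> + \<beta> * \<bar>v - w'\<bar>" using TB[OF mem] arith[of w w' v] by linarith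
      then have b: "\<beta> * \<bar>v - w\<bar> + \<beta> * \<bar>v - w'\<bar> < 10 * e" "\<bar>u - zm v\<bar> < 11 * e"
          "\<bar>u' - zm v\<bar> < 11 * e"
        using *(1,2) nn split[of "\<bar>v - w\<bar>"] split[of "\<bar>v - w'\<bar>"] by (linarith, argo, argo)
      have w: "\<bar>w - v\<bar> < 10 * e / \<beta>" "\<bar>w' - v\<bar> < 10 * e / \<beta>"
        using b(1) nn \<beta> unfolding pos_less_divide_eq[OF \<beta>] abs_minus_commute[of _ v]
            mult.commute[of _ \<beta>]
        by linarith+
      have d: "dist (x, y) (x', y') \<le> \<bar>x - x'\<bar> + \<bar>y - y'\<bar>" for x y x' y' :: real
        unfolding dist_Pair_Pair dist_real_def using sqrt_sum_squares_le_sum_abs[of "x - x'"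
            "y - y'"] by simp
      have "11 * e + 10 * e / \<beta> < e * (30 * (1 + 1 / \<beta>))"
      proof -
        have "e * (30 * (1 + 1 / \<beta>)) = 30 * e + 30 * (e / \<beta>)" by (simp add: distrib_left)
        moreover have "0 < e / \<beta>" using e(1) \<beta> by simp
        ultimately show ?thesis using e(1) by simp
      qed
      then have "dist (u, w) (zm v, v) < \<epsilon>" "dist (u', w') (zm v, v) < \<epsilon>"
        using d[of u w "zm v" v] d[of u' w' "zm v" v] b(2,3) w e(3) by linarith+
      then show ?thesis using mem by blast
    qed
    then show ?thesis by (simp add: closure_approachable)
  qed
  show thesis
  proof (rule that[of zm "\<lambda>v. - zn v"])
    show "zm v \<le> zm w + 6/5 * \<beta> * \<bar>v - w\<bar>" for v w using zm(1) by (simp add: \<delta>_def)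
    show "- zn v \<le> - zn w + 6/5 * \<beta> * \<bar>v - w\<bar>" for v w
      using zn(1)[of w v] by (simp add: \<delta>_def abs_minus_commute)
    show "- zn w \<le> u" if "(u, w) \<in> B" for u w
      using zn(2)[of "- u" w] that B' by force
  qed (use zm(2) le clos in auto)
qed

section \<open>Caps of one side against arcs and caps of the other side\<close>

text \<open>
  In the following, \<open>d\<close> is the signed horizontal distance by which a point of the picture at height
  \<open>w\<close> exceeds the vertical line through the turning point, on the side where it does not belong.
  Such a point lies on a cap between the heights \<open>f1\<close> and \<open>f2\<close> of two basic arcs. If the cap bends
  outwards, admissibility keeps the arcs of the other side away from it.
\<close>

definition separated :: "real \<Rightarrow> real \<Rightarrow> real set \<Rightarrow> bool" where
  "separated f1 f2 H \<longleftrightarrow> (\<forall>h\<in>H. h \<le> f1 - (f2 - f1) \<or> f2 + (f2 - f1) \<le> h)"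

definition sag :: "real \<Rightarrow> real \<Rightarrow> real \<Rightarrow> real" where
  "sag f1 f2 w = sqrt ((w - f1) * (f2 - w))"

text \<open>The first alternative covers caps that bend back into their own side, the second those
  that bend outwards. A point of an arc is the case f1 = f2, where \<open>sag\<close>
  vanishes.\<close>

definition excess :: "real \<Rightarrow> real set \<Rightarrow> real set \<Rightarrow> real \<Rightarrow> real \<Rightarrow> bool" where
  "excess \<beta> H H' d w \<longleftrightarrow> (\<exists>f1\<in>H. \<exists>f2\<in>H. f1 \<le> w \<and> w \<le> f2 \<and>
     (d \<le> - (\<beta> * sag f1 f2 w) \<or> d \<le> \<beta> * sag f1 f2 w \<and> separated f1 f2 H'))"

lemma sag_bounds:
  assumes "f1 \<le> w" "w \<le> f2"
  shows "min (w - f1) (f2 - w) \<le> sag f1 f2 w" "2 * sag f1 f2 w \<le> f2 - f1" "0 \<le> sag f1 f2 w"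
proof -
  have "(min (w - f1) (f2 - w))\<^sup>2 \<le> (w - f1) * (f2 - w)"
    using assms by (auto simp: min_def power2_eq_square intro: mult_left_mono mult_right_mono)
  then show "min (w - f1) (f2 - w) \<le> sag f1 f2 w" unfolding sag_def by (rule real_le_rsqrt)
  show "2 * sag f1 f2 w \<le> f2 - f1"
    using arith_geo_mean_sqrt[of "w - f1" "f2 - w"] assms by (simp add: sag_def)
  show "0 \<le> sag f1 f2 w" using assms by (simp add: sag_def)
qed

text \<open>Let D = f2 - f1. If g1 and g2 lie on the same side of [f1, f2], then w and w' are at
  least D apart. Otherwise the second cap encloses the first, and w' has distance at least D - |w -
  w'| from both of its ends.\<close>

lemma separated_inner:
  assumes f: "separated f1 f2 H'" "f1 \<le> w" "w \<le> f2" and g: "g1 \<in> H'" "g2 \<in> H'" "g1 \<le> w'" "w' \<le> g2"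
  shows "f2 - f1 \<le> \<bar>w - w'\<bar> \<or> (f2 - f1) - \<bar>w - w'\<bar> \<le> sag g1 g2 w'"
proof -
  have "g1 \<le> f1 - (f2 - f1) \<or> f2 + (f2 - f1) \<le> g1" "g2 \<le> f1 - (f2 - f1) \<or> f2 + (f2 - f1) \<le> g2"
    using f g by (auto simp: separated_def)
  then show ?thesis
    using sag_bounds(1)[OF g(3,4)] f(2,3) g(3,4) unfolding min_def by (elim disjE)
        (linarith | argo)+
qed

text \<open>Neither cap encloses the other, since each keeps the ends of the other away by its own
  width. Hence they lie one above the other, and |w - w'| bounds both widths.\<close>

lemma separated_outer:
  assumes f: "separated f1 f2 H'" "f1 \<in> H" "f2 \<in> H" "f1 \<le> w" "w \<le> f2"
    and g: "separated g1 g2 H" "g1 \<in> H'" "g2 \<in> H'" "g1 \<le> w'" "w' \<le> g2"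
  shows "(f2 - f1) + (g2 - g1) \<le> 2 * \<bar>w - w'\<bar>"
proof -
  have "g1 \<le> f1 - (f2 - f1) \<or> f2 + (f2 - f1) \<le> g1" "g2 \<le> f1 - (f2 - f1) \<or> f2 + (f2 - f1) \<le> g2"
    "f1 \<le> g1 - (g2 - g1) \<or> g2 + (g2 - g1) \<le> f1" "f2 \<le> g1 - (g2 - g1) \<or> g2 + (g2 - g1) \<le> f2"
    using f g by (auto simp: separated_def)
  then show ?thesis
    using f(4,5) g(4,5) by (cases "w \<le> w'"; elim disjE) simp_all
qed

text \<open>Two inward caps have no positive excess. An outward cap has \<open>sag\<close> at most
  half its width, which is compared with an inward cap by \<open>separated_inner\<close> and with an
  outward one by \<open>separated_outer\<close>.\<close>

lemma excess_sum_le: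
  assumes \<beta>: "0 < \<beta>" and d: "excess \<beta> H H' d w" "excess \<beta> H' H d' w'"
  shows "d + d' \<le> \<beta> * \<bar>w - w'\<bar>"
proof -
  have half: "d + d' \<le> \<beta> * \<bar>w - w'\<bar>"
    if sep: "separated f1 f2 H'" and f: "f1 \<le> w" "w \<le> f2" "d \<le> \<beta> * sag f1 f2 w"
      and g: "g1 \<in> H'" "g2 \<in> H'" "g1 \<le> w'" "w' \<le> g2" "d' \<le> - (\<beta> * sag g1 g2 w')"
    for d d' w w' f1 f2 g1 g2 and H' :: "real set"
  proof -
    have "sag f1 f2 w - sag g1 g2 w' \<le> \<bar>w - w'\<bar>"
      using separated_inner[OF sep f(1,2) g(1-4)] sag_bounds[OF f(1,2)] sag_bounds[OF g(3,4)]
          by argo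
    then have "\<beta> * (sag f1 f2 w - sag g1 g2 w') \<le> \<beta> * \<bar>w - w'\<bar>"
      using \<beta> by (intro mult_left_mono) auto
    then show ?thesis using f(3) g(5) by (simp add: algebra_simps)
  qed
  obtain f1 f2 where f: "f1 \<in> H" "f2 \<in> H" "f1 \<le> w" "w \<le> f2"
      "d \<le> - (\<beta> * sag f1 f2 w) \<or> d \<le> \<beta> * sag f1 f2 w \<and> separated f1 f2 H'"
    using d(1) by (auto simp: excess_def)
  obtain g1 g2 where g: "g1 \<in> H'" "g2 \<in> H'" "g1 \<le> w'" "w' \<le> g2"
      "d' \<le> - (\<beta> * sag g1 g2 w') \<or> d' \<le> \<beta> * sag g1 g2 w' \<and> separated g1 g2 H"
    using d(2) by (auto simp: excess_def)
  from f(5) g(5) show ?thesis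
  proof (elim disjE conjE)
    assume "d \<le> - (\<beta> * sag f1 f2 w)" "d' \<le> - (\<beta> * sag g1 g2 w')"
    moreover have "0 \<le> \<beta> * sag f1 f2 w" "0 \<le> \<beta> * sag g1 g2 w'" "0 \<le> \<beta> * \<bar>w - w'\<bar>"
      using \<beta> sag_bounds(3)[OF f(3,4)] sag_bounds(3)[OF g(3,4)] by auto
    ultimately show ?thesis by linarith
  next
    assume "d \<le> - (\<beta> * sag f1 f2 w)" "d' \<le> \<beta> * sag g1 g2 w'" "separated g1 g2 H"
    then show ?thesis using half[of g1 g2 H w' d' f1 f2 w d] f g by (simp add: abs_minus_commute)
  next
    assume "d \<le> \<beta> * sag f1 f2 w" "separated f1 f2 H'" "d' \<le> - (\<beta> * sag g1 g2 w')"
    then show ?thesis using half f g by blast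
  next
    assume a: "d \<le> \<beta> * sag f1 f2 w" "separated f1 f2 H'" "d' \<le> \<beta> * sag g1 g2 w'" "separated g1 g2 H"
    have "sag f1 f2 w + sag g1 g2 w' \<le> \<bar>w - w'\<bar>"
      using separated_outer[OF a(2) f(1-4) a(4) g(1-4)] sag_bounds(2)[OF f(3,4)]
          sag_bounds(2)[OF g(3,4)] by argo
    then have "\<beta> * (sag f1 f2 w + sag g1 g2 w') \<le> \<beta> * \<bar>w - w'\<bar>"
      using \<beta> by (intro mult_left_mono) auto
    then show ?thesis using a by (simp add: algebra_simps)
  qed
qed

lemma excess_contact:
  assumes \<beta>: "0 < \<beta>" and f: "separated f1 f2 H'" "f1 \<in> H" "f2 \<in> H" "f1 \<le> w" "w \<le> f2"
    and d: "excess \<beta> H' H 0 w"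
  shows "f1 = f2"
proof -
  obtain g1 g2 where g: "g1 \<in> H'" "g2 \<in> H'" "g1 \<le> w" "w \<le> g2"
      "0 \<le> - (\<beta> * sag g1 g2 w) \<or> 0 \<le> \<beta> * sag g1 g2 w \<and> separated g1 g2 H"
    using d by (auto simp: excess_def)
  from g(5) show ?thesis
  proof (elim disjE conjE)
    assume "0 \<le> - (\<beta> * sag g1 g2 w)"
    then have "sag g1 g2 w \<le> 0" using \<beta> by (simp add: mult_le_0_iff)
    moreover have "f2 - f1 \<le> 0 \<or> f2 - f1 \<le> sag g1 g2 w"
      using separated_inner[OF f(1,4,5) g(1-4)] by simp
    ultimately show ?thesis using f(4,5) by linarith
  next
    assume "separated g1 g2 H"
    from separated_outer[OF f \<open>separated g1 g2 H\<close> g(1-4)] show ?thesis using f(4,5) g(3,4) by simp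
  qed
qed

text \<open>Positive excess d comes from an outward cap of width at least 2 d/\<beta>. What the
  other side has at nearly the same height must pass around this cap, about 2 d behind the
  line.\<close>

lemma excess_positive:
  assumes \<beta>: "0 < \<beta>" and d: "excess \<beta> H H' d w" "excess \<beta> H' H d' w'" "0 < d"
  shows "d \<le> \<beta> * \<bar>w - w'\<bar> \<or> d' \<le> - 2 * d + \<beta> * \<bar>w - w'\<bar>"
proof -
  obtain f1 f2 where f: "f1 \<in> H" "f2 \<in> H" "f1 \<le> w" "w \<le> f2"
      "d \<le> - (\<beta> * sag f1 f2 w) \<or> d \<le> \<beta> * sag f1 f2 w \<and> separated f1 f2 H'"
    using d(1) by (auto simp: excess_def)
  have "0 \<le> \<beta> * sag f1 f2 w" using \<beta> sag_bounds(3)[OF f(3,4)] by simp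
  then have dle: "d \<le> \<beta> * sag f1 f2 w" and sep: "separated f1 f2 H'" using f(5) d(3) by auto
  have "2 * (\<beta> * sag f1 f2 w) \<le> \<beta> * (f2 - f1)"
    using mult_left_mono[OF sag_bounds(2)[OF f(3,4)], of \<beta>] \<beta> by simp
  then have wide: "2 * d \<le> \<beta> * (f2 - f1)" using dle by linarith
  obtain g1 g2 where g: "g1 \<in> H'" "g2 \<in> H'" "g1 \<le> w'" "w' \<le> g2"
      "d' \<le> - (\<beta> * sag g1 g2 w') \<or> d' \<le> \<beta> * sag g1 g2 w' \<and> separated g1 g2 H"
    using d(2) by (auto simp: excess_def)
  from g(5) show ?thesis
  proof (elim disjE conjE)
    assume a: "d' \<le> - (\<beta> * sag g1 g2 w')"
    from separated_inner[OF sep f(3,4) g(1-4)] show ?thesis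
    proof
      assume "f2 - f1 \<le> \<bar>w - w'\<bar>"
      then have "\<beta> * (f2 - f1) \<le> \<beta> * \<bar>w - w'\<bar>" using \<beta> by (intro mult_left_mono) auto
      then show ?thesis using wide d(3) by linarith
    next
      assume "f2 - f1 - \<bar>w - w'\<bar> \<le> sag g1 g2 w'"
      then have "\<beta> * (f2 - f1 - \<bar>w - w'\<bar>) \<le> \<beta> * sag g1 g2 w'" using \<beta> by (intro mult_left_mono) auto
      then show ?thesis using wide a by (simp add: algebra_simps)
    qed
  next
    assume "separated g1 g2 H"
    from separated_outer[OF sep f(1-4) this g(1-4)]
    have "f2 - f1 \<le> 2 * \<bar>w - w'\<bar>" using g(3,4) by linarith
    then have "\<beta> * (f2 - f1) \<le> \<beta> * (2 * \<bar>w - w'\<bar>)" using \<beta> by (intro mult_left_mono) auto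
    then show ?thesis using wide by simp
  qed
qed

text \<open>At a common limit point with \<open>x\<close> \<noteq> \<open>c\<close> one side has
  excess near r = |x - c| and the other near -r at nearly the same height, whereas
  \<open>excess_positive\<close> demands at most about -2 r.\<close>

lemma excess_closure:
  assumes \<beta>: "0 < \<beta>"
    and T: "\<And>u w. (u, w) \<in> T \<Longrightarrow> excess \<beta> H H' (u - c) w"
    and B: "\<And>u w. (u, w) \<in> B \<Longrightarrow> excess \<beta> H' H (c - u) w"
    and p: "(x, v) \<in> closure T" "(x, v) \<in> closure B"
  shows "x = c"
proof -
  have *: "\<not> 0 < r" if a: "\<And>e. 0 < e \<Longrightarrow> \<exists>d w d' w'. excess \<beta> H H' d w \<and> excess \<beta> H' H d' w' \<and>
        \<bar>d - r\<bar> < e \<and> \<bar>d' + r\<bar> < e \<and> \<bar>w - w'\<bar> < 2 * e" for r and H H' :: "real set"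
  proof
    assume r: "0 < r"
    \<comment> \<open>The two alternatives would give r < e + 2 \<beta> e and r < 3 e + 2 \<beta> e;
      this choice refutes both.\<close>
    define e where "e = r / (5 + 2 * \<beta>)"
    have k: "0 < 5 + 2 * \<beta>" using \<beta> by simp
    have e: "0 < e" "e * (5 + 2 * \<beta>) = r" using r k by (simp_all add: e_def)
    obtain d w d' w' where d: "excess \<beta> H H' d w" "excess \<beta> H' H d' w'" "\<bar>d - r\<bar> < e"
        "\<bar>d' + r\<bar> < e" "\<bar>w - w'\<bar> < 2 * e"
      using a[OF e(1)] by blast
    define t where "t = \<beta> * \<bar>w - w'\<bar>"
    have b: "t \<le> 2 * (\<beta> * e)" "0 < \<beta> * e"
      using mult_left_mono[OF less_imp_le[OF d(5)], of \<beta>] \<beta> e(1) by (simp_all add: t_def)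
    have r': "r = 5 * e + 2 * (\<beta> * e)" using e(2) by (simp add: algebra_simps)
    have dd: "r - e < d" "d < r + e" "- r - e < d'" using d(3,4) by (simp_all add: abs_less_iff)
    have "0 < d" using dd r' b e(1) by linarith
    from excess_positive[OF \<beta> d(1,2) this] show False
      unfolding t_def[symmetric] using dd r' b e(1) by (elim disjE) simp_all
  qed
  have near: "\<exists>u w u' w'. (u, w) \<in> T \<and> (u', w') \<in> B \<and> \<bar>u - x\<bar> < e \<and> \<bar>u' - x\<bar> < e \<and>
      \<bar>w - w'\<bar> < 2 * e" if e: "0 < e" for e
  proof -
    obtain u w where u: "(u, w) \<in> T" "dist (u, w) (x, v) < e" using p(1) e
        by (auto simp: closure_approachable)
    obtain u' w' where u': "(u', w') \<in> B" "dist (u', w') (x, v) < e" using p(2) e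
        by (auto simp: closure_approachable)
    have "\<bar>u - x\<bar> < e" "\<bar>w - v\<bar> < e" "\<bar>u' - x\<bar> < e" "\<bar>w' - v\<bar> < e"
      using dist_fst_le[of "(u, w)" "(x, v)"] dist_snd_le[of "(u, w)" "(x, v)"]
        dist_fst_le[of "(u', w')" "(x, v)"] dist_snd_le[of "(u', w')" "(x, v)"] u u'
      by (auto simp: dist_real_def)
    then show ?thesis using u u' by (intro exI[of _ u] exI[of _ w] exI[of _ u'] exI[of _ w']) auto
  qed
  have "\<not> 0 < x - c"
  proof (rule *)
    fix e :: real assume "0 < e"
    from near[OF this] obtain u w u' w' where "(u, w) \<in> T" "(u', w') \<in> B" "\<bar>u - x\<bar> < e"
        "\<bar>u' - x\<bar> < e" "\<bar>w - w'\<bar> < 2 * e" by blast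
    then show "\<exists>d w d' w'. excess \<beta> H H' d w \<and> excess \<beta> H' H d' w' \<and>
        \<bar>d - (x - c)\<bar> < e \<and> \<bar>d' + (x - c)\<bar> < e \<and> \<bar>w - w'\<bar> < 2 * e"
      using T B by (intro exI[of _ "u - c"] exI[of _ w] exI[of _ "c - u'"] exI[of _ w']) auto
  qed
  moreover have "\<not> 0 < c - x"
  proof (rule *)
    fix e :: real assume "0 < e"
    from near[OF this] obtain u w u' w' where "(u, w) \<in> T" "(u', w') \<in> B" "\<bar>u - x\<bar> < e"
        "\<bar>u' - x\<bar> < e" "\<bar>w - w'\<bar> < 2 * e" by blast
    then show "\<exists>d w d' w'. excess \<beta> H' H d w \<and> excess \<beta> H H' d' w' \<and>
        \<bar>d - (c - x)\<bar> < e \<and> \<bar>d' + (c - x)\<bar> < e \<and> \<bar>w - w'\<bar> < 2 * e"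
      using T B by (intro exI[of _ "c - u'"] exI[of _ w'] exI[of _ "u - c"] exI[of _ w]) auto
  qed
  ultimately show ?thesis by simp
qed

subsection \<open>The parity-lexicographical order\<close>

lemma ones_simps [simp]:
  "ones [] = 0" "ones (a # w) = (if a then Suc (ones w) else ones w)"
      "ones (u @ v) = ones u + ones v"
  by (simp_all add: ones_def)

lemma plex_less_Nil [simp]: "\<not> plex_less [] v" "\<not> plex_less u []"
  by (auto simp: plex_less_def)

lemma plex_less_Cons:
  "plex_less (a # u) (b # v) \<longleftrightarrow>
     (if a = b then if a then plex_less v u else plex_less u v else \<not> a \<and> length u = length v)"
  by (cases a; cases b; cases "length u = length v")
     (simp_all add: plex_less_def Ex_less_Suc2 eq_commute[of "take _ v"]
         disj_commute cong: conj_cong)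

lemma plex_linear: "length u = length v \<Longrightarrow> u = v \<or> plex_less u v \<or> plex_less v u"
  by (induction u v rule: list_induct2) (auto simp: plex_less_Cons)

lemma plex_le_snoc:
  "plex_le (w @ [a]) (w @ [b]) \<longleftrightarrow> a = b \<or> (b = even (ones w))"
proof -
  have "plex_less (w @ [a]) (w @ [b]) \<longleftrightarrow> a \<noteq> b \<and> b = even (ones w)"
  proof (induction w arbitrary: a b)
    case (Cons c w)
    show ?case using Cons.IH[of a b] Cons.IH[of b a] by (cases c) (auto simp: plex_less_Cons)
  qed (auto simp: plex_less_Cons)
  then show ?thesis by (auto simp: plex_le_def)
qed

subsection \<open>Itineraries\<close>

definition valid :: "real \<Rightarrow> bool list \<Rightarrow> real \<Rightarrow> bool" where
  "valid s w t \<longleftrightarrow> (\<forall>i<length w. if w ! i then 1/2 \<le> (tent s ^^ i) t else (tent s ^^ i) t \<le> 1/2)"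

lemma tent_simps: "0 < s \<Longrightarrow> t \<le> 1/2 \<Longrightarrow> tent s t = s * t" "0 < s \<Longrightarrow> 1/2 \<le> t \<Longrightarrow> tent s t = s * (1 - t)"
  unfolding tent_def by (auto simp: min_def intro!: mult_left_mono dest: mult_left_le_imp_le)

lemma valid_Cons: "valid s (a # w) t \<longleftrightarrow> (if a then 1/2 \<le> t else t \<le> 1/2) \<and> valid s w (tent s t)"
  unfolding valid_def length_Cons All_less_Suc2 by (simp del: funpow.simps add: funpow_Suc_right)

text \<open>Both implications go through the induction together, as the decreasing branch of the
  tent map exchanges them.\<close>

lemma plex_less_imp_le:
  assumes s: "0 < s"
  shows "length u = length v \<Longrightarrow> valid s u t \<Longrightarrow> valid s v t' \<Longrightarrow>
    (plex_less u v \<longrightarrow> t \<le> t') \<and> (plex_less v u \<longrightarrow> t' \<le> t)"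
proof (induction u v arbitrary: t t' rule: list_induct2)
  case (Cons a u b v)
  then have IH: "(plex_less u v \<longrightarrow> T t \<le> T t') \<and> (plex_less v u \<longrightarrow> T t' \<le> T t)" if "T = tent s" for T
    by (auto simp: valid_Cons that)
  show ?case
  proof (cases "a = b")
    case False
    then show ?thesis using Cons.prems by (auto simp: plex_less_Cons valid_Cons)
  next
    case True
    then show ?thesis
      using IH[OF refl] Cons.prems s by (cases a) (auto simp: plex_less_Cons valid_Cons tent_simps)
  qed
qed auto

lemma valid_plex_le:
  assumes "0 < s" "length u = length v" "valid s u t" "valid s v t'" "t < t'"
  shows "plex_le u v"
  using plex_linear[OF assms(2)] plex_less_imp_le[OF assms(1-4)] assms(5)
  by (auto simp: plex_le_def)

lemma funpow_periodic:
  assumes "(f ^^ n) x = x" "1 \<le> n" "\<And>i. 1 \<le> i \<Longrightarrow> i < n \<Longrightarrow> (f ^^ i) x \<noteq> x"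
  shows "(f ^^ m) x = x \<longleftrightarrow> n dvd m"
proof
  assume "(f ^^ m) x = x"
  then have "(f ^^ (m mod n)) x = x" using funpow_mod_eq[OF assms(1)] by simp
  then have "m mod n = 0" using assms(2) assms(3)[of "m mod n"] by fastforce
  then show "n dvd m" by auto
next
  assume "n dvd m"
  then show "(f ^^ m) x = x" using funpow_mod_eq[OF assms(1), of m] by auto
qed

lemma plex_less_seq_snoc:
  assumes eq: "\<And>i. 1 \<le> i \<Longrightarrow> i < n \<Longrightarrow> u i = v i" and n: "1 \<le> n" "\<not> u n" "v n"
  shows "plex_less_seq u v \<longleftrightarrow> even (ones (map u [1..<n]))"
proof -
  have tk: "take k (map f [1..<Suc N]) = map f [1..<Suc k]" if "k \<le> N" for f :: "nat \<Rightarrow> bool" and k N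
    using that by (simp add: take_map take_upt del: upt_Suc)
  have pre: "map u [1..<n] = map v [1..<n]" using eq by auto
  have nth: "map f [1..<Suc N] ! k = f (Suc k)" if "k < N" for f :: "nat \<Rightarrow> bool" and k N
    using that by (simp add: nth_append del: upt_Suc)
  show ?thesis
  proof
    assume "plex_less_seq u v"
    then obtain N where "plex_less (map u [1..<Suc N]) (map v [1..<Suc N])"
      unfolding plex_less_seq_def by blast
    then obtain k where k: "k < length (map u [1..<Suc N])"
        "take k (map u [1..<Suc N]) = take k (map v [1..<Suc N])"
        "map u [1..<Suc N] ! k < map v [1..<Suc N] ! k \<and> even (ones (take k (map u [1..<Suc N]))) \<or>
         map u [1..<Suc N] ! k > map v [1..<Suc N] ! k \<and> odd (ones (take k (map u [1..<Suc N])))"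
      unfolding plex_less_def by blast
    have kN: "k < N" using k(1) by (simp del: upt_Suc)
    have k: "map u [1..<Suc k] = map v [1..<Suc k]"
        "\<not> u (Suc k) \<and> v (Suc k) \<and> even (ones (map u [1..<Suc k])) \<or> u (Suc k) \<and> \<not> v (Suc k) \<and>
            odd (ones (map u [1..<Suc k]))"
      using k(2,3) kN unfolding nth[OF kN] tk[OF less_imp_le[OF kN]] by (auto simp del: upt_Suc)
    have "\<not> n < Suc k"
    proof
      assume "n < Suc k"
      then have "u n = v n" using k(1) n(1) by (auto simp del: upt_Suc)
      then show False using n by simp
    qed
    moreover have "\<not> Suc k < n" using eq[of "Suc k"] k(2) by auto
    ultimately have "Suc k = n" by simp
    then show "even (ones (map u [1..<n]))" using k(2) n by auto
  next
    assume ev: "even (ones (map u [1..<n]))"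
    have "map u [1..<Suc n] = map u [1..<n] @ [u n]" "map v [1..<Suc n] = map u [1..<n] @ [v n]"
      using n pre by simp_all
    then have "plex_le (map u [1..<Suc n]) (map v [1..<Suc n]) \<and>
        map u [1..<Suc n] \<noteq> map v [1..<Suc n]"
      using ev n by (simp add: plex_le_snoc del: upt_Suc)
    then show "plex_less_seq u v" unfolding plex_less_seq_def plex_le_def by blast
  qed
qed

section \<open>The kneading sequence and the returns of the turning point\<close>

locale tent_map =
  fixes s :: real
  assumes s1: "1 < s" and s2: "s \<le> 2"
begin

abbreviation T where "T \<equiv> tent s"
abbreviation \<nu> where "\<nu> \<equiv> kneading s"

lemma s0: "0 < s" using s1 by simp

lemma T_half: "T (1/2) = s/2"
  using tent_simps(1)[OF s0, of "1/2"] by simp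

text \<open>Replaces the least period and the comparison in the definition by usable facts. The last
  one of the periodic case records the choice of the smaller sequence: the period word has an even
  number of ones.\<close>

lemma kneading_cases:
  obtains (aperiodic) "\<And>n. 1 \<le> n \<Longrightarrow> (T ^^ n) (1/2) \<noteq> 1/2" "\<And>i. \<nu> i = ((T ^^ i) (1/2) > 1/2)"
  | (periodic) n where "1 \<le> n" "\<And>m. (T ^^ m) (1/2) = 1/2 \<longleftrightarrow> n dvd m"
      "\<And>i. 1 \<le> i \<Longrightarrow> \<not> n dvd i \<Longrightarrow> \<nu> i = ((T ^^ i) (1/2) > 1/2)"
      "\<And>i. 1 \<le> i \<Longrightarrow> \<nu> (i + n) = \<nu> i" "\<nu> n = odd (ones (map \<nu> [1..<n]))"
proof (cases "\<exists>n\<ge>1. (T ^^ n) (1/2) = 1/2")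
  case False
  then show thesis by (intro aperiodic) (auto simp: kneading_def)
next
  case True
  define n where "n = (LEAST n. n \<ge> 1 \<and> (T ^^ n) (1/2) = 1/2)"
  have n: "1 \<le> n" "(T ^^ n) (1/2) = 1/2"
    using LeastI_ex[of "\<lambda>n. n \<ge> 1 \<and> (T ^^ n) (1/2) = 1/2"] True by (auto simp: n_def)
  have least: "(T ^^ i) (1/2) \<noteq> 1/2" if "1 \<le> i" "i < n" for i
    using not_less_Least[of i "\<lambda>n. n \<ge> 1 \<and> (T ^^ n) (1/2) = 1/2"] that unfolding n_def by blast
  have per: "(T ^^ m) (1/2) = 1/2 \<longleftrightarrow> n dvd m" for m
    using funpow_periodic[OF n(2,1) least] by blast
  define w where "w = map (\<lambda>i. (T ^^ i) (1/2) > 1/2) [1..<n]"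
  have lw: "length w = n - 1" by (simp add: w_def)
  define p where "p b = periodic_seq (w @ [b])" for b
  have \<nu>: "\<nu> = (if plex_less_seq (p False) (p True) then p False else p True)"
    by (simp only: if_True kneading_def True Let_def n_def w_def p_def)
  have p_nth: "p b i = (w @ [b]) ! ((i - 1) mod n)" for b i
    using n(1) by (simp add: p_def periodic_seq_def lw)
  have p_eq: "p b i = ((T ^^ i) (1/2) > 1/2)" if "1 \<le> i" "\<not> n dvd i" for b i
  proof -
    have lt: "(i - 1) mod n < n" using n(1) by simp
    have ne: "(i - 1) mod n \<noteq> n - 1"
    proof
      assume "(i - 1) mod n = n - 1"
      then have "Suc ((i - 1) mod n) = n" using n(1) by simp
      then have "i mod n = 0" using mod_Suc[of "i - 1" n] that(1) by simp
      then show False using that(2) by auto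
    qed
    then have j: "(i - 1) mod n < n - 1" using lt by simp
    then have "p b i = ((T ^^ Suc ((i - 1) mod n)) (1/2) > 1/2)"
      by (simp add: p_nth nth_append lw w_def del: funpow.simps)
    also have "Suc ((i - 1) mod n) = i mod n" using mod_Suc[of "i - 1" n] that(1) j by simp
    finally show ?thesis using funpow_mod_eq[OF n(2)] by simp
  qed
  have p_n: "p b n = b" for b using n(1) by (simp add: p_nth nth_append lw)
  have p_less: "p False i = p True i" if "1 \<le> i" "i < n" for i
  proof -
    have "\<not> n dvd i" using that by (auto dest: dvd_imp_le)
    then show ?thesis using p_eq that(1) by blast
  qed
  have cmp: "plex_less_seq (p False) (p True) \<longleftrightarrow> even (ones (map (p False) [1..<n]))"
    using plex_less_seq_snoc[of n "p False" "p True"] p_less n(1) p_n by simp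
  have pre: "map (p True) [1..<n] = map (p False) [1..<n]" using p_less by auto
  show thesis
  proof (rule periodic[OF n(1) per])
    show "\<nu> i = ((T ^^ i) (1/2) > 1/2)" if "1 \<le> i" "\<not> n dvd i" for i
      using that p_eq by (simp add: \<nu>)
    show "\<nu> (i + n) = \<nu> i" if "1 \<le> i" for i
    proof -
      have "(i + n - 1) mod n = (i - 1) mod n" using that
          by (simp add: mod_add_self2 flip: Nat.add_diff_assoc2)
      then show ?thesis by (simp add: \<nu> p_nth)
    qed
    show "\<nu> n = odd (ones (map \<nu> [1..<n]))"
    proof (cases "plex_less_seq (p False) (p True)")
      case True
      then have "\<nu> = p False" by (simp add: \<nu>)
      then show ?thesis using cmp True p_n by simp
    next
      case False
      then have "\<nu> = p True" by (simp add: \<nu>)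
      then show ?thesis using cmp False p_n pre by (simp only:) simp
    qed
  qed
qed

lemma kneading_off: "1 \<le> m \<Longrightarrow> (T ^^ m) (1/2) \<noteq> 1/2 \<Longrightarrow> \<nu> m = ((T ^^ m) (1/2) > 1/2)"
  by (cases rule: kneading_cases) auto

lemma kneading_1: "\<nu> 1"
  using kneading_off[of 1] T_half s1 by simp

lemma kneading_turn:
  obtains e where "\<And>m. 1 \<le> m \<Longrightarrow> (T ^^ m) (1/2) = 1/2 \<Longrightarrow> \<nu> m = e"
proof (cases rule: kneading_cases)
  case (periodic n)
  have "\<nu> (n * Suc k) = \<nu> n" for k
  proof (induction k)
    case (Suc k)
    have "1 \<le> n * Suc k" using periodic(1) by simp
    then have "\<nu> (n * Suc k + n) = \<nu> (n * Suc k)" by (rule periodic(4))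
    moreover have "n * Suc (Suc k) = n * Suc k + n" by simp
    ultimately show ?case using Suc by presburger
  qed simp
  then have "\<nu> m = \<nu> n" if "1 \<le> m" "n dvd m" for m
    using that by (metis dvdE mult_0_right not0_implies_Suc not_one_le_zero)
  then show thesis using periodic(2) that by blast
qed (use that in blast)

text \<open>A return time is a multiple of the period, and the prefix of that length consists of
  period words, each with an even number of ones.\<close>

lemma kneading_even:
  assumes "1 \<le> m" "(T ^^ m) (1/2) = 1/2"
  shows "\<nu> m = odd (ones (map \<nu> [1..<m]))"
proof (cases rule: kneading_cases)
  case (periodic n)
  have e: "even (ones (map \<nu> [1..<1 + n * k]))" for k
  proof (induction k)
    case (Suc k)
    have shift: "\<nu> (i + n * k) = \<nu> i" if "1 \<le> i" for i
    proof (induction k)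
      case (Suc k)
      have "1 \<le> i + n * k" using that by simp
      then have "\<nu> (i + n * k + n) = \<nu> (i + n * k)" by (rule periodic(4))
      moreover have "i + n * Suc k = i + n * k + n" by simp
      ultimately show ?case using Suc by presburger
    qed simp
    have "[1..<1 + n * k + n] = [1..<1 + n * k] @ [1 + n * k..<1 + n * k + n]"
      by (rule upt_add_eq_append) simp
    moreover have "1 + n * Suc k = 1 + n * k + n" by simp
    ultimately have
        "map \<nu> [1..<1 + n * Suc k] = map \<nu> [1..<1 + n * k] @ map \<nu> [1 + n * k..<1 + n * k + n]"
      by (simp only: map_append)
    moreover have "map \<nu> [1 + n * k..<1 + n * k + n] = map \<nu> [1..<1 + n]"
    proof (rule nth_equalityI)
      fix i assume "i < length (map \<nu> [1 + n * k..<1 + n * k + n])"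
      then show "map \<nu> [1 + n * k..<1 + n * k + n] ! i = map \<nu> [1..<1 + n] ! i"
        using shift[of "1 + i"] by (simp add: add.assoc add.commute[of i] del: upt_Suc)
    qed simp
    moreover have "map \<nu> [1..<1 + n] = map \<nu> [1..<n] @ [\<nu> n]"
      using periodic(1) by simp
    moreover have "even (ones (map \<nu> [1..<n] @ [\<nu> n]))" using periodic(5) by (simp split: if_splits)
    ultimately show ?case using Suc by (simp del: upt_Suc)
  qed simp
  obtain k where "m = n * k" using assms periodic(2) by auto
  then have "even (ones (map \<nu> [1..<1 + m]))" using e by blast
  moreover have "map \<nu> [1..<1 + m] = map \<nu> [1..<m] @ [\<nu> m]" using assms(1) by simp
  ultimately show ?thesis by (auto split: if_splits)
qed (use assms in blast)

lemma valid_kneading: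
  "valid s (map \<nu> [k..<k + n]) ((T ^^ k) (1/2))" if "1 \<le> k"
proof -
  have A: "if \<nu> (k + i) then 1/2 \<le> (T ^^ (k + i)) (1/2) else (T ^^ (k + i)) (1/2) \<le> 1/2" for i
    using kneading_off[of "k + i"] that by (cases "(T ^^ (k + i)) (1/2) = 1/2") auto
  have B: "(T ^^ i) ((T ^^ k) (1/2)) = (T ^^ (k + i)) (1/2)" for i
    by (simp add: funpow_add add.commute[of k])
  show ?thesis
    unfolding valid_def
  proof (intro allI impI)
    fix i assume "i < length (map \<nu> [k..<k + n])"
    then have "map \<nu> [k..<k + n] ! i = \<nu> (k + i)" by simp
    then show "if map \<nu> [k..<k + n] ! i then 1/2 \<le> (T ^^ i) ((T ^^ k) (1/2)) else (T ^^ i)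
        ((T ^^ k) (1/2)) \<le> 1/2"
      using A[of i] unfolding B by simp
  qed
qed

end

section \<open>Two-sided itineraries of threads\<close>

lemma map_upto_upt: "map a [k + 1..k + int n] = map (\<lambda>i. a (k + int i)) [1..<1 + n]"
proof (induction n)
  case (Suc n)
  have "[k + 1..k + int (Suc n)] = [k + 1..k + int n] @ [k + int (Suc n)]"
    using upto_rec2[of "k + 1" "k + int (Suc n)"] by simp
  then show ?case using Suc by (simp del: upt_Suc add: upt_Suc_append)
qed simp

definition window :: "(int \<Rightarrow> bool) \<Rightarrow> int \<Rightarrow> nat \<Rightarrow> bool list" where
  "window a p n = map (\<lambda>i. a (p + int i)) [0..<n]"

lemma drop_map_upto: "drop q (map a [i..j]) = window a (i + int q) (length [i..j] - q)"
  by (rule nth_equalityI) (auto simp: window_def nth_upto algebra_simps)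

lemma coord_0: "coord s x 0 = x 0"
  by (simp add: coord_def)

lemma coord_nonpos: "coord s x (- int j) = x j"
  by (simp add: coord_def)

lemma coord_step: "x \<in> tent_limit s \<Longrightarrow> coord s x (i + 1) = tent s (coord s x i)"
proof -
  assume x: "x \<in> tent_limit s"
  consider "i < 0" | "0 \<le> i" by linarith
  then show ?thesis
  proof cases
    case 1
    then have "nat (- i) = Suc (nat (- (i + 1)))" by simp
    then show ?thesis using 1 x by (simp add: coord_def tent_limit_def)
  next
    case 2
    then have "nat (i + 1) = Suc (nat i)" by simp
    then show ?thesis using 2 by (simp add: coord_def)
  qed
qed

lemma coord_funpow: "x \<in> tent_limit s \<Longrightarrow> coord s x (k + int m) = (tent s ^^ m) (coord s x k)"
proof (induction m)
  case (Suc m)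
  then show ?case using coord_step[of x s "k + int m"] by (simp add: algebra_simps)
qed simp

context tent_map
begin

text \<open>A word that starts with a one does not reach into an infinite initial block of zeros,
  where admissibility of the sequence does not control words.\<close>

lemma adm_word_window:
  assumes "adm_two_sided s a" "a i" "i \<le> j"
  shows "adm_word s (map a [i..j])"
proof -
  consider "\<forall>i j. adm_word s (map a [i..j])"
    | k where "\<forall>i<k. \<not> a i" "\<forall>i j. k \<le> i \<longrightarrow> adm_word s (map a [i..j])"
    | "\<forall>i. \<not> a i"
    using assms(1) unfolding adm_two_sided_def by blast
  then show ?thesis
  proof cases
    case 2
    then have "k \<le> i" using assms(2) by (meson not_less)
    then show ?thesis using 2 by blast
  qed (use assms in auto)
qed

text \<open>A forbidden continuation of a prefix of the kneading sequence would exceed that sequence.\<close>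

lemma adm_continuation:
  assumes adm: "adm_two_sided s a" and j: "1 \<le> j"
    and pre: "\<And>i. 1 \<le> i \<Longrightarrow> i < j \<Longrightarrow> a (k + int i) = \<nu> i" and ne: "a (k + int j) \<noteq> \<nu> j"
  shows "even (ones (map \<nu> [1..<j])) = \<nu> j"
proof (cases "j = 1")
  case True
  then show ?thesis using kneading_1 by simp
next
  case False
  then have "a (k + 1)" using pre[of 1] kneading_1 j by simp
  then have "adm_word s (map a [k + 1..k + int j])" using adm j by (intro adm_word_window) auto
  moreover have "map a [k + 1..k + int j] = map \<nu> [1..<j] @ [a (k + int j)]"
    unfolding map_upto_upt using j pre by simp
  ultimately have "adm_word s (map \<nu> [1..<j] @ [a (k + int j)])" by simp
  then have "plex_le (map \<nu> [1..<j] @ [a (k + int j)]) (map \<nu> [1..<1 + j])"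
    using j by (auto simp: adm_word_def dest!: spec[of _ 0] simp del: upt_Suc)
  moreover have "map \<nu> [1..<1 + j] = map \<nu> [1..<j] @ [\<nu> j]" using j by simp
  ultimately show ?thesis using ne plex_le_snoc by metis
qed

lemma represents_coord:
  "represents s a x \<Longrightarrow> coord s x i \<noteq> 1/2 \<Longrightarrow> a i = (coord s x i > 1/2)"
  unfolding represents_def by (cases "a i") (fastforce dest!: conjunct2 spec[of _ i])+

text \<open>Where the orbit is not at 1/2 the coordinate dictates the symbol. At a return both
  symbols fit, but by the parity of the period word the one that \<nu> does not have yields a word
  above the kneading sequence.\<close>

lemma represents_after_turn:
  assumes x: "x \<in> tent_limit s" and a: "represents s a x" and k: "coord s x k = 1/2"
  shows "1 \<le> m \<Longrightarrow> a (k + int m) = \<nu> m"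
proof (induction m rule: less_induct)
  case (less m)
  have c: "coord s x (k + int m) = (T ^^ m) (1/2)" using coord_funpow[OF x, of k m] unfolding k .
  show ?case
  proof (cases "(T ^^ m) (1/2) = 1/2")
    case False
    then show ?thesis using represents_coord[OF a, of "k + int m"] c kneading_off[OF less.prems]
        by simp
  next
    case True
    show ?thesis
    proof (rule ccontr)
      assume "\<not> ?thesis"
      then have "even (ones (map \<nu> [1..<m])) = \<nu> m"
        using a less by (intro adm_continuation[of a m k]) (auto simp: represents_def)
      then show False using kneading_even[OF less.prems True] by simp
    qed
  qed
qed

subsection \<open>Existence of admissible itineraries\<close>

lemma T_range: "t \<in> {0..1} \<Longrightarrow> T t \<in> {0..s/2}"
  using s0 mult_left_mono[of t "1/2" s] mult_left_mono[of "1 - t" "1/2" s]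
  by (cases "t \<le> 1/2") (auto simp: tent_simps)

lemma coord_unit: "x \<in> tent_limit s \<Longrightarrow> coord s x i \<in> {0..1}"
proof (cases "i \<le> 0")
  case False
  assume x: "x \<in> tent_limit s"
  have "(T ^^ n) (x 0) \<in> {0..1}" for n
    using x T_range s2 by (induction n) (fastforce simp: tent_limit_def)+
  then show ?thesis using False by (simp add: coord_def)
qed (auto simp: coord_def tent_limit_def)

lemma coord_range: "x \<in> tent_limit s \<Longrightarrow> coord s x i \<in> {0..s/2}"
  using coord_step[of x s "i - 1"] T_range[OF coord_unit, of x "i - 1"] by simp

text \<open>Coordinates equal to 1/2 get the symbol that \<nu> has at all returns. Words are
  admissible while the thread is in the core from l = T(T(1/2)) to s/2. A thread with a coordinate
  below l has been below l in its entire past, so it starts with infinitely many zeros, and it is in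
  the core from its first one on.\<close>

lemma represents_exists:
  assumes x: "x \<in> tent_limit s"
  obtains a where "represents s a x"
proof -
  define z where "z = coord s x"
  define l where "l = s * (1 - s/2)"
  have step: "z (i + 1) = T (z i)" for i using coord_step[OF x] by (simp add: z_def)
  have pow: "z (i + int m) = (T ^^ m) (z i)" for i m using coord_funpow[OF x] by (simp add: z_def)
  have range: "0 \<le> z i" "z i \<le> s/2" for i using coord_range[OF x, of i] by (auto simp: z_def)
  obtain e where e: "\<And>m. 1 \<le> m \<Longrightarrow> (T ^^ m) (1/2) = 1/2 \<Longrightarrow> \<nu> m = e"
    by (rule kneading_turn) blast
  define a where "a i = (if z i = 1/2 then e else z i > 1/2)" for i
  have valid: "valid s (window a p n) (z p)" for p n
    unfolding valid_def window_def using pow[of p, symmetric] by (auto simp: a_def)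
  have turn: "a (k + int m) = \<nu> m" if "z k = 1/2" "1 \<le> m" for k m
    using e[OF that(2)] kneading_off[OF that(2)] pow[of k m] that(1) by (auto simp: a_def)
  have T2: "(T ^^ 1) (1/2) = s/2" "(T ^^ 2) (1/2) = l"
    using s1 tent_simps(2)[OF s0, of "s/2"] by (simp_all add: T_half numeral_2_eq_2 l_def)
  have turned: "z (p - 1) = 1/2" if "z p = s/2" for p
  proof (cases "z (p - 1) \<le> 1/2")
    case True
    then show ?thesis using step[of "p - 1"] that s0 by (simp add: tent_simps)
  next
    case False
    then show ?thesis using step[of "p - 1"] that s0 by (simp add: tent_simps)
  qed
  have upper: "plex_le (window a p n) (map \<nu> [1..<1 + n])" for p n
  proof (cases "z p = s/2")
    case True
    have "a (p + int i) = \<nu> (1 + i)" for i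
      using turn[OF turned[OF True], of "1 + i"] by (simp add: algebra_simps)
    then have "window a p n = map \<nu> [1..<1 + n]"
      by (intro nth_equalityI) (auto simp: window_def simp del: upt_Suc)
    then show ?thesis by (simp add: plex_le_def)
  next
    case False
    then show ?thesis
      using valid_plex_le[OF s0 _ valid valid_kneading[of 1 n], of p n] T2 range(2)[of p]
      by (simp add: window_def del: upt_Suc)
  qed
  have l: "l < 1/2"
  proof -
    have "0 < (s - 1)\<^sup>2" using s1 by simp
    then show ?thesis by (simp add: l_def power2_eq_square algebra_simps)
  qed
  \<comment> \<open>At z p = l the predecessor matters: if it is s/2, the turning point lies two
    steps back. The other preimage 1 - s/2 is at least l only for s = 2; then l = 0 is fixed and
    both words consist of zeros.\<close>
  have lower: "plex_le (map \<nu> [2..<2 + n]) (window a p n)" if "l \<le> z p" "l < z p \<or> l \<le> z (p - 1)"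
      for p n
  proof (cases "l < z p")
    case True
    then show ?thesis
      using valid_plex_le[OF s0 _ valid_kneading[of 2 n] valid, of p n] T2
      by (simp add: window_def del: upt_Suc)
  next
    case False
    then have zp: "z p = l" "l \<le> z (p - 1)" using that by auto
    have "a (p + int i) = \<nu> (2 + i)" for i
    proof (cases "z (p - 1) \<le> 1/2")
      case False
      then have "z (p - 1) = s/2" using step[of "p - 1"] zp s0 by (simp add: tent_simps l_def)
      from turn[OF turned[OF this], of "2 + i"] show ?thesis by (simp add: algebra_simps)
    next
      case True
      then have "z (p - 1) = 1 - s/2" using step[of "p - 1"] zp s0 by (simp add: tent_simps l_def)
      then have "l \<le> 1 - s/2" using zp(2) by simp
      moreover have "(s - 1) * (1 - s/2) = l - (1 - s/2)" by (simp add: l_def field_simps)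
      ultimately have "(s - 1) * (1 - s/2) \<le> 0" by simp
      then have "s = 2" using s1 s2 by (simp add: mult_le_0_iff)
      then have l0: "l = 0" by (simp add: l_def)
      have "(T ^^ i) 0 = 0" for i using tent_simps(1)[OF s0, of 0] by (induction i) simp_all
      then have 0: "z (p + int i) = 0" "(T ^^ (2 + i)) (1/2) = 0"
        using pow[of p i] zp T2(2) l0 funpow_add[of i 2 T] by (simp_all add: add.commute)
      then show ?thesis using kneading_off[of "2 + i"] by (simp add: a_def)
    qed
    then have "window a p n = map \<nu> [2..<2 + n]"
      by (intro nth_equalityI) (auto simp: window_def simp del: upt_Suc)
    then show ?thesis by (simp add: plex_le_def)
  qed
  have word: "adm_word s (map a [i..j])" if "\<And>p. i \<le> p \<Longrightarrow> l \<le> z p \<and> (l < z p \<or> l \<le> z (p - 1))"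
      for i j
    unfolding adm_word_def drop_map_upto using that lower upper by auto
  have inv: "l \<le> T t" if "l \<le> t" "t \<le> s/2" for t
  proof (cases "t \<le> 1/2")
    case True
    have "0 \<le> l" using s0 s2 by (simp add: l_def)
    then have "0 \<le> t" using that by linarith
    then have "t \<le> s * t" using s1 mult_right_mono[of 1 s t] by simp
    then show ?thesis using True that s0 by (simp add: tent_simps)
  next
    case False
    then show ?thesis using that s0 by (simp add: tent_simps l_def)
  qed
  have "adm_two_sided s a"
  proof (cases "\<forall>i. l \<le> z i")
    case True
    then show ?thesis using word by (auto simp: adm_two_sided_def)
  next
    case False
    then obtain i0 where i0: "z i0 < l" by (auto simp: not_le)
    have small: "z (i0 - int n) < l" for n
    proof (induction n)
      case (Suc n)
      define t where "t = z (i0 - int (Suc n))"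
      have t: "T t < l" using step[of "i0 - int (Suc n)"] Suc by (simp add: t_def)
      have "t \<le> 1/2"
      proof (rule ccontr)
        assume "\<not> t \<le> 1/2"
        then have "T t = s * (1 - t)" using s0 by (simp add: tent_simps)
        moreover have "l \<le> s * (1 - t)"
          using range(2) s0 unfolding l_def t_def by (intro mult_left_mono) auto
        ultimately show False using t by simp
      qed
      then have "T t = s * t" using s0 by (simp add: tent_simps)
      moreover have "t \<le> s * t" using range(1) s1 mult_right_mono[of 1 s t] by (simp add: t_def)
      ultimately show ?case using t by (simp add: t_def)
    qed (use i0 in simp)
    have a0: "\<not> a i" if "i \<le> i0" for i
      using small[of "nat (i0 - i)"] that l by (auto simp: a_def)
    show ?thesis
    proof (cases "\<exists>i. a i")
      case True
      then obtain i1 where i1: "a i1" by blast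
      define m where "m = (LEAST m. a (i0 + int m))"
      have ex: "a (i0 + int (nat (i1 - i0)))" using i1 a0[of i1] by auto
      define k where "k = i0 + int m"
      have ak: "a k" unfolding k_def m_def using ex by (rule LeastI)
      have below: "\<not> a i" if "i < k" for i
        using a0[of i] not_less_Least[of "nat (i - i0)" "\<lambda>m. a (i0 + int m)"] that
        unfolding k_def m_def by (cases "i \<le> i0") auto
      have zk: "1/2 \<le> z k" using ak by (auto simp: a_def split: if_splits)
      have above: "l \<le> z (k + int n)" for n
      proof (induction n)
        case 0
        then show ?case using zk l by simp
      next
        case (Suc n)
        then show ?case using inv[OF _ range(2)] step[of "k + int n"] by (simp add: algebra_simps)
      qed
      have "l \<le> z p \<and> (l < z p \<or> l \<le> z (p - 1))" if "k \<le> p" for p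
        using above[of "nat (p - k)"] above[of "nat (p - 1 - k)"] that zk l by (cases "p = k") auto
      then have "\<forall>i j. k \<le> i \<longrightarrow> adm_word s (map a [i..j])" using word by auto
      then show ?thesis using ak below unfolding adm_two_sided_def by blast
    qed (auto simp: adm_two_sided_def)
  qed
  moreover have "coord s x i \<in> (if a i then {1/2..1} else {0..1/2})" for i
    using coord_unit[OF x, of i] by (auto simp: a_def z_def)
  ultimately show thesis using that unfolding represents_def by blast
qed

end

subsection \<open>Heights\<close>

abbreviation tail_seq :: "(nat \<Rightarrow> bool) \<Rightarrow> nat \<Rightarrow> bool" where
  "tail_seq l \<equiv> (\<lambda>k. l (k + 1))"

lemma ones_lword: "ones (lword l j (Suc 0)) = ones (map l [Suc 0..<Suc j])"
  by (simp add: lword_def ones_def del: upt_Suc)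

lemma ones_lword_Suc:
  "ones (lword l (Suc j) (Suc 0)) = (if l 1 then 1 else 0) + ones (lword (tail_seq l) j (Suc 0))"
proof -
  have "[Suc 0..<Suc (Suc j)] = Suc 0 # map Suc [Suc 0..<Suc j]"
    by (subst upt_conv_Cons) (simp_all add: map_Suc_upt del: upt_Suc)
  then show ?thesis unfolding ones_lword by (simp add: o_def del: upt_Suc)
qed

definition height_term :: "(nat \<Rightarrow> bool) \<Rightarrow> (nat \<Rightarrow> bool) \<Rightarrow> nat \<Rightarrow> real" where
  "height_term L l i = (-1) powi (int (ones (lword L (Suc i) 1)) - int (ones (lword l (Suc i) 1))) * (1 / 3 ^ Suc i)"

lemma height_eq: "height L l = suminf (height_term L l) + 1/2"
  unfolding height_def height_term_def[abs_def] ..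

lemma thirds_sums: "(\<lambda>i. 1 / 3 ^ Suc i) sums (1/2 :: real)"
proof -
  have "(\<lambda>i. (1/3) * (1/3) ^ i) sums ((1/3) * (1 / (1 - 1/3)) :: real)"
    by (intro sums_mult geometric_sums) simp
  then show ?thesis by (simp add: power_divide)
qed

lemma abs_height_term: "\<bar>height_term L l i\<bar> = 1 / 3 ^ Suc i"
proof -
  have "\<bar>(-1 :: real) powi n\<bar> = 1" for n
    by (simp add: power_int_abs)
  then show ?thesis by (simp add: height_term_def abs_mult)
qed

lemma summable_height_term: "summable (height_term L l)"
  by (rule summable_rabs_cancel) (simp only: abs_height_term sums_summable[OF thirds_sums])

lemma height_bounds: "0 \<le> height L l" "height L l \<le> 1"
proof -
  have "\<bar>suminf (height_term L l)\<bar> \<le> (\<Sum>i. \<bar>height_term L l i\<bar>)"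
    by (rule summable_rabs) (simp only: abs_height_term sums_summable[OF thirds_sums])
  also have "\<dots> = 1/2" unfolding abs_height_term using sums_unique[OF thirds_sums] by simp
  finally show "0 \<le> height L l" "height L l \<le> 1" unfolding height_eq by linarith+
qed

lemma height_rec:
  "height L l = (if L 1 = l 1 then (height (tail_seq L) (tail_seq l) + 2) / 3
     else (1 - height (tail_seq L) (tail_seq l)) / 3)"
proof -
  define \<epsilon> :: real where "\<epsilon> = (if L 1 = l 1 then 1 else -1)"
  have 0: "height_term L l 0 = \<epsilon> / 3"
    by (auto simp: height_term_def lword_def \<epsilon>_def)
  have Suc: "height_term L l (Suc i) = \<epsilon> / 3 * height_term (tail_seq L) (tail_seq l) i" for i
  proof -
    have "(-1 :: real) powi (int (ones (lword L (Suc (Suc i)) 1)) - int (ones (lword l (Suc (Suc i)) 1)))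
       = \<epsilon> * (-1) powi (int (ones (lword (tail_seq L) (Suc i) 1)) - int (ones (lword (tail_seq l)
           (Suc i) 1)))"
      unfolding One_nat_def ones_lword_Suc[of _ "Suc i"] \<epsilon>_def
      by (auto simp: power_int_add power_int_diff power_int_minus field_simps)
    then show ?thesis by (simp add: height_term_def)
  qed
  have "suminf (height_term L l) = height_term L l 0 + (\<Sum>i. height_term L l (Suc i))"
    using suminf_split_head[OF summable_height_term] by simp
  also have "\<dots> = \<epsilon> / 3 + \<epsilon> / 3 * suminf (height_term (tail_seq L) (tail_seq l))"
    by (simp only: 0 Suc suminf_mult[OF summable_height_term])
  finally have "height L l = \<epsilon> / 3 + \<epsilon> / 3 * (height (tail_seq L) (tail_seq l) - 1/2) + 1/2"
    by (simp add: height_eq)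
  then show ?thesis by (cases "L 1 = l 1") (simp_all add: \<epsilon>_def field_simps)
qed

lemma height_cong:
  assumes "\<And>j. 1 \<le> j \<Longrightarrow> L j = L' j" "\<And>j. 1 \<le> j \<Longrightarrow> l j = l' j"
  shows "height L l = height L' l'"
proof -
  have "map L [1..<Suc (Suc i)] = map L' [1..<Suc (Suc i)]"
      "map l [1..<Suc (Suc i)] = map l' [1..<Suc (Suc i)]" for i
    using assms by (auto simp del: upt_Suc)
  then have "height_term L l = height_term L' l'"
    unfolding height_term_def[abs_def] One_nat_def ones_lword by metis
  then show ?thesis by (simp add: height_eq)
qed

lemma height_agree:
  "(\<And>i. 1 \<le> i \<Longrightarrow> i \<le> k \<Longrightarrow> l i = m i) \<Longrightarrow> \<bar>height L l - height L m\<bar> \<le> (1/3) ^ k"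
proof (induction k arbitrary: L l m)
  case 0
  show ?case using height_bounds[of L l] height_bounds[of L m] by (simp add: abs_le_iff)
next
  case (Suc k)
  have "\<bar>height (tail_seq L) (tail_seq l) - height (tail_seq L) (tail_seq m)\<bar> \<le> (1/3) ^ k"
    by (rule Suc.IH) (use Suc.prems in auto)
  moreover have "l 1 = m 1" using Suc.prems by simp
  moreover have "\<bar>(A + 2) / 3 - (B + 2) / 3\<bar> \<le> 1/3 * c" "\<bar>(1 - A) / 3 - (1 - B) / 3\<bar> \<le> 1/3 * c"
    if "\<bar>A - B\<bar> \<le> c" for A B c :: real
    using that unfolding abs_le_iff by (simp_all add: field_simps)
  ultimately show ?case unfolding height_rec[of L l] height_rec[of L m] power_Suc by simp
qed

text \<open>As long as n agrees with l and m, one and the same affine map of ratio 1/3 acts on all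
  three heights. At the first disagreement n lies in the opposite outer third. With
  \<open>height_agree\<close> this yields the gap demanded by \<open>separated\<close>.\<close>

lemma height_differ:
  assumes "\<And>i. 1 \<le> i \<Longrightarrow> i \<le> k \<Longrightarrow> l i = m i" and "1 \<le> i" "i \<le> k" "n i \<noteq> l i"
  shows "height L l + (1/3) ^ k \<le> height L n \<and> height L m + (1/3) ^ k \<le> height L n \<or>
    height L n + (1/3) ^ k \<le> height L l \<and> height L n + (1/3) ^ k \<le> height L m"
  using assms
proof (induction k arbitrary: L l m n i)
  case (Suc k)
  define A where "A = height (tail_seq L) (tail_seq l)"
  define B where "B = height (tail_seq L) (tail_seq m)"
  define C where "C = height (tail_seq L) (tail_seq n)"
  define p :: real where "p = (1/3) ^ k"
  have p: "p \<le> 1" by (simp add: p_def power_le_one)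
  have lm: "l 1 = m 1" using Suc.prems(1)[of 1] by simp
  have b: "0 \<le> A" "A \<le> 1" "0 \<le> B" "B \<le> 1" "0 \<le> C" "C \<le> 1"
    unfolding A_def B_def C_def by (rule height_bounds)+
  note rec = height_rec[of L l, folded A_def] height_rec[of L m, folded B_def]
      height_rec[of L n, folded C_def]
    power_Suc[of "1/3 :: real" k, folded p_def]
  show ?case
  proof (cases "n 1 = l 1")
    case False
    then show ?thesis
      unfolding rec using lm b p by (cases "L 1 = l 1") (auto simp: field_simps)
  next
    case True
    then have "i \<noteq> 1" using Suc.prems by auto
    then have "A + p \<le> C \<and> B + p \<le> C \<or> C + p \<le> A \<and> C + p \<le> B"
      using Suc.prems unfolding A_def B_def C_def p_def
      by (intro Suc.IH[of "tail_seq l" "tail_seq m" "i - 1" "tail_seq n"]) auto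
    then show ?thesis
      unfolding rec using lm True by (cases "L 1 = l 1") (auto simp: field_simps)
  qed
qed auto

lemma height_inj: "height L l = height L m \<Longrightarrow> 1 \<le> j \<Longrightarrow> l j = m j"
proof (rule ccontr)
  assume a: "height L l = height L m" "1 \<le> j" "l j \<noteq> m j"
  then have "height L l + (1/3) ^ j \<le> height L m \<and> height L l + (1/3) ^ j \<le> height L m \<or>
      height L m + (1/3) ^ j \<le> height L l \<and> height L m + (1/3) ^ j \<le> height L l"
    by (intro height_differ[of j l l j]) auto
  moreover have "0 < (1/3 :: real) ^ j" by simp
  ultimately show False using a(1) by linarith
qed

subsection \<open>Pictures with elliptic caps\<close>

abbreviation hgt :: "(nat \<Rightarrow> bool) \<Rightarrow> (int \<Rightarrow> bool) \<Rightarrow> real" where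
  "hgt L a \<equiv> height L (left_part a)"

definition cap ::
    "real \<Rightarrow> real \<Rightarrow> (nat \<Rightarrow> bool) \<Rightarrow> (nat \<Rightarrow> real) \<Rightarrow> (int \<Rightarrow> bool) \<Rightarrow> (int \<Rightarrow> bool) \<Rightarrow> int \<Rightarrow> (real \<times> real) set" where
  "cap \<alpha> s L x a b k = half_ellipse \<alpha> (odd (ones (map a [k + 1..-1]))) (x 0) (hgt L a) (hgt L b)"

definition joined :: "real \<Rightarrow> (nat \<Rightarrow> real) \<Rightarrow> (int \<Rightarrow> bool) \<Rightarrow> (int \<Rightarrow> bool) \<Rightarrow> int \<Rightarrow> bool" where
  "joined s x a b k \<longleftrightarrow> represents s a x \<and> represents s b x \<and> identified_at s k a b"

text \<open>The picture is divided by the symbol at index 0, since the fold sends the two parts to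
  different bands. A cap at k < 0 does not mix the parts, as its two sequences agree at 0.\<close>

definition piece :: "real \<Rightarrow> real \<Rightarrow> (nat \<Rightarrow> bool) \<Rightarrow> bool \<Rightarrow> (nat \<Rightarrow> real) \<Rightarrow> (real \<times> real) set" where
  "piece \<alpha> s L e x = {p. (\<exists>a. represents s a x \<and> a 0 = e \<and> p = (x 0, hgt L a)) \<or>
     (\<exists>a b k. joined s x a b k \<and> k < 0 \<and> a 0 = e \<and> p \<in> cap \<alpha> s L x a b k)}"

definition picture :: "real \<Rightarrow> real \<Rightarrow> (nat \<Rightarrow> bool) \<Rightarrow> (nat \<Rightarrow> real) \<Rightarrow> (real \<times> real) set" where
  "picture \<alpha> s L x = piece \<alpha> s L False x \<union> piece \<alpha> s L True x"

lemma picture_iff: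
  "p \<in> picture \<alpha> s L x \<longleftrightarrow> (\<exists>a. represents s a x \<and> p = (x 0, hgt L a)) \<or>
     (\<exists>a b k. joined s x a b k \<and> k < 0 \<and> p \<in> cap \<alpha> s L x a b k)"
  unfolding picture_def piece_def Un_iff mem_Collect_eq by blast

lemma picture_cong:
  assumes "\<And>j. 1 \<le> j \<Longrightarrow> L j = L' j"
  shows "picture \<alpha> s L x = picture \<alpha> s L' x"
proof -
  have "hgt L a = hgt L' a" for a using assms by (intro height_cong) auto
  then show ?thesis by (auto simp: picture_iff cap_def)
qed

lemma semicircle_half_ellipse: "semicircle lf t y z = half_ellipse 1 lf t y z"
proof -
  have "(u - t)\<^sup>2 + (v - (y + z) / 2)\<^sup>2 = ((y - z) / 2)\<^sup>2 \<longleftrightarrow> (u - t)\<^sup>2 = 1\<^sup>2 * ((v - y) * (z - v))"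
      for u v :: real
  proof -
    have "((y - z) / 2)\<^sup>2 - (v - (y + z) / 2)\<^sup>2 = (v - y) * (z - v)"
        by (simp add: power2_eq_square field_simps)
    then show ?thesis by (simp add: eq_diff_eq[symmetric])
  qed
  then show ?thesis by (simp add: semicircle_def half_ellipse_def)
qed

lemma drawn_picture:
  assumes "x \<in> tent_limit s"
  shows "drawn s L x = picture 1 s L x"
proof -
  have "{(x 0, height L l) | l. x \<in> basic_arc s l} = {(x 0, hgt L a) | a. represents s a x}"
  proof safe
    fix l assume "x \<in> basic_arc s l"
    then obtain a where "represents s a x" "\<forall>j\<ge>1. left_part a j = l j" by (auto simp: basic_arc_def)
    then show "\<exists>a. (x 0, height L l) = (x 0, hgt L a) \<and> represents s a x"
      using height_cong[of L L l "left_part a"] by auto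
  next
    fix a assume "represents s a x"
    then show "\<exists>l. (x 0, hgt L a) = (x 0, height L l) \<and> x \<in> basic_arc s l"
      using assms by (auto simp: basic_arc_def)
  qed
  then show ?thesis
    unfolding drawn_def semicircle_half_ellipse set_eq_iff picture_iff joined_def cap_def by blast
qed


section \<open>Position of caps relative to the turning line\<close>

definition side_heights :: "real \<Rightarrow> (nat \<Rightarrow> bool) \<Rightarrow> bool \<Rightarrow> real set" where
  "side_heights s L e = {hgt L a | a x. x \<in> tent_limit s \<and> represents s a x \<and> a 0 = e}"

lemma half_ellipse_between:
  assumes "(u, v) \<in> half_ellipse \<alpha> lf t y z" "0 < \<alpha>"
  shows "min y z \<le> v" "v \<le> max y z" "u = (if lf then t - \<alpha> * sag (min y z)
      (max y z) v else t + \<alpha> * sag (min y z) (max y z) v)"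
proof -
  have e: "(u - t)\<^sup>2 = \<alpha>\<^sup>2 * ((v - y) * (z - v))" and lf: "if lf then u \<le> t else t \<le> u"
    using assms by (auto simp: half_ellipse_def)
  then have "0 \<le> (v - y) * (z - v)" using assms(2)
    by (metis zero_le_mult_iff zero_le_power2 zero_less_power not_less)
  then show b: "min y z \<le> v" "v \<le> max y z"
    by (auto simp: zero_le_mult_iff min_def max_def)
  have "sag (min y z) (max y z) v = sqrt ((v - y) * (z - v))"
    by (auto simp: sag_def min_def max_def algebra_simps)
  moreover have "\<bar>u - t\<bar> = sqrt ((u - t)\<^sup>2)" by simp
  ultimately have "\<bar>u - t\<bar> = \<alpha> * sag (min y z) (max y z) v"
    unfolding e using assms(2) by (simp add: real_sqrt_mult)
  then show "u = (if lf then t - \<alpha> * sag (min y z) (max y z) v else t + \<alpha> * sag (min y z)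
      (max y z) v)"
    using lf by (auto split: if_splits)
qed

lemma represents_side: "represents s a x \<Longrightarrow> (if a 0 then 1/2 \<le> x 0 else x 0 \<le> 1/2)"
  unfolding represents_def by (auto dest!: spec[of _ 0] simp: coord_0 split: if_splits)

lemma joined_side: "joined s x a b k \<Longrightarrow> k < 0 \<Longrightarrow> b 0 = a 0"
  by (auto simp: joined_def identified_at_def)

context tent_map
begin

text \<open>
  A cap that bends across the turning point comes from a word \<open>c\<^sub>1\<dots>c\<^sub>j\<^sub>-\<^sub>1\<close> that is followed by \<open>c\<^sub>j\<close>;
  the parity that decides the side of the cap makes the other continuation inadmissible.
\<close>

lemma cap_separated:
  assumes j: "joined s x a b k" "k < 0" and lf: "odd (ones (map a [k + 1..-1])) = a 0"
  shows "separated (min (hgt L a) (hgt L b)) (max (hgt L a) (hgt L b)) (side_heights s L (\<not> a 0))"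
  unfolding separated_def
proof
  fix h assume "h \<in> side_heights s L (\<not> a 0)"
  then obtain c y where c: "h = hgt L c" "represents s c y" "c 0 = (\<not> a 0)"
    by (auto simp: side_heights_def)
  define n where "n = nat (- k)"
  have n: "1 \<le> n" "k + int n = 0" "k + int (n - 1) = -1" using j(2) by (auto simp: n_def)
  have ident: "\<And>i. i \<noteq> k \<Longrightarrow> a i = b i" "\<And>i. 1 \<le> i \<Longrightarrow> a (k + int i) = \<nu> i"
    using j(1) by (auto simp: joined_def identified_at_def)
  have "map a [k + 1..-1] = map \<nu> [1..<n]"
    using map_upto_upt[of a k "n - 1"] n(1) ident(2) unfolding n(3) by simp
  then have par: "odd (ones (map \<nu> [1..<n])) = \<nu> n" using lf ident(2)[OF n(1)] n(2) by simp
  have "\<exists>i. 1 \<le> i \<and> i < n \<and> c (k + int i) \<noteq> \<nu> i"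
  proof (rule ccontr)
    assume "\<not> ?thesis"
    then have "even (ones (map \<nu> [1..<n])) = \<nu> n"
      using c(2,3) n ident(2)[OF n(1)] by (intro adm_continuation[of c n k])
          (auto simp: represents_def)
    then show False using par by simp
  qed
  then obtain i where i: "1 \<le> i" "i < n" "c (k + int i) \<noteq> a (k + int i)" using ident(2) by auto
  define d where "d = n - i"
  have d: "1 \<le> d" "d \<le> n - 1" "- int d = k + int i" using i n by (auto simp: d_def of_nat_diff)
  have agree: "left_part a i = left_part b i" if "1 \<le> i" "i \<le> n - 1" for i
    using that n ident(1)[of "- int i"] by (auto simp: left_part_def)
  \<comment> \<open>\<open>a\<close> and \<open>b\<close> agree at the indices -1, ..., -(n - 1),
    and \<open>c\<close> deviates at one of these, so its gap to both heights is at least the bound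
    for their distance.\<close>
  have "hgt L a + (1/3) ^ (n - 1) \<le> hgt L c \<and> hgt L b + (1/3) ^ (n - 1) \<le> hgt L c \<or>
    hgt L c + (1/3) ^ (n - 1) \<le> hgt L a \<and> hgt L c + (1/3) ^ (n - 1) \<le> hgt L b"
    using height_differ[of "n - 1" "left_part a" "left_part b" d "left_part c" L] agree d i
    by (auto simp: left_part_def)
  moreover have "\<bar>hgt L a - hgt L b\<bar> \<le> (1/3) ^ (n - 1)"
    using agree by (intro height_agree)
  ultimately show "h \<le> min (hgt L a) (hgt L b) - (max (hgt L a) (hgt L b) - min (hgt L a)
      (hgt L b)) \<or>
      max (hgt L a) (hgt L b) + (max (hgt L a) (hgt L b) - min (hgt L a) (hgt L b)) \<le> h"
    unfolding c(1) by (auto simp: min_def max_def)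
qed

definition beyond :: "bool \<Rightarrow> real \<Rightarrow> real" where
  "beyond e u = (if e then 1/2 - u else u - 1/2)"

lemma hgt_side: "x \<in> tent_limit s \<Longrightarrow> represents s a x \<Longrightarrow> hgt L a \<in> side_heights s L (a 0)"
  by (auto simp: side_heights_def)

lemma piece_cases:
  assumes x: "x \<in> tent_limit s" and p: "(u, w) \<in> piece \<beta> s L e x" and \<beta>: "0 < \<beta>"
  obtains a b where "represents s a x" "represents s b x" "a 0 = e" "b 0 = e"
    "min (hgt L a) (hgt L b) \<le> w" "w \<le> max (hgt L a) (hgt L b)"
    "beyond e u = beyond e (x 0) - \<beta> * sag (min (hgt L a) (hgt L b)) (max (hgt L a) (hgt L b)) w \<or>
     beyond e u = beyond e (x 0) + \<beta> * sag (min (hgt L a) (hgt L b)) (max (hgt L a) (hgt L b)) w \<and>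
     separated (min (hgt L a) (hgt L b)) (max (hgt L a) (hgt L b)) (side_heights s L (\<not> e))"
proof -
  from p consider a where "represents s a x" "a 0 = e" "u = x 0" "w = hgt L a"
    | a b k where "joined s x a b k" "k < 0" "a 0 = e" "(u, w) \<in> cap \<beta> s L x a b k"
    by (auto simp: piece_def)
  then show thesis
  proof cases
    case 1
    then show thesis by (intro that[of a a]) (auto simp: sag_def)
  next
    case 2
    note b = half_ellipse_between[OF 2(4)[unfolded cap_def] \<beta>]
    show thesis
    proof (rule that[of a b, OF _ _ _ _ b(1,2)])
      show "represents s a x" "represents s b x" "a 0 = e" "b 0 = e"
        using 2 joined_side[OF 2(1,2)] by (auto simp: joined_def)
      show "beyond e u = beyond e (x 0) - \<beta> * sag (min (hgt L a) (hgt L b)) (max (hgt L a)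
          (hgt L b)) w \<or>
         beyond e u = beyond e (x 0) + \<beta> * sag (min (hgt L a) (hgt L b)) (max (hgt L a)
             (hgt L b)) w \<and>
         separated (min (hgt L a) (hgt L b)) (max (hgt L a) (hgt L b)) (side_heights s L (\<not> e))"
        using cap_separated[OF 2(1,2), of L] 2(3) b(3) by (auto simp: beyond_def)
    qed
  qed
qed

lemma beyond_le: "represents s a x \<Longrightarrow> beyond (a 0) (x 0) \<le> 0"
  using represents_side[of s a x] by (auto simp: beyond_def split: if_splits)

lemma piece_excess:
  assumes x: "x \<in> tent_limit s" and p: "(u, w) \<in> piece \<beta> s L e x" and \<beta>: "0 < \<beta>"
  shows "excess \<beta> (side_heights s L e) (side_heights s L (\<not> e)) (beyond e u) w"
proof -
  obtain a b where ab: "represents s a x" "represents s b x" "a 0 = e" "b 0 = e"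
    "min (hgt L a) (hgt L b) \<le> w" "w \<le> max (hgt L a) (hgt L b)"
    "beyond e u = beyond e (x 0) - \<beta> * sag (min (hgt L a) (hgt L b)) (max (hgt L a) (hgt L b)) w \<or>
     beyond e u = beyond e (x 0) + \<beta> * sag (min (hgt L a) (hgt L b)) (max (hgt L a) (hgt L b)) w \<and>
     separated (min (hgt L a) (hgt L b)) (max (hgt L a) (hgt L b)) (side_heights s L (\<not> e))"
    by (rule piece_cases[OF assms])
  have m: "min (hgt L a) (hgt L b) \<in> side_heights s L e" "max (hgt L a)
      (hgt L b) \<in> side_heights s L e"
    using hgt_side[OF x ab(1), of L] hgt_side[OF x ab(2), of L] ab(3,4)
        by (auto simp: min_def max_def)
  have "beyond e (x 0) \<le> 0" using beyond_le[OF ab(1)] ab(3) by simp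
  then show ?thesis
    unfolding excess_def using ab(5,6,7) by (intro bexI[OF _ m(1)] bexI[OF _ m(2)]) auto
qed

lemma piece_bound:
  assumes x: "x \<in> tent_limit s" and p: "(u, w) \<in> piece \<beta> s L e x" and \<beta>: "0 < \<beta>" "\<beta> \<le> 1"
  shows "beyond e u \<le> 1/2" "0 \<le> w" "w \<le> 1"
proof -
  obtain a b where ab: "represents s a x" "a 0 = e"
    "min (hgt L a) (hgt L b) \<le> w" "w \<le> max (hgt L a) (hgt L b)"
    "beyond e u = beyond e (x 0) - \<beta> * sag (min (hgt L a) (hgt L b)) (max (hgt L a) (hgt L b)) w \<or>
     beyond e u = beyond e (x 0) + \<beta> * sag (min (hgt L a) (hgt L b)) (max (hgt L a) (hgt L b)) w"
    by (rule piece_cases[OF x p \<beta>(1)]) blast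
  let ?S = "sag (min (hgt L a) (hgt L b)) (max (hgt L a) (hgt L b)) w"
  have h: "0 \<le> min (hgt L a) (hgt L b)" "max (hgt L a) (hgt L b) \<le> 1"
    using height_bounds by (auto simp: min_def max_def)
  then show "0 \<le> w" "w \<le> 1" using ab(3,4) by linarith+
  have S: "0 \<le> ?S" "2 * ?S \<le> 1" using sag_bounds(2,3)[OF ab(3,4)] h by linarith+
  then have "0 \<le> \<beta> * ?S" "\<beta> * ?S \<le> 1 * ?S" using \<beta>(1) mult_right_mono[OF \<beta>(2) S(1)] by auto
  moreover have "beyond e (x 0) \<le> 0" using beyond_le[OF ab(1)] ab(2) by simp
  ultimately show "beyond e u \<le> 1/2" using ab(5) S by linarith
qed

text \<open>A piece may cross the line on an outward cap, but where the other side reaches the line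
  too, such a cap has width zero by \<open>excess_contact\<close>. Only an end of an arc
  remains.\<close>

lemma piece_contact:
  assumes x: "x \<in> tent_limit s" and p: "(1/2, w) \<in> piece \<beta> s L e x" and \<beta>: "0 < \<beta>"
    and c: "excess \<beta> (side_heights s L (\<not> e)) (side_heights s L e) 0 w"
  obtains a where "represents s a x" "a 0 = e" "x 0 = 1/2" "w = hgt L a"
proof -
  obtain a b where ab: "represents s a x" "represents s b x" "a 0 = e" "b 0 = e"
    "min (hgt L a) (hgt L b) \<le> w" "w \<le> max (hgt L a) (hgt L b)"
    "beyond e (1/2) = beyond e (x 0) - \<beta> * sag (min (hgt L a) (hgt L b)) (max (hgt L a)
        (hgt L b)) w \<or>
     beyond e (1/2) = beyond e (x 0) + \<beta> * sag (min (hgt L a) (hgt L b)) (max (hgt L a)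
         (hgt L b)) w \<and>
     separated (min (hgt L a) (hgt L b)) (max (hgt L a) (hgt L b)) (side_heights s L (\<not> e))"
    by (rule piece_cases[OF x p \<beta>])
  let ?f = "min (hgt L a) (hgt L b)" and ?g = "max (hgt L a) (hgt L b)"
  have mem: "?f \<in> side_heights s L e" "?g \<in> side_heights s L e"
    using hgt_side[OF x ab(1), of L] hgt_side[OF x ab(2), of L] ab(3,4)
        by (auto simp: min_def max_def)
  have le: "beyond e (x 0) \<le> 0" using beyond_le[OF ab(1)] ab(3) by simp
  have nn: "0 \<le> \<beta> * sag ?f ?g w" using \<beta> sag_bounds(3)[OF ab(5,6)] by simp
  have 0: "beyond e (1/2) = 0" by (simp add: beyond_def)
  have "beyond e (x 0) = 0 \<and> (w = ?f \<or> w = ?g)"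
    using ab(7)
  proof (elim disjE conjE)
    assume "beyond e (1/2) = beyond e (x 0) - \<beta> * sag ?f ?g w"
    then have "beyond e (x 0) = 0" "\<beta> * sag ?f ?g w = 0" using le nn 0 by linarith+
    then show ?thesis using \<beta> by (auto simp: sag_def)
  next
    assume a: "beyond e (1/2) = beyond e (x 0) + \<beta> * sag ?f ?g w"
        "separated ?f ?g (side_heights s L (\<not> e))"
    then have "?f = ?g" using excess_contact[OF \<beta> a(2) mem ab(5,6)] c by simp
    then have "w = ?f" using ab(5,6) by linarith
    then show ?thesis using a(1) 0 by (simp add: sag_def)
  qed
  then have "x 0 = 1/2" "w = hgt L a \<or> w = hgt L b"
    by (auto simp: beyond_def min_def max_def split: if_splits)
  then show thesis using that ab by metis
qed

end

subsection \<open>Prolonging a thread\<close>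

text \<open>The self-map of the inverse limit induced by T. It lowers every index by one, so that an
  identification at index 0 turns into a cap at -1.\<close>

definition prolong :: "real \<Rightarrow> (nat \<Rightarrow> real) \<Rightarrow> nat \<Rightarrow> real" where
  "prolong s y = case_nat (tent s (y 0)) y"

definition shift :: "int \<Rightarrow> (int \<Rightarrow> bool) \<Rightarrow> int \<Rightarrow> bool" where
  "shift d a i = a (i + d)"

lemma shift_shift [simp]: "shift d (shift e a) = shift (d + e) a"
  by (auto simp: shift_def add.assoc)

lemma shift_0 [simp]: "shift 0 a = a"
  by (auto simp: shift_def)

lemma map_shift: "map (shift d a) [i..j] = map a [i + d..j + d]"
  by (rule nth_equalityI) (auto simp: shift_def nth_upto algebra_simps)

lemma adm_shift: "adm_two_sided s a \<Longrightarrow> adm_two_sided s (shift d a)"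
  unfolding adm_two_sided_def map_shift
proof (elim disjE exE conjE)
  fix k assume k: "a k" "\<forall>i<k. \<not> a i" "\<forall>i j. k \<le> i \<longrightarrow> adm_word s (map a [i..j])"
  have "shift d a (k - d) \<and> (\<forall>i<k - d. \<not> shift d a i) \<and>
      (\<forall>i j. k - d \<le> i \<longrightarrow> adm_word s (map a [i + d..j + d]))"
    using k by (auto simp: shift_def)
  then show "(\<forall>i j. adm_word s (map a [i + d..j + d])) \<or>
    (\<exists>k. shift d a k \<and> (\<forall>i<k. \<not> shift d a i) \<and> (\<forall>i j. k \<le> i \<longrightarrow> adm_word s (map a [i + d..j + d]))) \<or>
    (\<forall>i. \<not> shift d a i)" by blast
qed (auto simp: shift_def)

lemma identified_shift: "identified_at s k a b \<Longrightarrow> identified_at s (k - d) (shift d a) (shift d b)"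
  by (auto simp: identified_at_def shift_def algebra_simps)

lemma left_part_shift: "tail_seq (left_part (shift 1 a)) = left_part a"
  by (auto simp: left_part_def shift_def)

lemma coord_prolong: "coord s (prolong s y) i = coord s y (i + 1)"
proof -
  consider "i < 0" | "i = 0" | "0 < i" by linarith
  then show ?thesis
  proof cases
    case 1
    then have "nat (- i) = Suc (nat (- (i + 1)))" by simp
    then show ?thesis using 1 by (simp add: coord_def prolong_def)
  next
    case 3
    then have "nat (i + 1) = Suc (nat i)" by simp
    then show ?thesis using 3 by (simp add: coord_def prolong_def funpow_swap1)
  qed (simp add: coord_def prolong_def)
qed

lemma represents_prolong: "represents s (shift 1 a) (prolong s y) \<longleftrightarrow> represents s a y"
proof -
  have "adm_two_sided s (shift 1 a) \<longleftrightarrow> adm_two_sided s a"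
    using adm_shift[of s a 1] adm_shift[of s "shift 1 a" "-1"] by auto
  moreover have all: "(\<forall>i. P (i + 1)) \<longleftrightarrow> (\<forall>i. P i)" for P :: "int \<Rightarrow> bool"
    by (metis diff_add_cancel)
  have "(\<forall>i. coord s y (i + 1) \<in> (if shift 1 a i then {1/2..1} else {0..1/2})) \<longleftrightarrow>
      (\<forall>i. coord s y i \<in> (if a i then {1/2..1} else {0..1/2}))"
    using all[of "\<lambda>i. coord s y i \<in> (if a i then {1/2..1} else {0..1/2})"] by (simp only: shift_def)
  ultimately show ?thesis
    by (simp only: represents_def coord_prolong)
qed

lemma joined_prolong: "joined s (prolong s y) (shift 1 a) (shift 1 b) (k - 1) \<longleftrightarrow> joined s y a b k"
  using identified_shift[of s k a b 1] identified_shift[of s "k - 1" "shift 1 a" "shift 1 b" "-1"]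
  by (auto simp: joined_def represents_prolong)

section \<open>Arcs and caps under the fold\<close>

lemma shift_inverse: "\<exists>a'. a = shift 1 a'"
  by (rule exI[of _ "shift (-1) a"]) simp

definition fold_arm :: "real \<Rightarrow> bool \<Rightarrow> real \<times> real \<Rightarrow> real \<times> real" where
  "fold_arm s e p = (if e then (s * (1 - fst p), (1 - snd p) / 3) else (s * fst p, (snd p + 2) / 3))"

lemma fold_arm_surj: "0 < s \<Longrightarrow> \<exists>p'. p = fold_arm s e p'"
  by (rule exI[of _ "if e then (1 - fst p / s, 1 - 3 * snd p) else (fst p / s, 3 * snd p - 2)"])
     (auto simp: fold_arm_def)

lemma fold_arm_inj: "0 < s \<Longrightarrow> fold_arm s e p = fold_arm s e p' \<Longrightarrow> p = p'"
  by (auto simp: fold_arm_def prod_eq_iff split: if_splits)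

lemma hgt_shift: "\<not> L 1 \<Longrightarrow>
    hgt L (shift 1 a) = (if a 0 then (1 - hgt (tail_seq L) a) / 3 else (hgt (tail_seq L) a + 2) / 3)"
  using height_rec[of L "left_part (shift 1 a)"] left_part_shift[of a]
  by (simp add: left_part_def shift_def)

lemma prolong_0:
  assumes "0 < s" "represents s a y"
  shows "prolong s y 0 = (if a 0 then s * (1 - y 0) else s * y 0)"
  using represents_side[OF assms(2)] assms(1) by (auto simp: prolong_def tent_simps)

lemma arc_prolong:
  assumes "0 < s" "\<not> L 1" "represents s a y"
  shows "(prolong s y 0, hgt L (shift 1 a)) = fold_arm s (a 0) (y 0, hgt (tail_seq L) a)"
  using prolong_0[OF assms(1,3)] hgt_shift[of L a] assms(2) by (simp add: fold_arm_def)

lemma half_ellipse_commute: "half_ellipse \<alpha> lf t y z = half_ellipse \<alpha> lf t z y"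
proof -
  have "(v - y) * (z - v) = (v - z) * (y - v)" for v by (simp add: algebra_simps)
  then show ?thesis by (simp add: half_ellipse_def)
qed

lemma fold_arm_half_ellipse:
  assumes "0 < s"
  shows "fold_arm s False p \<in> half_ellipse \<alpha> lf (s * t) ((y + 2) / 3) ((z + 2) / 3) \<longleftrightarrow>
      p \<in> half_ellipse (\<alpha> / (3 * s)) lf t y z"
    "fold_arm s True p \<in> half_ellipse \<alpha> lf (s * (1 - t)) ((1 - y) / 3) ((1 - z) / 3) \<longleftrightarrow>
        p \<in> half_ellipse (\<alpha> / (3 * s)) (\<not> lf) t y z"
proof -
  obtain u w where p: "p = (u, w)" by (cases p)
  have sc: "s\<^sup>2 * (u - t)\<^sup>2 = \<alpha>\<^sup>2 * (D / 9) \<longleftrightarrow> (u - t)\<^sup>2 = (\<alpha> / (3 * s))\<^sup>2 * D" for D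
    using assms by (simp add: power_divide power_mult_distrib field_simps)
  have prods: "((w + 2) / 3 - (y + 2) / 3) * ((z + 2) / 3 - (w + 2) / 3) = ((w - y) * (z - w)) / 9"
    "((1 - w) / 3 - (1 - y) / 3) * ((1 - z) / 3 - (1 - w) / 3) = ((w - y) * (z - w)) / 9"
    by (simp_all add: field_simps)
  have squares: "(s * u - s * t)\<^sup>2 = s\<^sup>2 * (u - t)\<^sup>2"
      "(s * (1 - u) - s * (1 - t))\<^sup>2 = s\<^sup>2 * (u - t)\<^sup>2"
    by (simp_all add: power2_eq_square algebra_simps)
  have sides: "s * u \<le> s * t \<longleftrightarrow> u \<le> t" "s * t \<le> s * u \<longleftrightarrow> t \<le> u"
      "s * (1 - u) \<le> s * (1 - t) \<longleftrightarrow> t \<le> u" "s * (1 - t) \<le> s * (1 - u) \<longleftrightarrow> u \<le> t"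
    using assms by simp_all
  show "fold_arm s False p \<in> half_ellipse \<alpha> lf (s * t) ((y + 2) / 3) ((z + 2) / 3) \<longleftrightarrow>
      p \<in> half_ellipse (\<alpha> / (3 * s)) lf t y z"
    "fold_arm s True p \<in> half_ellipse \<alpha> lf (s * (1 - t)) ((1 - y) / 3) ((1 - z) / 3) \<longleftrightarrow>
        p \<in> half_ellipse (\<alpha> / (3 * s)) (\<not> lf) t y z"
    unfolding p half_ellipse_def fold_arm_def fst_conv snd_conv if_True if_False mem_Collect_eq prod.case
      prods squares sides sc by (cases lf; simp)+
qed

text \<open>The word that decides the side of the cap gains the old symbol at 0. If this is a one,
  the parity changes, in accordance with the horizontal reversal on that part. Stretching by s and
  shrinking by 3 multiplies the aspect ratio by 3 s.\<close>

lemma cap_prolong: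
  assumes "0 < s" "\<not> L 1" and j: "joined s y a b k" "k < 0"
  shows "fold_arm s (a 0) p \<in> cap \<alpha> s L (prolong s y) (shift 1 a) (shift 1 b) (k - 1) \<longleftrightarrow>
    p \<in> cap (\<alpha> / (3 * s)) s (tail_seq L) y a b k"
proof -
  have "[k + 1..0] = [k + 1..-1] @ [0]" using upto_rec2[of "k + 1" 0] j(2) by simp
  then have "map (shift 1 a) [k - 1 + 1..-1] = map a [k + 1..-1] @ [a 0]"
    unfolding map_shift by simp
  moreover have "b 0 = a 0" using joined_side[OF j] .
  ultimately show ?thesis
    using fold_arm_half_ellipse[OF assms(1)] prolong_0[OF assms(1), of a y] j(1)
    by (cases "a 0") (auto simp: cap_def hgt_shift[of L, OF assms(2)] joined_def)
qed

text \<open>The two sequences have the same left part and thus give one point before the fold, at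
  abscissa 1/2. The fold sends it to two ends in different bands; the word between is empty, so the
  cap bends to the right.\<close>

lemma turning_cap_prolong:
  assumes "0 < s" "\<not> L 1" and j: "joined s y a b 0"
  shows "y 0 = 1/2" "hgt (tail_seq L) b = hgt (tail_seq L) a"
    "cap \<alpha> s L (prolong s y) (shift 1 a) (shift 1 b) (-1) =
       half_ellipse \<alpha> False (s/2) ((hgt (tail_seq L) a + 2) / 3) ((1 - hgt (tail_seq L) a) / 3)"
proof -
  have r: "represents s a y" "represents s b y" and ne: "a 0 \<noteq> b 0" and eq: "\<And>i. i \<noteq> 0 \<Longrightarrow> a i = b i"
    using j by (auto simp: joined_def identified_at_def)
  show y: "y 0 = 1/2" using represents_side[OF r(1)] represents_side[OF r(2)] ne
      by (auto split: if_splits)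
  show h: "hgt (tail_seq L) b = hgt (tail_seq L) a"
    using eq by (intro height_cong) (auto simp: left_part_def)
  have p: "prolong s y 0 = s/2" using prolong_0[OF assms(1) r(1)] y by simp
  have no_ones: "odd (ones (map (shift 1 a) [-1 + 1..-1])) = False" by simp
  show "cap \<alpha> s L (prolong s y) (shift 1 a) (shift 1 b) (-1) =
       half_ellipse \<alpha> False (s/2) ((hgt (tail_seq L) a + 2) / 3) ((1 - hgt (tail_seq L) a) / 3)"
    unfolding cap_def p no_ones hgt_shift[of L, OF assms(2)] h
    using ne by (cases "a 0") (simp_all only: if_True if_False half_ellipse_commute simp_thms)
qed

lemma picture_prolong_cases:
  assumes s: "0 < s" "\<not> L 1" and p: "p \<in> picture \<alpha> s L (prolong s y)"
  obtains (arm) e p' where "p' \<in> piece (\<alpha> / (3 * s)) s (tail_seq L) e y" "p = fold_arm s e p'"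
  | (turn) a b where "joined s y a b 0"
      "p \<in> half_ellipse \<alpha> False (s/2) ((hgt (tail_seq L) a + 2) / 3) ((1 - hgt (tail_seq L) a) / 3)"
proof -
  from p consider a where "represents s a (prolong s y)" "p = (prolong s y 0, hgt L a)"
    | a b k where "joined s (prolong s y) a b k" "k < 0" "p \<in> cap \<alpha> s L (prolong s y) a b k"
    unfolding picture_iff by blast
  then show thesis
  proof cases
    case 1
    obtain a' where a': "a = shift 1 a'" using shift_inverse by blast
    then have "represents s a' y" using 1 represents_prolong by simp
    then show thesis
      using 1 a' arc_prolong[where L = L, OF s] by (intro arm[of "(y 0, hgt (tail_seq L) a')"
          "a' 0"]) (auto simp: piece_def)
  next
    case 2
    obtain a' b' where a': "a = shift 1 a'" "b = shift 1 b'" using shift_inverse by blast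
    define k' where "k' = k + 1"
    have k: "k = k' - 1" by (simp add: k'_def)
    have j: "joined s y a' b' k'" using 2(1) unfolding a' k joined_prolong .
    show thesis
    proof (cases "k' = 0")
      case True
      then show thesis using turn[of a' b']
          j 2(3) turning_cap_prolong(3)[where L = L, OF s, of y a' b' \<alpha>] a' k by simp
    next
      case False
      then have k0: "k' < 0" using 2(2) k by simp
      obtain p' where p': "p = fold_arm s (a' 0) p'" using fold_arm_surj[OF s(1)] by blast
      then have "p' \<in> cap (\<alpha> / (3 * s)) s (tail_seq L) y a' b' k'"
        using 2(3) cap_prolong[where L = L, OF s j k0] unfolding a' k by simp
      then show thesis using arm[of p' "a' 0"] p' j k0 by (auto simp: piece_def)
    qed
  qed
qed

lemma fold_arm_picture:
  assumes s: "0 < s" "\<not> L 1" and p: "p \<in> piece (\<alpha> / (3 * s)) s (tail_seq L) e y"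
  shows "fold_arm s e p \<in> picture \<alpha> s L (prolong s y)"
proof -
  from p consider a where "represents s a y" "a 0 = e" "p = (y 0, hgt (tail_seq L) a)"
    | a b k where "joined s y a b k" "k < 0" "a 0 = e"
        "p \<in> cap (\<alpha> / (3 * s)) s (tail_seq L) y a b k"
    unfolding piece_def by blast
  then show ?thesis
  proof cases
    case 1
    then have "represents s (shift 1 a) (prolong s y)" by (simp add: represents_prolong)
    moreover have "fold_arm s e p = (prolong s y 0, hgt L (shift 1 a))"
      using arc_prolong[where L = L, OF s 1(1)] 1 by simp
    ultimately show ?thesis unfolding picture_iff by blast
  next
    case 2
    then have "fold_arm s e p \<in> cap \<alpha> s L (prolong s y) (shift 1 a) (shift 1 b) (k - 1)"
      using cap_prolong[where L = L, OF s 2(1,2)] by simp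
    moreover have "joined s (prolong s y) (shift 1 a) (shift 1 b) (k - 1)" using 2 joined_prolong
        by simp
    moreover have "k - 1 < 0" using 2 by simp
    ultimately show ?thesis unfolding picture_iff by blast
  qed
qed

lemma turning_cap_picture:
  assumes s: "0 < s" "\<not> L 1" and j: "joined s y a b 0"
  shows "half_ellipse \<alpha> False (s/2) ((hgt (tail_seq L) a + 2) / 3) ((1 - hgt (tail_seq L) a) / 3)
    \<subseteq> picture \<alpha> s L (prolong s y)"
proof
  fix p assume "p \<in> half_ellipse \<alpha> False (s/2) ((hgt (tail_seq L) a + 2) / 3)
      ((1 - hgt (tail_seq L) a) / 3)"
  then have "p \<in> cap \<alpha> s L (prolong s y) (shift 1 a) (shift 1 b) (-1)"
    using turning_cap_prolong(3)[where L = L, OF s j] by simp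
  moreover have "joined s (prolong s y) (shift 1 a) (shift 1 b) (-1)"
      using j joined_prolong[of s y a b 0] by simp
  ultimately show "p \<in> picture \<alpha> s L (prolong s y)" unfolding picture_iff by force
qed

context tent_map
begin

abbreviation X where "X \<equiv> tent_limit s"

lemma prolong_limit: "y \<in> X \<Longrightarrow> prolong s y \<in> X"
  using T_range[of "y 0"] s2 by (auto simp: tent_limit_def prolong_def split: nat.split)

lemma limit_prolong:
  assumes "x \<in> X" obtains y where "y \<in> X" "x = prolong s y"
proof
  show "(\<lambda>i. x (Suc i)) \<in> X" using assms by (auto simp: tent_limit_def)
  show "x = prolong s (\<lambda>i. x (Suc i))" using assms
      by (auto simp: tent_limit_def prolong_def split: nat.split)
qed

lemma prolong_image: "prolong s ` X = X"
  using prolong_limit limit_prolong by blast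

lemma prolong_inj: "prolong s y = prolong s y' \<Longrightarrow> y = y'"
  by (rule ext) (metis old.nat.simps(5) prolong_def)

lemma limit_eqI:
  assumes "y \<in> X" "y' \<in> X" "represents s a y" "represents s a' y'" "y 0 = y' 0" "\<And>j. 1 \<le> j \<Longrightarrow>
      left_part a j = left_part a' j"
  shows "y = y'"
proof
  fix n
  show "y n = y' n"
  proof (induction n)
    case (Suc n)
    have "tent s (y (Suc n)) = tent s (y' (Suc n))" using Suc assms(1,2)
        by (simp add: tent_limit_def)
    moreover have side: "if a (- int (Suc n)) then 1/2 \<le> z (Suc n) else z (Suc n) \<le> 1/2"
      if "represents s a z" for a z
    proof -
      have "coord s z (- int (Suc n)) \<in> (if a (- int (Suc n)) then {1/2..1} else {0..1/2})"
        using that unfolding represents_def by blast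
      then show ?thesis unfolding coord_nonpos by (auto split: if_splits)
    qed
    moreover have "a (- int (Suc n)) = a' (- int (Suc n))"
      using assms(6)[of "Suc n"] by (simp add: left_part_def)
    ultimately show ?case
      using side[OF assms(3)] side[OF assms(4)] s0 by (cases "a (- int (Suc n))")
          (simp_all add: tent_simps)
  qed (use assms in simp)
qed

text \<open>\<open>is_phi\<close> for caps of aspect ratio \<alpha>. Of the embedding only
  injectivity and the closed image are kept; both pass to \<phi> \<circ> \<open>prolong s\<close>,
  since \<open>prolong s\<close> permutes \<open>X\<close>.\<close>

definition pictured :: "real \<Rightarrow> (nat \<Rightarrow> bool) \<Rightarrow> ((nat \<Rightarrow> real) \<Rightarrow> real \<times> real) \<Rightarrow> bool" where
  "pictured \<alpha> L \<phi> \<longleftrightarrow> inj_on \<phi> X \<and> closed (\<phi> ` X) \<and>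
     (\<exists>q :: real \<times> real \<Rightarrow> real \<times> real. quotient_map euclidean euclidean q \<and>
        (\<forall>x\<in>X. \<forall>p\<in>picture \<alpha> s L x. q p = \<phi> x) \<and>
        (\<forall>p p'. q p = q p' \<longleftrightarrow> p = p' \<or> (\<exists>x\<in>X. p \<in> picture \<alpha> s L x \<and> p' \<in> picture \<alpha> s L x)))"

lemma picture_nonempty: "x \<in> X \<Longrightarrow> \<exists>p. p \<in> picture \<alpha> s L x"
  unfolding picture_iff using represents_exists by metis

text \<open>
  The picture is closed because it is the preimage of the compact set \<open>\<phi> ` X\<close> under the quotient map.
\<close>

lemma closed_total_picture:
  assumes "pictured \<alpha> L \<phi>"
  shows "closed (\<Union>x\<in>X. picture \<alpha> s L x)"
proof -
  obtain q :: "real \<times> real \<Rightarrow> real \<times> real" where q: "quotient_map euclidean euclidean q"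
      "\<And>x p. x \<in> X \<Longrightarrow> p \<in> picture \<alpha> s L x \<Longrightarrow> q p = \<phi> x"
      "\<And>p p'. q p = q p' \<longleftrightarrow> p = p' \<or> (\<exists>x\<in>X. p \<in> picture \<alpha> s L x \<and> p' \<in> picture \<alpha> s L x)"
    using assms unfolding pictured_def by blast
  have "(\<Union>x\<in>X. picture \<alpha> s L x) = q -` (\<phi> ` X)"
  proof (intro equalityI subsetI)
    fix p assume "p \<in> q -` (\<phi> ` X)"
    then obtain x where x: "x \<in> X" "q p = \<phi> x" by auto
    obtain p0 where p0: "p0 \<in> picture \<alpha> s L x" using picture_nonempty[OF x(1)] by blast
    then have "q p = q p0" using q(2) x by simp
    then show "p \<in> (\<Union>x\<in>X. picture \<alpha> s L x)" using q(3) p0 x by blast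
  qed (use q(2) in auto)
  moreover have "continuous_on UNIV q"
    using quotient_imp_continuous_map[OF q(1)] by simp
  ultimately show ?thesis
    using assms closed_vimage[of "\<phi> ` X" q] unfolding pictured_def by simp
qed

text \<open>By \<open>piece_contact\<close> both pieces have the end of an arc there. Equal heights
  give equal left parts, hence one thread, and to the right of index 0 both itineraries are
  \<nu>.\<close>

lemma contact_point:
  assumes \<beta>: "0 < \<beta>" and y: "y \<in> X" "(1/2, w) \<in> piece \<beta> s L False y"
    and y': "y' \<in> X" "(1/2, w) \<in> piece \<beta> s L True y'"
  obtains a b where "joined s y a b 0" "w = hgt L a"
proof -
  have e: "excess \<beta> (side_heights s L False) (side_heights s L True) 0 w"
      "excess \<beta> (side_heights s L True) (side_heights s L False) 0 w"
    using piece_excess[OF y \<beta>] piece_excess[OF y' \<beta>] by (simp_all add: beyond_def)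
  obtain a where a: "represents s a y" "\<not> a 0" "y 0 = 1/2" "w = hgt L a"
    by (rule piece_contact[OF y \<beta>]) (use e in auto)
  obtain b where b: "represents s b y'" "b 0" "y' 0 = 1/2" "w = hgt L b"
    by (rule piece_contact[OF y' \<beta>]) (use e in auto)
  have left: "left_part a j = left_part b j" if "1 \<le> j" for j
    using height_inj[of L "left_part a" "left_part b"] a b that by simp
  have "y = y'" using limit_eqI[OF y(1) y'(1) a(1) b(1) _ left] a b by simp
  have right: "a (int m) = \<nu> m" "b (int m) = \<nu> m" if "1 \<le> m" for m
    using represents_after_turn[OF y(1) a(1), of 0 m] represents_after_turn[OF y'(1) b(1), of 0 m]
        a b that
    by (simp_all add: coord_0)
  have "a i = b i" if "i \<noteq> 0" for i
    using left[of "nat (- i)"] right[of "nat i"] that by (cases "i < 0") (auto simp: left_part_def)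
  then have "identified_at s 0 a b"
    using a(2) b(2) right by (auto simp: identified_at_def)
  then show thesis using that[of a b] a b \<open>y = y'\<close> by (simp add: joined_def)
qed

end

subsection \<open>Unfolding the picture\<close>

lemma continuous_on_one_sided_lipschitz:
  fixes f :: "real \<Rightarrow> real"
  assumes "0 \<le> \<delta>" and lip: "\<And>v w. f v \<le> f w + \<delta> * \<bar>v - w\<bar>"
  shows "continuous_on UNIV f"
proof -
  have "\<delta>-lipschitz_on UNIV f"
  proof (rule lipschitz_onI)
    fix x y
    have "\<bar>f x - f y\<bar> \<le> \<delta> * \<bar>x - y\<bar>"
      using lip[of x y] lip[of y x] unfolding abs_minus_commute[of y x] by linarith
    then show "dist (f x) (f y) \<le> \<delta> * dist x y" by (simp add: dist_real_def)
  qed (use assms(1) in simp)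
  then show ?thesis by (rule lipschitz_on_continuous_on)
qed

context tent_map
begin

text \<open>Closedness of the picture for \<open>tail_seq L\<close> is not yet available. The limit
  point is folded into the picture for \<open>L\<close>, which is closed, and its origin there is
  analysed.\<close>

lemma closure_fold_arm:
  assumes \<alpha>: "0 < \<alpha>" "\<alpha> \<le> 1" and L: "\<not> L 1" and \<phi>: "pictured \<alpha> L \<phi>"
    and c: "(1/2, v) \<in> closure (\<Union>y\<in>X. piece (\<alpha> / (3 * s)) s (tail_seq L) e y)"
  shows "(1/2, v) \<in> (\<Union>y\<in>X. piece (\<alpha> / (3 * s)) s (tail_seq L) e y)"
proof -
  define \<beta> where "\<beta> = \<alpha> / (3 * s)"
  have \<beta>: "0 < \<beta>" "\<beta> \<le> 1" using \<alpha> s1 by (simp_all add: \<beta>_def field_simps)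
  let ?S = "\<Union>y\<in>X. piece \<beta> s (tail_seq L) e y"
  let ?P = "\<Union>x\<in>X. picture \<alpha> s L x"
  have unit: "0 \<le> w \<and> w \<le> 1" if "p \<in> piece \<beta> s (tail_seq L) e' y" "y \<in> X" "w = snd p" for p w e' y
    using piece_bound(2,3)[OF that(2) _ \<beta>, of "fst p" w] that by auto
  have "?S \<subseteq> UNIV \<times> {0..1}"
    using unit by (auto simp: mem_Times_iff)
  then have "closure ?S \<subseteq> UNIV \<times> {0..1}"
    by (intro closure_minimal closed_Times) auto
  then have v: "0 \<le> v" using c by (auto simp: \<beta>_def)
  have "continuous_on UNIV (fold_arm s e)"
    unfolding fold_arm_def by (cases e) (auto intro!: continuous_intros)
  then have "fold_arm s e ` closure ?S \<subseteq> closure (fold_arm s e ` ?S)"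
    by (intro image_closure_subset) (auto intro: closure_subset[THEN subsetD] continuous_on_subset)
  also have "\<dots> \<subseteq> ?P"
  proof (rule closure_minimal[OF _ closed_total_picture[OF \<phi>]])
    show "fold_arm s e ` ?S \<subseteq> ?P"
      using fold_arm_picture[where L = L, OF s0 L] prolong_limit by (fastforce simp: \<beta>_def)
  qed
  finally have "fold_arm s e (1/2, v) \<in> ?P" using c by (auto simp: \<beta>_def)
  then obtain x where "x \<in> X" "fold_arm s e (1/2, v) \<in> picture \<alpha> s L x" by blast
  then obtain y where y: "y \<in> X" "fold_arm s e (1/2, v) \<in> picture \<alpha> s L (prolong s y)"
    by (metis limit_prolong)
  from s0 L y(2) show ?thesis
  proof (cases rule: picture_prolong_cases)
    case (arm e' p')
    \<comment> \<open>Nonnegative heights are folded to at least 2/3 or to at most 1/3, so the band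
      reveals the side.\<close>
    have "0 \<le> snd p'" using unit arm(1) y(1) unfolding \<beta>_def by blast
    then have "e' = e"
      using arg_cong[OF arm(2), of snd] v by (cases e; cases e') (auto simp: fold_arm_def)
    then have "p' = (1/2, v)" using fold_arm_inj[OF s0, of e "(1/2, v)" p'] arm(2) \<open>e' = e\<close> by simp
    then show ?thesis using arm(1) y(1) \<open>e' = e\<close> by blast
  next
    case (turn a b)
    let ?w = "hgt (tail_seq L) a"
    have w: "0 \<le> ?w" by (rule height_bounds)
    note t = turning_cap_prolong[where L = L, OF s0 L turn(1)]
    \<comment> \<open>The folded point has abscissa s/2, which the half ellipse meets only at its
      two ends.\<close>
    define R z where "R = ?w / 3 + 1/6" and "z = snd (fold_arm s e (1/2, v)) - 1/2"
    have "\<bar>z\<bar> \<le> R" "0 = \<alpha> * sqrt (R\<^sup>2 - z\<^sup>2)"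
      using turn(2) unfolding half_ellipse_fold[OF \<alpha>(1) w] R_def z_def by (auto simp: fold_arm_def)
    then have "R\<^sup>2 = z\<^sup>2" using \<alpha> by simp
    moreover have "z\<^sup>2 = (v / 3 + 1/6)\<^sup>2"
      by (auto simp: z_def fold_arm_def power2_eq_square field_simps)
    ultimately have vw: "v = ?w"
      using w v power2_eq_iff_nonneg[of R "v / 3 + 1/6"] by (simp add: R_def)
    obtain d where d: "d \<in> {a, b}" "d 0 = e"
      using turn(1) by (cases "a 0 = e") (auto simp: joined_def identified_at_def)
    then have "represents s d y" "hgt (tail_seq L) d = v"
      using turn(1) t(2) vw by (auto simp: joined_def)
    then have "(1/2, v) \<in> piece \<beta> s (tail_seq L) e y"
      using t(1) d(2) unfolding piece_def by auto
    then show ?thesis using y(1) by (auto simp: \<beta>_def)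
  qed
qed

text \<open>The cut is made before the fold, between the two sides \<open>A False\<close> and
  \<open>A True\<close>, and \<open>G\<close> is the unfolding along it. As q is constant on the
  fibres of \<open>G\<close>, it induces a map q' with q' \<circ> \<open>G\<close> = q, and q' is
  the new quotient map.\<close>

lemma pictured_unfold:
  assumes \<alpha>: "0 < \<alpha>" "\<alpha> \<le> 1" and L: "\<not> L 1" and \<phi>: "pictured \<alpha> L \<phi>"
  shows "pictured (\<alpha> / (3 * s)) (tail_seq L) (\<phi> \<circ> prolong s)"
proof -
  define \<beta> where "\<beta> = \<alpha> / (3 * s)"
  have \<beta>: "0 < \<beta>" "\<beta> \<le> 1" using \<alpha> s1 by (simp_all add: \<beta>_def field_simps)
  define L' where "L' = tail_seq L"
  obtain q :: "real \<times> real \<Rightarrow> real \<times> real" where q: "quotient_map euclidean euclidean q"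
      "\<And>x p. x \<in> X \<Longrightarrow> p \<in> picture \<alpha> s L x \<Longrightarrow> q p = \<phi> x"
      "\<And>p p'. q p = q p' \<longleftrightarrow> p = p' \<or> (\<exists>x\<in>X. p \<in> picture \<alpha> s L x \<and> p' \<in> picture \<alpha> s L x)"
    and inj: "inj_on \<phi> X" and cl: "closed (\<phi> ` X)"
    using \<phi> unfolding pictured_def by blast
  define A where "A e = (\<Union>y\<in>X. piece \<beta> s L' e y)" for e
  have exc: "excess \<beta> (side_heights s L' e) (side_heights s L' (\<not> e)) (beyond e u) w"
    and bnd: "beyond e u \<le> 1/2" "0 \<le> w" "w \<le> 1" if "(u, w) \<in> A e" for u w e
    using piece_excess[OF _ _ \<beta>(1)] piece_bound[OF _ _ \<beta>] that unfolding A_def by blast+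
  have exF: "excess \<beta> (side_heights s L' False) (side_heights s L' True) (u - 1/2) w" if
      "(u, w) \<in> A False" for u w
    using exc[OF that] by (simp add: beyond_def)
  have exT: "excess \<beta> (side_heights s L' True) (side_heights s L' False) (1/2 - u) w" if
      "(u, w) \<in> A True" for u w
    using exc[OF that] by (simp add: beyond_def)
  have sum: "u - u' \<le> \<beta> * \<bar>w - w'\<bar>" if "(u, w) \<in> A False" "(u', w') \<in> A True" for u w u' w'
    using excess_sum_le[OF \<beta>(1) exF[OF that(1)] exT[OF that(2)]] by simp
  have below: "u \<le> 1" if "(u, w) \<in> A False" for u w
    using bnd(1)[OF that] by (simp add: beyond_def)
  have above: "0 \<le> u" if "(u, w) \<in> A True" for u w
    using bnd(1)[OF that] by (simp add: beyond_def)
  obtain zm zp where z: "\<And>v w. zm v \<le> zm w + 6/5 * \<beta> * \<bar>v - w\<bar>"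
      "\<And>v w. zp v \<le> zp w + 6/5 * \<beta> * \<bar>v - w\<bar>"
    "\<And>v. zm v \<le> zp v" "\<And>u w. (u, w) \<in> A False \<Longrightarrow> u \<le> zm w" "\<And>u w. (u, w) \<in> A True \<Longrightarrow> zp w \<le> u"
    "\<And>v. zm v = zp v \<Longrightarrow> (zm v, v) \<in> closure (A False) \<inter> closure (A True)"
    by (rule cut_between[where T = "A False" and B = "A True", OF \<beta>(1) sum below above])
        (assumption | rule that)+
  \<comment> \<open>Common limit points of the sides lie on the turning line by
    \<open>excess_closure\<close> and belong to both sides by
    \<open>closure_fold_arm\<close>.\<close>
  have contact: "zm v = 1/2 \<and> (1/2, v) \<in> A False \<and> (1/2, v) \<in> A True" if "zm v = zp v" for v
  proof -
    note c = z(6)[OF that]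
    have half: "zm v = 1/2"
      using excess_closure[OF \<beta>(1) exF exT] c by blast
    then show ?thesis
      using closure_fold_arm[where L = L, OF \<alpha> L \<phi>, of v] c
      unfolding half A_def \<beta>_def[symmetric] L'_def[symmetric] by blast
  qed
  have lip: "s * (6/5 * \<beta> * \<bar>y - y0\<bar>) = 2 * \<alpha> / 5 * \<bar>y - y0\<bar>" for y y0
    using s0 by (simp add: \<beta>_def)
  interpret fold_cut s \<alpha> zm zp
  proof
    show "zm y = 1/2 \<and> 0 \<le> y \<and> y \<le> 1" if "zm y = zp y" for y
      using contact[OF that] bnd by blast
    show "s * (zm y - 1/2) \<le> 2 * \<alpha> / 5 * \<bar>y - y0\<bar>" if "zm y0 = zp y0" for y y0
      using contact[OF that] z(1)[of y y0] s0 unfolding lip[symmetric]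
          by (intro mult_left_mono) auto
    show "s * (1/2 - zp y) \<le> 2 * \<alpha> / 5 * \<bar>y - y0\<bar>" if "zm y0 = zp y0" for y y0
      using contact[OF that] z(2)[of y0 y] s0 that unfolding lip[symmetric]
      by (intro mult_left_mono) (auto simp: abs_minus_commute)
  qed (use s0 \<alpha> z(3) in auto)
  define G where "G = unbend s \<alpha> zm zp"
  have "0 \<le> 6/5 * \<beta>" using \<beta> by simp
  then have "continuous_on UNIV zm" "continuous_on UNIV zp"
    using continuous_on_one_sided_lipschitz[OF _ z(1)]
        continuous_on_one_sided_lipschitz[OF _ z(2)] by blast+
  then have G: "quotient_map euclidean euclidean G"
    unfolding G_def by (intro unbend_quotient s0 \<alpha> z(3))
  have G_arm: "G (fold_arm s e p) = p" if "p \<in> piece \<beta> s L' e y" "y \<in> X" for p e y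
  proof -
    obtain u w where p: "p = (u, w)" by (cases p)
    have a: "(u, w) \<in> A e" using that p by (auto simp: A_def)
    show ?thesis
      using unbend_top[OF s0 \<alpha>(1), of w u zm zp] unbend_bottom[OF s0 \<alpha>(1), of w zp u zm]
          a z(4,5) bnd(2)
      by (cases e) (auto simp: p G_def fold_arm_def)
  qed
  have at_turn: "(1/2, hgt L' a) \<in> piece \<beta> s L' (a 0) y \<and> (1/2, hgt L' a) \<in> piece \<beta> s L' (b 0) y \<and>
      a 0 \<noteq> b 0"
    if j: "joined s y a b 0" for a b y
  proof -
    have "represents s a y" "represents s b y" using j by (auto simp: joined_def)
    moreover have "a 0 \<noteq> b 0" using j by (auto simp: joined_def identified_at_def)
    ultimately show ?thesis
      using turning_cap_prolong(1,2)[where L = L, OF s0 L j] unfolding piece_def L'_def[symmetric]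
          by auto
  qed
  have G_turn: "G p = (1/2, hgt L' a)"
    if j: "joined s y a b 0" "y \<in> X" and p: "p \<in> half_ellipse \<alpha> False (s/2) ((hgt L' a + 2) / 3)
        ((1 - hgt L' a) / 3)" for p a b y
  proof -
    have "(1/2, hgt L' a) \<in> A False" "(1/2, hgt L' a) \<in> A True"
      using at_turn[OF j(1)] j(2) unfolding A_def by (cases "a 0"; auto)+
    \<comment> \<open>Both sides contain (1/2, w) for this height w, so \<open>zp\<close> \<le> 1/2
      \<le> \<open>zm\<close> there: the cut closes at every turning point.\<close>
    then have "zm (hgt L' a) = zp (hgt L' a)"
      using z(3)[of "hgt L' a"] z(4,5) by force
    then show ?thesis using unbend_cap p unfolding G_def by blast
  qed
  have G_pic: "G p \<in> picture \<beta> s L' y" if y: "y \<in> X" and p: "p \<in> picture \<alpha> s L (prolong s y)"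
      for p y
    using s0 L p
  proof (cases rule: picture_prolong_cases)
    case (arm e p')
    then show ?thesis using G_arm[OF _ y, of p' e] unfolding \<beta>_def[symmetric] L'_def[symmetric]
      by (cases e) (auto simp: picture_def)
  next
    case (turn a b)
    then show ?thesis
      using G_turn[OF turn(1) y, of p] at_turn[OF turn(1)] unfolding L'_def[symmetric]
      by (cases "a 0") (auto simp: picture_def)
  qed
  \<comment> \<open>A nontrivial fibre of \<open>G\<close> lies on a half ellipse at a height where
    the cut closes; \<open>contact_point\<close> identifies it as a cap of the picture.\<close>
  have G_fib: "p = p' \<or> (\<exists>x\<in>X. p \<in> picture \<alpha> s L x \<and> p' \<in> picture \<alpha> s L x)" if "G p = G p'" for p p'
  proof (rule disjCI)
    assume "\<not> (\<exists>x\<in>X. p \<in> picture \<alpha> s L x \<and> p' \<in> picture \<alpha> s L x)"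
    moreover have "\<exists>x\<in>X. half_ellipse \<alpha> False (s/2) ((w + 2) / 3) ((1 - w) / 3) \<subseteq> picture \<alpha> s L x"
        if w: "zm w = zp w" for w
    proof -
      obtain y y' where "y \<in> X" "(1/2, w) \<in> piece \<beta> s L' False y" "y' \<in> X"
          "(1/2, w) \<in> piece \<beta> s L' True y'"
        using contact[OF w] by (auto simp: A_def)
      then obtain a b where "joined s y a b 0" "w = hgt L' a"
        using contact_point[OF \<beta>(1)] by metis
      then show ?thesis
        using turning_cap_picture[where L = L, OF s0 L, of y a b \<alpha>] prolong_limit \<open>y \<in> X\<close>
            unfolding L'_def by blast
    qed
    ultimately show "p = p'"
      using unbend_fibres[of p p'] that unfolding G_def by blast
  qed
  have contq: "continuous_map euclidean euclidean q" by (rule quotient_imp_continuous_map[OF q(1)])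
  obtain q' where q': "continuous_map euclidean euclidean q'" "\<And>p. q' (G p) = q p"
    by (rule quotient_map_lift_exists[OF G contq]) (use G_fib q(3) in auto)
  have surjG: "\<exists>p. P = G p" for P
    by (rule surjD[OF quotient_imp_surjective_map[OF G, unfolded topspace_euclidean]])
  have "q' \<circ> G = q" using q'(2) by auto
  then have quot: "quotient_map euclidean euclidean q'"
    using quotient_map_from_composition[OF quotient_imp_continuous_map[OF G] q'(1)] q(1) by simp
  have val: "q' P = \<phi> (prolong s y)" if y: "y \<in> X" and P: "P \<in> picture \<beta> s L' y" for P y
  proof -
    obtain e where e: "P \<in> piece \<beta> s L' e y" using P by (auto simp: picture_def)
    then have "fold_arm s e P \<in> picture \<alpha> s L (prolong s y)"
      using fold_arm_picture[where L = L, OF s0 L] unfolding \<beta>_def L'_def by blast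
    then have "q (fold_arm s e P) = \<phi> (prolong s y)" using q(2) prolong_limit y by blast
    then show ?thesis using q'(2)[of "fold_arm s e P"] G_arm[OF e y] by simp
  qed
  have fib: "q' P = q' P' \<longleftrightarrow> P = P' \<or> (\<exists>y\<in>X. P \<in> picture \<beta> s L' y \<and> P' \<in> picture \<beta> s L' y)" for P P'
  proof
    assume eq: "q' P = q' P'"
    obtain p p' where p: "P = G p" "P' = G p'" using surjG by metis
    then have "q p = q p'" using eq q'(2) by simp
    then consider "p = p'" | x where "x \<in> X" "p \<in> picture \<alpha> s L x" "p' \<in> picture \<alpha> s L x"
      using q(3) by blast
    then show "P = P' \<or> (\<exists>y\<in>X. P \<in> picture \<beta> s L' y \<and> P' \<in> picture \<beta> s L' y)"
    proof cases
      case 2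
      then obtain y where "y \<in> X" "x = prolong s y" by (metis limit_prolong)
      then show ?thesis using G_pic 2 p by blast
    qed (use p in simp)
  next
    assume "P = P' \<or> (\<exists>y\<in>X. P \<in> picture \<beta> s L' y \<and> P' \<in> picture \<beta> s L' y)"
    then show "q' P = q' P'" by (elim disjE bexE conjE) (simp_all only: val)
  qed
  have "inj_on (\<phi> \<circ> prolong s) X"
    by (rule comp_inj_on) (use inj prolong_inj prolong_image in \<open>auto intro!: inj_onI\<close>)
  moreover have "closed ((\<phi> \<circ> prolong s) ` X)"
    using cl prolong_image by (metis image_comp)
  ultimately show ?thesis
    unfolding pictured_def \<beta>_def[symmetric] L'_def[symmetric] using quot val fib by auto
qed

section \<open>Reflection, iteration and uniqueness\<close>

lemma picture_reflect:
  "p \<in> picture \<alpha> s (L(1 := \<not> L 1)) x \<longleftrightarrow> (fst p, 1 - snd p) \<in> picture \<alpha> s L x"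
proof -
  have h: "height (L(1 := \<not> L 1)) l = 1 - height L l" for l
  proof -
    define A where "A = height (tail_seq L) (tail_seq l)"
    have "height (tail_seq (L(1 := \<not> L 1))) (tail_seq l) = A"
      unfolding A_def by (rule height_cong) auto
    then show ?thesis
      unfolding height_rec[of "L(1 := \<not> L 1)" l] height_rec[of L l, folded A_def]
      by (simp only:) (auto simp: field_simps)
  qed
  have e: "p \<in> half_ellipse \<alpha> lf t (1 - y) (1 - z) \<longleftrightarrow> (fst p, 1 - snd p) \<in> half_ellipse \<alpha> lf t y z"
      for lf t y z
  proof -
    have "(snd p - (1 - y)) * (1 - z - snd p) = (1 - snd p - y) * (z - (1 - snd p))"
        by (simp add: algebra_simps)
    then show ?thesis by (cases p) (simp add: half_ellipse_def)
  qed
  have "p = (x 0, 1 - y) \<longleftrightarrow> (fst p, 1 - snd p) = (x 0, y)" for y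
    by (auto simp: prod_eq_iff)
  then show ?thesis
    unfolding picture_iff cap_def h e by simp
qed

text \<open>Changing the first symbol of \<open>L\<close> changes the sign of every term in the
  heights, which reflects the plane in the line of height 1/2. This reduces the unfolding to
  sequences that start with 0.\<close>

lemma pictured_reflect:
  assumes "pictured \<alpha> L \<phi>"
  shows "pictured \<alpha> (L(1 := \<not> L 1)) \<phi>"
proof -
  let ?R = "\<lambda>p :: real \<times> real. (fst p, 1 - snd p)"
  obtain q :: "real \<times> real \<Rightarrow> real \<times> real" where q: "quotient_map euclidean euclidean q"
      "\<And>x p. x \<in> X \<Longrightarrow> p \<in> picture \<alpha> s L x \<Longrightarrow> q p = \<phi> x"
      "\<And>p p'. q p = q p' \<longleftrightarrow> p = p' \<or> (\<exists>x\<in>X. p \<in> picture \<alpha> s L x \<and> p' \<in> picture \<alpha> s L x)"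
    using assms unfolding pictured_def by blast
  have "quotient_map euclidean euclidean ?R"
    by (rule homeo_quotient[of _ ?R]) (auto intro!: continuous_intros)
  then have "quotient_map euclidean euclidean (q \<circ> ?R)"
    using q(1) by (rule quotient_map_compose)
  moreover have "(q \<circ> ?R) p = (q \<circ> ?R) p' \<longleftrightarrow> p = p' \<or>
      (\<exists>x\<in>X. p \<in> picture \<alpha> s (L(1 := \<not> L 1)) x \<and> p' \<in> picture \<alpha> s (L(1 := \<not> L 1)) x)" for p p'
    unfolding picture_reflect comp_apply q(3) by (auto simp: prod_eq_iff)
  moreover have "(q \<circ> ?R) p = \<phi> x" if "x \<in> X" "p \<in> picture \<alpha> s (L(1 := \<not> L 1)) x" for x p
    using that q(2) unfolding picture_reflect by simp
  ultimately show ?thesis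
    using assms unfolding pictured_def by blast
qed

lemma pictured_cong: "(\<And>j. 1 \<le> j \<Longrightarrow> L j = L' j) \<Longrightarrow> pictured \<alpha> L \<phi> \<longleftrightarrow> pictured \<alpha> L' \<phi>"
  unfolding pictured_def using picture_cong[of L L'] by simp

lemma pictured_tail:
  assumes \<alpha>: "0 < \<alpha>" "\<alpha> \<le> 1" and \<phi>: "pictured \<alpha> L \<phi>"
  shows "pictured (\<alpha> / (3 * s)) (tail_seq L) (\<phi> \<circ> prolong s)"
proof (cases "L 1")
  case True
  have "pictured (\<alpha> / (3 * s)) (tail_seq (L(1 := \<not> L 1))) (\<phi> \<circ> prolong s)"
    by (rule pictured_unfold[OF \<alpha> _ pictured_reflect[OF \<phi>]]) (use True in simp)
  then show ?thesis
    by (rule pictured_cong[THEN iffD1, rotated]) auto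
qed (use pictured_unfold assms in blast)

lemma pictured_iterate:
  assumes "pictured 1 L \<phi>"
  shows "pictured ((1 / (3 * s)) ^ n) (\<lambda>k. L (k + n)) (\<phi> \<circ> (prolong s ^^ n))"
proof (induction n)
  case (Suc n)
  have "0 < 1 / (3 * s)" "1 / (3 * s) \<le> 1" using s1 by (simp_all add: field_simps)
  then have "0 < (1 / (3 * s)) ^ n" "(1 / (3 * s)) ^ n \<le> 1" by (auto intro: power_le_one)
  from pictured_tail[OF this Suc] show ?case
    by (simp add: comp_assoc funpow_Suc_right[symmetric] del: funpow.simps)
        (simp add: mult.commute funpow_swap1 o_def)
qed (use assms in simp)

text \<open>The picture prescribes the fibres of both quotient maps, so one factors through the
  other by an injective quotient map, that is, a homeomorphism.\<close>

lemma pictured_unique: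
  assumes "pictured \<alpha> L \<phi>" "pictured \<alpha> L \<psi>"
  obtains h :: "real \<times> real \<Rightarrow> real \<times> real" where "homeomorphic_map euclidean euclidean h"
      "\<And>x. x \<in> X \<Longrightarrow> h (\<phi> x) = \<psi> x"
proof -
  let ?f = "\<lambda>p p'. p = p' \<or> (\<exists>x\<in>X. p \<in> picture \<alpha> s L x \<and> p' \<in> picture \<alpha> s L x)"
  obtain q :: "real \<times> real \<Rightarrow> real \<times> real" where q: "quotient_map euclidean euclidean q"
      "\<And>x p. x \<in> X \<Longrightarrow> p \<in> picture \<alpha> s L x \<Longrightarrow> q p = \<phi> x" "\<And>p p'. q p = q p' \<longleftrightarrow> ?f p p'"
    using assms(1) unfolding pictured_def by blast
  obtain r :: "real \<times> real \<Rightarrow> real \<times> real" where r: "quotient_map euclidean euclidean r"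
      "\<And>x p. x \<in> X \<Longrightarrow> p \<in> picture \<alpha> s L x \<Longrightarrow> r p = \<psi> x" "\<And>p p'. r p = r p' \<longleftrightarrow> ?f p p'"
    using assms(2) unfolding pictured_def by blast
  have same: "q p = q p' \<longleftrightarrow> r p = r p'" for p p' by (simp only: q(3) r(3))
  obtain h where h: "continuous_map euclidean euclidean h" "\<And>p. h (q p) = r p"
    by (rule quotient_map_lift_exists[OF q(1) quotient_imp_continuous_map[OF r(1)]])
        (use same in auto)
  have "h \<circ> q = r" using h(2) by auto
  then have "quotient_map euclidean euclidean h"
    using quotient_map_from_composition[OF quotient_imp_continuous_map[OF q(1)] h(1)] r(1) by simp
  moreover have surj: "\<exists>p. P = q p" for P
    by (rule surjD[OF quotient_imp_surjective_map[OF q(1), unfolded topspace_euclidean]])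
  have "inj h"
  proof (rule injI)
    fix P P' assume eq: "h P = h P'"
    obtain p p' where p: "P = q p" "P' = q p'"
      using surj by metis
    then show "P = P'" using eq h(2) same by simp
  qed
  moreover have "h (\<phi> x) = \<psi> x" if x: "x \<in> X" for x
  proof -
    obtain p where "p \<in> picture \<alpha> s L x" using picture_nonempty[OF x] by blast
    then show ?thesis using h(2)[of p] q(2) r(2) x by simp
  qed
  ultimately show thesis using that by (simp add: homeomorphic_map_def)
qed

lemma compact_limit: "compact X"
proof -
  have "compact (Pi\<^sub>E UNIV (\<lambda>_::nat. {0..1::real}))"
    using compactin_PiE[of "\<lambda>_. euclidean" "UNIV :: nat set" "\<lambda>_. {0..1::real}"]
    by (simp add: euclidean_product_topology)
  moreover have "closed {x :: nat \<Rightarrow> real. T (x (Suc i)) = x i}" for i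
    unfolding tent_def
        by (intro closed_Collect_eq continuous_intros continuous_on_product_coordinates)
  then have "closed (\<Inter>i. {x. T (x (Suc i)) = x i})" by blast
  ultimately have "compact (Pi\<^sub>E UNIV (\<lambda>_. {0..1}) \<inter> (\<Inter>i. {x. T (x (Suc i)) = x i}))"
    by (rule compact_Int_closed)
  moreover have "X = Pi\<^sub>E UNIV (\<lambda>_. {0..1}) \<inter> (\<Inter>i. {x. T (x (Suc i)) = x i})"
    by (auto simp: tent_limit_def PiE_iff)
  ultimately show ?thesis by simp
qed

lemma is_phi_pictured:
  assumes "is_phi s L \<phi>"
  shows "pictured 1 L \<phi>"
proof -
  have e: "embedding_map (top_of_set X) euclidean \<phi>" using assms by (simp add: is_phi_def)
  have "continuous_on X \<phi>"
    using homeomorphic_imp_continuous_map[OF e[unfolded embedding_map_def]]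
    by (auto simp: continuous_map_in_subtopology)
  then have "closed (\<phi> ` X)" using compact_limit compact_continuous_image compact_imp_closed
      by blast
  moreover have "inj_on \<phi> X"
    using e by (auto simp: embedding_map_def homeomorphic_map_def)
  ultimately show ?thesis
    using assms drawn_picture unfolding is_phi_def pictured_def by simp
qed

end

theorem proposition7p8:
  fixes s :: real
    and L1 L2 :: "nat \<Rightarrow> bool"
    and \<phi>1 \<phi>2 :: "(nat \<Rightarrow> real) \<Rightarrow> real \<times> real"
  assumes "sqrt 2 < s" and "s \<le> 2"
    and "adm_left s L1" and "adm_left s L2"
    and "\<exists>n. \<forall>k>n. L1 k = L2 k"
    and "is_phi s L1 \<phi>1" and "is_phi s L2 \<phi>2"
  shows "equivalent_embeddings (tent_limit s) \<phi>1 \<phi>2"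
proof -
  have "1 < sqrt 2" by simp
  then interpret tent_map s using assms(1,2) by unfold_locales linarith+
  obtain n where n: "\<And>k. n < k \<Longrightarrow> L1 k = L2 k" using assms(5) by blast
  have "pictured ((1 / (3 * s)) ^ n) (\<lambda>k. L1 (k + n)) (\<phi>1 \<circ> (prolong s ^^ n))"
    using is_phi_pictured[OF assms(6)] by (rule pictured_iterate)
  moreover have "pictured ((1 / (3 * s)) ^ n) (\<lambda>k. L1 (k + n)) (\<phi>2 \<circ> (prolong s ^^ n))"
    using pictured_iterate[OF is_phi_pictured[OF assms(7)], of n]
    by (rule pictured_cong[THEN iffD1, rotated]) (use n in auto)
  ultimately obtain h :: "real \<times> real \<Rightarrow> real \<times> real" where h:
      "homeomorphic_map euclidean euclidean h"
      "\<And>y. y \<in> X \<Longrightarrow> h ((\<phi>1 \<circ> (prolong s ^^ n)) y) = (\<phi>2 \<circ> (prolong s ^^ n)) y"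
    by (rule pictured_unique) blast
  \<comment> \<open>Every thread is an n-fold prolongation, so the relation between the composed
    maps carries over to \<open>\<phi>1\<close> and \<open>\<phi>2\<close>.\<close>
  have "(prolong s ^^ n) ` X = X"
  proof (induction n)
    case (Suc n)
    then show ?case using prolong_image by (metis funpow.simps(2) image_comp)
  qed simp
  then have hx: "h (\<phi>1 x) = \<phi>2 x" if "x \<in> X" for x
    using h(2) that by (metis (no_types, lifting) comp_apply imageE)
  have "inj_on \<phi>1 X" using is_phi_pictured[OF assms(6)] by (simp add: pictured_def)
  then have "\<forall>p \<in> \<phi>1 ` X. h p = (\<phi>2 \<circ> inv_into X \<phi>1) p"
    using hx by (auto simp: inv_into_f_f)
  then show ?thesis
    using h(1) assms(6,7) unfolding equivalent_embeddings_def is_phi_def by blast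
qed

end
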